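(* Let $\mathcal{O}$ be an orbifold with underlying space $O$, let $n\ge 1$, and let $(x_1,\ldots,x_n)$ and $(y_1,\ldots,y_n)$ be two $n$-tuples of pairwise distinct points of $O$. Assume that for every $i$ the points $x_i$ and $y_i$ lie in the same connected component of the singular stratification, i.e. $y_i\in\Sigma(x_i)$. Assume furthermore that each connected component of $\Sigma_1$ contains at most one of the $x_i$'s. Then there exists an orbifold diffeomorphism $f:\mathcal{O}\rightarrow\mathcal{O}$, isotopic to the identity through a compactly supported isotopy, such that $f(x_i)=y_i$ for all $1\le i\le n$.
   Context: Orbifolds. Let $O$ be a topological space. A (smooth, $d$-dimensional) orbifold chart on $O$ is a triple $(\tilde U,\Gamma_U,\phi_U)$ with $\tilde U\subseteq\mathbb{R}^d$ open and connected, $\Gamma_U$ a finite group acting smoothly and effectively on $\tilde U$, and $\phi_U:\tilde U\to U$ a continuous map onto an open subset $U\subseteq O$ with $\phi_U\circ\gamma=\phi_U$ for all $\gamma\in\Gamma_U$, inducing a homeomorphism $\tilde U/\Gamma_U\cong U$. An embedding of charts $(\tilde U,\Gamma_U,\phi_U)\to(\tilde V,\Gamma_V,\phi_V)$ is a smooth embedding $\lambda:\tilde U\to\tilde V$ with $\phi_V\circ\lambda=\phi_U$. Two charts over $U,V$ are locally compatible if for each $p\in U\cap V$ there is a chart over some $W$ with $p\in W\subseteq U\cap V$ that embeds into both. An orbifold atlas is a collection of pairwise locally compatible charts covering $O$; two atlases are equivalent if they have a common refinement (an atlas refines another if each of its charts embeds into a chart of the other). An orbifold $\mathcal{O}$ is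 a paracompact Hausdorff space $O$ with a maximal orbifold atlas; $\dim\mathcal{O}=d$. Strata. For $x=\phi_U(\tilde x)$, the isotropy group is $\Gamma_x=\{\gamma\in\Gamma_U:\gamma\tilde x=\tilde x\}$ (well defined up to isomorphism). A chart $(\tilde U_x,\Gamma_x,\phi_x)$ is centered at $x$ if $x\in U_x$ and its group is isomorphic to $\Gamma_x$; then $x$ has a unique lift $\tilde x$, fixed by $\Gamma_x$, and $\Gamma_x$ acts on $T_{\tilde x}\tilde U_x$ by differentials. The singular dimension is $\mathrm{sdim}(x)=\dim (T_{\tilde x}\tilde U_x)^{\Gamma_x}$, the dimension of the fixed subspace (independent of the chart). Put $\Sigma_k=\{x\in O:\mathrm{sdim}(x)=k\}$ for $0\le k\le d$ (so $\Sigma_d$ is the set of points with trivial isotropy), with the subspace topology, and let $\Sigma(x)$ be the connected component of $\Sigma_{\mathrm{sdim}(x)}$ containing $x$. Each $\Sigma_k$ is naturally a $k$-dimensional manifold. Maps. A smooth orbifold map $f:\mathcal{O}\to\mathcal{P}$ is a continuous map $f:O\to P$ such that for every $x\in O$ there are charts $(\tilde U,\Gamma_U,\phi_U)$, $(\tilde V,\Gamma_V,\phi_V)$ containing $x$ and $f(x)$ with $f(U)\subseteq V$ and a smooth map $\tilde f:\tilde U\to\tilde V$ with $\phi_V\circ\tilde f=f\circ\phi_U$. It is an orbifold diffeomorphism if it has an inverse that is a smooth orbifold map. $\mathcal{O}\times[0,1]$ carries the product orbifold structure (charts $\tilde U\times I$, $I\subseteq[0,1]$ a relatively open interval, with $\Gamma_U$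 acting on the first factor). An isotopy from $f$ to $g$ (orbifold diffeomorphisms of $\mathcal{O}$) is a smooth orbifold map $F:\mathcal{O}\times[0,1]\to\mathcal{O}$ with $F(\cdot,0)=f$, $F(\cdot,1)=g$ and each $F(\cdot,t)$ an orbifold diffeomorphism. An isotopy starting or ending at the identity is compactly supported if there is a compact $K\subseteq O$ with $F(x,t)=x$ for all $x\notin K$ and all $t$. *)

theory Defs
  imports "HOL-Analysis.Analysis" "HOL-Algebra.Group_Action"
begin

section \<open>Topological preliminaries\<close>

definition paracompact_space :: "'a topology \<Rightarrow> bool" where
  "paracompact_space X \<longleftrightarrow>
     (\<forall>\<U>. (\<forall>U\<in>\<U>. openin X U) \<and> topspace X \<subseteq> \<Union>\<U> \<longrightarrow>
       (\<exists>\<V>. (\<forall>V\<in>\<V>. openin X V \<and> (\<exists>U\<in>\<U>. V \<subseteq> U)) \<and> topspace X \<subseteq> \<Union>\<V>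
            \<and> locally_finite_in X \<V>))"

definition quotient_topology :: "'a topology \<Rightarrow> ('a \<Rightarrow> 'b) \<Rightarrow> 'b topology" where
  "quotient_topology X q =
     topology (\<lambda>S. S \<subseteq> q ` topspace X \<and> openin X {x \<in> topspace X. q x \<in> S})"

lemma openin_quotient_topology:
  "openin (quotient_topology X q) S \<longleftrightarrow>
     S \<subseteq> q ` topspace X \<and> openin X {x \<in> topspace X. q x \<in> S}"
proof -
  have "istopology (\<lambda>S. S \<subseteq> q ` topspace X \<and> openin X {x \<in> topspace X. q x \<in> S})"
    unfolding istopology_def
  proof (intro conjI allI impI, goal_cases)
    case (1 S T) then show ?case by blast
  next
    case (2 S T)
    have "{x \<in> topspace X. q x \<in> S \<inter> T} =
          {x \<in> topspace X. q x \<in> S} \<inter> {x \<in> topspace X. q x \<in> T}" by blast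
    with 2 show ?case by auto
  next
    case (3 K) then show ?case by blast
  next
    case (4 K)
    have "{x \<in> topspace X. q x \<in> \<Union>K} = (\<Union>S\<in>K. {x \<in> topspace X. q x \<in> S})" by blast
    with 4 show ?case by auto
  qed
  then show ?thesis
    by (simp add: quotient_topology_def topology_inverse')
qed

section \<open>Smooth maps\<close>

text \<open>\<open>Ck_on\<close> is meant for open sets \<open>W\<close> in finite-dimensional spaces, where it says that all
  iterated directional derivatives of order up to \<open>k\<close> exist and are continuous.\<close>

primrec Ck_on ::
    "nat \<Rightarrow> ('e::real_normed_vector \<Rightarrow> 'f::real_normed_vector) \<Rightarrow> 'e set \<Rightarrow> bool" where
  "Ck_on 0 f W \<longleftrightarrow> continuous_on W f"
| "Ck_on (Suc k) f W \<longleftrightarrow>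
     (\<forall>x\<in>W. f differentiable (at x)) \<and>
     (\<forall>v. Ck_on k (\<lambda>x. frechet_derivative f (at x) v) W)"

text \<open>Smoothness on an arbitrary subset: locally the restriction of a smooth map defined on an
  open set. On open sets this is ordinary smoothness. The general form is needed for
  domains \<open>U \<times> I\<close> where \<open>I\<close> contains an endpoint of \<open>[0,1]\<close>, and for relatively open
  subsets of a linear subspace.\<close>

definition smooth_on :: "('e::euclidean_space \<Rightarrow> 'f::euclidean_space) \<Rightarrow> 'e set \<Rightarrow> bool" where
  "smooth_on f S \<longleftrightarrow>
     (\<forall>x\<in>S. \<exists>W g. open W \<and> x \<in> W \<and> (\<forall>k. Ck_on k g W) \<and> (\<forall>y\<in>S \<inter> W. g y = f y))"

definition smooth_embedding ::
    "('e::euclidean_space \<Rightarrow> 'f::euclidean_space) \<Rightarrow> 'e set \<Rightarrow> 'f set \<Rightarrow> bool" where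
  "smooth_embedding l S T \<longleftrightarrow>
     smooth_on l S \<and> l ` S \<subseteq> T \<and> (\<exists>m. smooth_on m (l ` S) \<and> (\<forall>x\<in>S. m (l x) = x))"

section \<open>Orbifold charts\<close>

text \<open>The model space \<open>\<real>\<^sup>d\<close> is represented by a linear subspace \<open>E\<close> with \<open>dim E = d\<close> of a
  Euclidean space; unlike a type of class \<open>euclidean_space\<close>, this also allows \<open>d = 0\<close>.
  A finite group acting effectively on \<open>U\<close> is the same as a finite subgroup of the group of
  bijections of \<open>U\<close>, so the group of a chart is given as such a subgroup.\<close>

record ('e, 'a) orb_chart =
  Dom :: "'e set"
  Grp :: "('e \<Rightarrow> 'e) set"
  Proj :: "'e \<Rightarrow> 'a"

definition chart_image :: "('e, 'a) orb_chart \<Rightarrow> 'a set" where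
  "chart_image c = Proj c ` Dom c"

definition chart_group :: "('e, 'a) orb_chart \<Rightarrow> ('e \<Rightarrow> 'e) monoid" where
  "chart_group c = (BijGroup (Dom c))\<lparr>carrier := Grp c\<rparr>"

definition chart_orbit :: "('e, 'a) orb_chart \<Rightarrow> 'e \<Rightarrow> 'e set" where
  "chart_orbit c = orbit (chart_group c) (\<lambda>\<gamma>. \<gamma>)"

definition orbit_space :: "('e::euclidean_space, 'a) orb_chart \<Rightarrow> 'e set topology" where
  "orbit_space c = quotient_topology (top_of_set (Dom c)) (chart_orbit c)"

definition orbifold_chart ::
    "'e::euclidean_space set \<Rightarrow> 'a topology \<Rightarrow> ('e, 'a) orb_chart \<Rightarrow> bool" where
  "orbifold_chart E X c \<longleftrightarrow>
     openin (top_of_set E) (Dom c) \<and> connected (Dom c) \<and>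
     finite (Grp c) \<and> subgroup (Grp c) (BijGroup (Dom c)) \<and>
     (\<forall>\<gamma>\<in>Grp c. smooth_on \<gamma> (Dom c)) \<and>
     continuous_map (top_of_set (Dom c)) X (Proj c) \<and> openin X (chart_image c) \<and>
     (\<forall>\<gamma>\<in>Grp c. \<forall>u\<in>Dom c. Proj c (\<gamma> u) = Proj c u) \<and>
     (\<exists>\<psi>. homeomorphic_map (orbit_space c) (subtopology X (chart_image c)) \<psi> \<and>
          (\<forall>u\<in>Dom c. \<psi> (chart_orbit c u) = Proj c u))"

definition chart_embedding ::
    "('e::euclidean_space, 'a) orb_chart \<Rightarrow> ('e, 'a) orb_chart \<Rightarrow> ('e \<Rightarrow> 'e) \<Rightarrow> bool" where
  "chart_embedding c c' l \<longleftrightarrow>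
     smooth_embedding l (Dom c) (Dom c') \<and> (\<forall>u\<in>Dom c. Proj c' (l u) = Proj c u)"

definition locally_compatible ::
    "'e::euclidean_space set \<Rightarrow> 'a topology \<Rightarrow> ('e, 'a) orb_chart \<Rightarrow> ('e, 'a) orb_chart \<Rightarrow> bool"
  where
  "locally_compatible E X c c' \<longleftrightarrow>
     (\<forall>p \<in> chart_image c \<inter> chart_image c'.
        \<exists>w. orbifold_chart E X w \<and> p \<in> chart_image w \<and>
            chart_image w \<subseteq> chart_image c \<inter> chart_image c' \<and>
            (\<exists>l. chart_embedding w c l) \<and> (\<exists>l. chart_embedding w c' l))"

section \<open>Orbifolds\<close>

definition orbifold_atlas ::
    "'e::euclidean_space set \<Rightarrow> 'a topology \<Rightarrow> ('e, 'a) orb_chart set \<Rightarrow> bool" where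
  "orbifold_atlas E X A \<longleftrightarrow>
     (\<forall>c\<in>A. orbifold_chart E X c) \<and>
     (\<forall>c\<in>A. \<forall>c'\<in>A. locally_compatible E X c c') \<and>
     (\<Union>c\<in>A. chart_image c) = topspace X"

definition orbifold ::
    "'e::euclidean_space set \<Rightarrow> 'a topology \<Rightarrow> ('e, 'a) orb_chart set \<Rightarrow> bool" where
  "orbifold E X A \<longleftrightarrow>
     subspace E \<and> paracompact_space X \<and> Hausdorff_space X \<and>
     orbifold_atlas E X A \<and> (\<forall>B. orbifold_atlas E X B \<and> A \<subseteq> B \<longrightarrow> B = A)"

section \<open>Singular dimension and strata\<close>

definition isotropy_group :: "('e, 'a) orb_chart \<Rightarrow> 'e \<Rightarrow> ('e \<Rightarrow> 'e) monoid" where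
  "isotropy_group c u = (chart_group c)\<lparr>carrier := stabilizer (chart_group c) (\<lambda>\<gamma>. \<gamma>) u\<rparr>"

definition centered_at :: "('e, 'a) orb_chart \<Rightarrow> 'a \<Rightarrow> bool" where
  "centered_at c x \<longleftrightarrow> (\<exists>u\<in>Dom c. Proj c u = x \<and> chart_group c \<cong> isotropy_group c u)"

text \<open>The differential of \<open>\<gamma>\<close> at \<open>u\<close> is determined on the tangent space \<open>E\<close>, because \<open>Dom c\<close> is
  open in \<open>E\<close>; outside of \<open>E\<close> the value of \<open>frechet_derivative\<close> is unspecified.\<close>

definition fixed_tangent_space ::
    "'e::euclidean_space set \<Rightarrow> ('e, 'a) orb_chart \<Rightarrow> 'e \<Rightarrow> 'e set" where
  "fixed_tangent_space E c u =
     {v \<in> E. \<forall>\<gamma>\<in>Grp c. frechet_derivative \<gamma> (at u within Dom c) v = v}"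

definition sdim ::
    "'e::euclidean_space set \<Rightarrow> ('e, 'a) orb_chart set \<Rightarrow> 'a \<Rightarrow> nat" where
  "sdim E A x =
     (THE k. \<exists>c\<in>A. centered_at c x \<and>
        (\<exists>u\<in>Dom c. Proj c u = x \<and> k = dim (fixed_tangent_space E c u)))"

definition stratum ::
    "'e::euclidean_space set \<Rightarrow> 'a topology \<Rightarrow> ('e, 'a) orb_chart set \<Rightarrow> nat \<Rightarrow> 'a set" where
  "stratum E X A k = {x \<in> topspace X. sdim E A x = k}"

definition stratum_component ::
    "'e::euclidean_space set \<Rightarrow> 'a topology \<Rightarrow> ('e, 'a) orb_chart set \<Rightarrow> 'a \<Rightarrow> 'a set" where
  "stratum_component E X A x =
     connected_component_of_set (subtopology X (stratum E X A (sdim E A x))) x"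

section \<open>Smooth orbifold maps and isotopies\<close>

definition smooth_orbifold_map ::
    "'a topology \<Rightarrow> ('e::euclidean_space, 'a) orb_chart set \<Rightarrow>
     'b topology \<Rightarrow> ('f::euclidean_space, 'b) orb_chart set \<Rightarrow> ('a \<Rightarrow> 'b) \<Rightarrow> bool" where
  "smooth_orbifold_map X A Y B f \<longleftrightarrow>
     continuous_map X Y f \<and>
     (\<forall>x\<in>topspace X. \<exists>c\<in>A. \<exists>d\<in>B.
        x \<in> chart_image c \<and> f x \<in> chart_image d \<and> f ` chart_image c \<subseteq> chart_image d \<and>
        (\<exists>h. smooth_on h (Dom c) \<and> h ` Dom c \<subseteq> Dom d \<and>
             (\<forall>u\<in>Dom c. Proj d (h u) = f (Proj c u))))"

definition orbifold_diffeomorphism ::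
    "'a topology \<Rightarrow> ('e::euclidean_space, 'a) orb_chart set \<Rightarrow> ('a \<Rightarrow> 'a) \<Rightarrow> bool" where
  "orbifold_diffeomorphism X A f \<longleftrightarrow>
     smooth_orbifold_map X A X A f \<and>
     (\<exists>g. smooth_orbifold_map X A X A g \<and>
          (\<forall>x\<in>topspace X. g (f x) = x) \<and> (\<forall>x\<in>topspace X. f (g x) = x))"

definition product_chart ::
    "('e, 'a) orb_chart \<Rightarrow> real set \<Rightarrow> ('e \<times> real, 'a \<times> real) orb_chart" where
  "product_chart c I =
     \<lparr>Dom = Dom c \<times> I,
      Grp = (\<lambda>\<gamma>. restrict (map_prod \<gamma> id) (Dom c \<times> I)) ` Grp c,
      Proj = map_prod (Proj c) id\<rparr>"

definition interval_product_space :: "'a topology \<Rightarrow> ('a \<times> real) topology" where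
  "interval_product_space X = prod_topology X (top_of_set {0..1})"

definition interval_product_atlas ::
    "('e, 'a) orb_chart set \<Rightarrow> ('e \<times> real, 'a \<times> real) orb_chart set" where
  "interval_product_atlas A =
     {product_chart c I | c I. c \<in> A \<and> is_interval I \<and> openin (top_of_set {0..1}) I}"

definition orbifold_isotopy ::
    "'a topology \<Rightarrow> ('e::euclidean_space, 'a) orb_chart set \<Rightarrow>
     ('a \<Rightarrow> 'a) \<Rightarrow> ('a \<Rightarrow> 'a) \<Rightarrow> ('a \<times> real \<Rightarrow> 'a) \<Rightarrow> bool" where
  "orbifold_isotopy X A f g F \<longleftrightarrow>
     smooth_orbifold_map (interval_product_space X) (interval_product_atlas A) X A F \<and>
     (\<forall>x\<in>topspace X. F (x, 0) = f x) \<and> (\<forall>x\<in>topspace X. F (x, 1) = g x) \<and>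
     (\<forall>t\<in>{0..1}. orbifold_diffeomorphism X A (\<lambda>x. F (x, t)))"

definition compactly_supported :: "'a topology \<Rightarrow> ('a \<times> real \<Rightarrow> 'a) \<Rightarrow> bool" where
  "compactly_supported X F \<longleftrightarrow>
     (\<exists>K. compactin X K \<and> (\<forall>x\<in>topspace X - K. \<forall>t\<in>{0..1}. F (x, t) = x))"

end

theory Submission
  imports Defs
begin

text \<open>The points are moved one at a time along their strata, by isotopies composed of copies of one
  local move.

  The local move. By averaging over the isotropy group, every point \<open>p\<close> has a chart on which the
  group acts linearly with \<open>p\<close> at the origin (\<open>linear_chart_exists\<close>). In such a chart the stratum of
  \<open>p\<close> is the image of the space of fixed vectors (\<open>linear_chart_stratum_iff\<close>); this needs that the
  singular dimension can be read off in any chart as the dimension of the space fixed by the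
  derivatives of the stabilizer (\<open>sdim_eq_dim_isotropy_fixed_space\<close>), which rests on the fact that a
  lift of the identity has the derivative of a group element (\<open>identity_lift_derivative\<close>). A small
  fixed vector \<open>w\<close> gives the equivariant maps \<open>s \<mapsto> s + t \<rho>(s) w\<close>, with an invariant bump function
  \<open>\<rho>\<close>. They are diffeomorphisms, smoothly in \<open>t\<close>, and descend to a compactly supported isotopy that
  pushes \<open>p\<close> to the image of \<open>w\<close> (\<open>linear_chart_push\<close>). So inside a stratum, and with a finite set
  \<open>Z\<close> held fixed, the points outside \<open>Z\<close> that can be reached from a given one form an open set.

  From local to global. Reachability is an equivalence relation, hence constant on connected subsets
  of a stratum that avoid \<open>Z\<close> (\<open>reachable_in_connected\<close>). A component of the \<open>k\<close>-dimensional stratum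
  remains connected without \<open>Z\<close> if \<open>k \<noteq> 1\<close>, because a convex open set of dimension \<open>k \<noteq> 1\<close> is
  connected without any one of its points (\<open>connectedin_stratum_component_minus_finite\<close>); for
  \<open>k = 1\<close> the hypothesis of the theorem keeps \<open>Z\<close> out of the component. Each point
  is moved while the targets already attained are held fixed.

  Two facts about atlases make the local constructions global: a maximal atlas contains every chart
  pulled back along an embedding (\<open>pull_chart_in_atlas\<close>), and smooth families of orbifold maps compose
  (\<open>smooth_family_compose\<close>), because their lifts can be arranged to start and to end in prescribed
  charts.\<close>

section \<open>Calculus of smooth maps\<close>

lemma Ck_on_cong:
  assumes "open W" "\<And>x. x \<in> W \<Longrightarrow> f x = g x" "Ck_on k f W"
  shows "Ck_on k g W"
  using assms(2,3)
proof (induction k arbitrary: f g)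
  case 0
  then show ?case using continuous_on_cong by force
next
  case (Suc k)
  have d: "f differentiable (at x)" if "x \<in> W" for x using Suc.prems that by simp
  have g: "(g has_derivative frechet_derivative f (at x)) (at x)" if "x \<in> W" for x
    using d[OF that] assms(1) that Suc.prems(1)
    by (meson frechet_derivative_works has_derivative_transform_within_open)
  have eq: "frechet_derivative f (at x) = frechet_derivative g (at x)" if "x \<in> W" for x
    using g[OF that] frechet_derivative_at by blast
  have "Ck_on k (\<lambda>x. frechet_derivative g (at x) v) W" for v
    by (rule Suc.IH[of "\<lambda>x. frechet_derivative f (at x) v"]) (use eq Suc.prems in auto)
  then show ?case using g by (auto simp: differentiable_def)
qed

lemma Ck_on_SucI:
  assumes "open W" "\<And>x. x \<in> W \<Longrightarrow> (f has_derivative f' x) (at x)"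
    and "\<And>v. Ck_on k (\<lambda>x. f' x v) W"
  shows "Ck_on (Suc k) f W"
proof -
  have "Ck_on k (\<lambda>x. frechet_derivative f (at x) v) W" for v
    by (rule Ck_on_cong[OF assms(1) _ assms(3)[of v]])
       (use assms(2) frechet_derivative_at in metis)
  then show ?thesis using assms(2) by (auto simp: differentiable_def)
qed

lemma Ck_on_SucD_has_derivative:
  "Ck_on (Suc k) f W \<Longrightarrow> x \<in> W \<Longrightarrow> (f has_derivative frechet_derivative f (at x)) (at x)"
  by (simp add: frechet_derivative_works[symmetric])

lemma Ck_on_pred: "Ck_on (Suc k) f W \<Longrightarrow> Ck_on k f W"
proof (induction k arbitrary: f)
  case 0
  then show ?case
    by (auto intro!: continuous_at_imp_continuous_on differentiable_imp_continuous_within)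
next
  case (Suc k)
  then show ?case by auto
qed

lemma Ck_on_continuous: "Ck_on k f W \<Longrightarrow> continuous_on W f"
proof (induction k)
  case (Suc k)
  then show ?case using Ck_on_pred[of k f W] by blast
qed simp

lemma Ck_on_subset: "Ck_on k f W \<Longrightarrow> V \<subseteq> W \<Longrightarrow> Ck_on k f V"
  by (induction k arbitrary: f) (auto intro: continuous_on_subset)

lemma Ck_on_local:
  assumes "\<And>x. x \<in> W \<Longrightarrow> \<exists>U. open U \<and> x \<in> U \<and> Ck_on k f U"
  shows "Ck_on k f W"
  using assms
proof (induction k arbitrary: f)
  case 0
  have "isCont f x" if "x \<in> W" for x
    using 0[OF that] continuous_on_eq_continuous_at by auto
  then show ?case by (simp add: continuous_at_imp_continuous_on)
next
  case (Suc k)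
  show ?case
  proof (simp, intro conjI ballI allI)
    fix x assume "x \<in> W"
    then show "f differentiable at x" using Suc.prems by force
  next
    fix v
    show "Ck_on k (\<lambda>x. frechet_derivative f (at x) v) W"
      by (rule Suc.IH) (use Suc.prems in force)
  qed
qed

lemma Ck_on_const: "open W \<Longrightarrow> Ck_on k (\<lambda>x. c) W"
  by (induction k arbitrary: c) auto

lemma Ck_on_bounded_linear:
  assumes "open W" "bounded_linear L" shows "Ck_on k L W"
proof (cases k)
  case 0 then show ?thesis
    using assms(2) by (simp add: linear_continuous_on)
next
  case (Suc j)
  show ?thesis unfolding Suc
    by (rule Ck_on_SucI[OF assms(1), where f' = "\<lambda>x. L"])
       (auto intro: assms Ck_on_const bounded_linear_imp_has_derivative)
qed

lemma Ck_on_add: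
  assumes "open W" "Ck_on k f W" "Ck_on k g W"
  shows "Ck_on k (\<lambda>x. f x + g x) W"
  using assms(2,3)
proof (induction k arbitrary: f g)
  case 0 then show ?case by (auto intro: continuous_intros)
next
  case (Suc k)
  show ?case
    by (rule Ck_on_SucI[OF assms(1), where f' = "\<lambda>x v. frechet_derivative f (at x) v + frechet_derivative g (at x) v"])
       (use Suc.prems in \<open>auto intro!: Suc.IH has_derivative_add simp: frechet_derivative_works[symmetric]\<close>)
qed

lemma Ck_on_bilinear:
  assumes "bounded_bilinear b" "open W" "Ck_on k f W" "Ck_on k g W"
  shows "Ck_on k (\<lambda>x. b (f x) (g x)) W"
  using assms(3,4)
proof (induction k arbitrary: f g)
  case 0 then show ?case
    using bounded_bilinear.continuous_on[OF assms(1)] by auto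
next
  case (Suc k)
  have "Ck_on k f W" "Ck_on k g W" using Suc.prems by (auto intro: Ck_on_pred simp del: Ck_on.simps)
  then show ?case
    by (intro Ck_on_SucI[OF assms(2), where f' = "\<lambda>x v. b (f x) (frechet_derivative g (at x) v)
            + b (frechet_derivative f (at x) v) (g x)"])
       (use Suc.prems in \<open>auto intro!: Suc.IH Ck_on_add assms bounded_bilinear.FDERIV[OF assms(1)]
           simp: frechet_derivative_works[symmetric]\<close>)
qed

lemma Ck_on_sum:
  assumes "open W" "\<And>i. i \<in> I \<Longrightarrow> Ck_on k (f i) W"
  shows "Ck_on k (\<lambda>x. \<Sum>i\<in>I. f i x) W"
  using assms(2)
  by (induction I rule: infinite_finite_induct) (auto intro: Ck_on_const Ck_on_add assms(1))

lemma bounded_linear_basis_expand: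
  fixes L :: "'a::euclidean_space \<Rightarrow> 'b::real_normed_vector"
  assumes "linear L"
  shows "L v = (\<Sum>b\<in>Basis. (v \<bullet> b) *\<^sub>R L b)"
proof -
  have "L v = L (\<Sum>b\<in>Basis. (v \<bullet> b) *\<^sub>R b)" by (simp add: euclidean_representation)
  also have "\<dots> = (\<Sum>b\<in>Basis. (v \<bullet> b) *\<^sub>R L b)"
    using assms by (simp add: linear_sum linear_cmul)
  finally show ?thesis .
qed

lemma Ck_on_compose:
  fixes f :: "'a::euclidean_space \<Rightarrow> 'b::euclidean_space" and g :: "'b \<Rightarrow> 'c::euclidean_space"
  assumes W: "open W" and V: "open V" and f: "Ck_on k f W" and g: "Ck_on k g V" and sub: "f ` W \<subseteq> V"
  shows "Ck_on k (\<lambda>x. g (f x)) W"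
  using f g
proof (induction k arbitrary: g)
  case 0 then show ?case
    using sub by (auto intro: continuous_on_compose2)
next
  case (Suc k)
  have fk: "Ck_on k f W" using Suc.prems(1) by (rule Ck_on_pred)
  let ?f' = "\<lambda>x. frechet_derivative f (at x)" and ?g' = "\<lambda>x. frechet_derivative g (at x)"
  have g': "(g has_derivative ?g' y) (at y)" if "y \<in> V" for y
    using Ck_on_SucD_has_derivative[OF Suc.prems(2) that] .
  have f': "(f has_derivative ?f' x) (at x)" if "x \<in> W" for x
    using Ck_on_SucD_has_derivative[OF Suc.prems(1) that] .
  show ?case
  proof (rule Ck_on_SucI[OF W, where f' = "\<lambda>x v. \<Sum>b\<in>Basis. (?f' x v \<bullet> b) *\<^sub>R ?g' (f x) b"])
    fix x assume x: "x \<in> W"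
    then have fx: "f x \<in> V" using sub by auto
    have e: "(\<lambda>v. ?g' (f x) (?f' x v)) = (\<lambda>v. \<Sum>b\<in>Basis. (?f' x v \<bullet> b) *\<^sub>R ?g' (f x) b)"
      by (rule ext, rule bounded_linear_basis_expand) (rule has_derivative_linear[OF g'[OF fx]])
    show "((\<lambda>x. g (f x)) has_derivative (\<lambda>v. \<Sum>b\<in>Basis. (?f' x v \<bullet> b) *\<^sub>R ?g' (f x) b)) (at x)"
      using has_derivative_compose[OF f'[OF x] g'[OF fx]] unfolding e .
  next
    fix v
    have "Ck_on k (\<lambda>x. ?g' (f x) b) W" for b
      by (rule Suc.IH[OF fk]) (use Suc.prems(2) in simp)
    moreover have "Ck_on k (\<lambda>x. ?f' x v \<bullet> b) W" for b
      by (rule Ck_on_bilinear[OF bounded_bilinear_inner W _ Ck_on_const[OF W]])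
         (use Suc.prems(1) in simp)
    ultimately show "Ck_on k (\<lambda>x. \<Sum>b\<in>Basis. (?f' x v \<bullet> b) *\<^sub>R ?g' (f x) b) W"
      by (intro Ck_on_sum[OF W] Ck_on_bilinear[OF bounded_bilinear_scaleR W])
  qed
qed

definition Cinf_on :: "('e::real_normed_vector \<Rightarrow> 'f::real_normed_vector) \<Rightarrow> 'e set \<Rightarrow> bool" where
  "Cinf_on f W \<longleftrightarrow> (\<forall>k. Ck_on k f W)"

lemma Cinf_on_cong: "open W \<Longrightarrow> (\<And>x. x \<in> W \<Longrightarrow> f x = g x) \<Longrightarrow> Cinf_on f W \<Longrightarrow> Cinf_on g W"
  unfolding Cinf_on_def using Ck_on_cong by blast

lemma Cinf_on_subset: "Cinf_on f W \<Longrightarrow> V \<subseteq> W \<Longrightarrow> Cinf_on f V"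
  unfolding Cinf_on_def using Ck_on_subset by blast

lemma Cinf_on_local:
  "(\<And>x. x \<in> W \<Longrightarrow> \<exists>U. open U \<and> x \<in> U \<and> Cinf_on f U) \<Longrightarrow> Cinf_on f W"
  unfolding Cinf_on_def using Ck_on_local by metis

lemma Cinf_on_const: "open W \<Longrightarrow> Cinf_on (\<lambda>x. c) W"
  unfolding Cinf_on_def using Ck_on_const by blast

lemma Cinf_on_linear:
  fixes L :: "'a::euclidean_space \<Rightarrow> 'b::euclidean_space"
  shows "open W \<Longrightarrow> linear L \<Longrightarrow> Cinf_on L W"
  unfolding Cinf_on_def using Ck_on_bounded_linear linear_conv_bounded_linear by blast

lemma Cinf_on_add:
  "open W \<Longrightarrow> Cinf_on f W \<Longrightarrow> Cinf_on g W \<Longrightarrow> Cinf_on (\<lambda>x. f x + g x) W"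
  unfolding Cinf_on_def using Ck_on_add by blast

lemma Cinf_on_bilinear:
  "bounded_bilinear b \<Longrightarrow> open W \<Longrightarrow> Cinf_on f W \<Longrightarrow> Cinf_on g W \<Longrightarrow> Cinf_on (\<lambda>x. b (f x) (g x)) W"
  unfolding Cinf_on_def using Ck_on_bilinear by blast

lemmas Cinf_on_scaleR = Cinf_on_bilinear[OF bounded_bilinear_scaleR]
  and Cinf_on_mult = Cinf_on_bilinear[OF bounded_bilinear_mult]
  and Cinf_on_inner = Cinf_on_bilinear[OF bounded_bilinear_inner]

lemma Cinf_on_diff:
  assumes "open W" "Cinf_on f W" "Cinf_on g W" shows "Cinf_on (\<lambda>x. f x - g x) W"
  using Cinf_on_add[OF assms(1,2) Cinf_on_scaleR[OF assms(1) Cinf_on_const[OF assms(1)] assms(3), of "-1"]]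
  by simp

lemma Cinf_on_sum:
  "open W \<Longrightarrow> (\<And>i. i \<in> I \<Longrightarrow> Cinf_on (f i) W) \<Longrightarrow> Cinf_on (\<lambda>x. \<Sum>i\<in>I. f i x) W"
  unfolding Cinf_on_def by (intro allI Ck_on_sum) simp_all

lemma Cinf_on_compose:
  fixes f :: "'a::euclidean_space \<Rightarrow> 'b::euclidean_space" and g :: "'b \<Rightarrow> 'c::euclidean_space"
  assumes "open W" "open V" "Cinf_on f W" "Cinf_on g V" "f ` W \<subseteq> V"
  shows "Cinf_on (\<lambda>x. g (f x)) W"
  unfolding Cinf_on_def
proof
  fix k
  show "Ck_on k (\<lambda>x. g (f x)) W"
    by (rule Ck_on_compose[OF assms(1,2) _ _ assms(5)])
       (rule assms(3,4)[unfolded Cinf_on_def, rule_format])+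
qed

lemma Cinf_on_continuous: "Cinf_on f W \<Longrightarrow> continuous_on W f"
  unfolding Cinf_on_def using Ck_on_continuous by blast

lemma Cinf_on_has_derivative:
  "Cinf_on f W \<Longrightarrow> x \<in> W \<Longrightarrow> (f has_derivative frechet_derivative f (at x)) (at x)"
  unfolding Cinf_on_def using Ck_on_SucD_has_derivative by blast

lemma Cinf_on_derivative:
  assumes "Cinf_on f W" shows "Cinf_on (\<lambda>x. frechet_derivative f (at x) v) W"
  unfolding Cinf_on_def
proof
  fix k
  have "Ck_on (Suc k) f W" using assms by (simp add: Cinf_on_def del: Ck_on.simps)
  then show "Ck_on k (\<lambda>x. frechet_derivative f (at x) v) W" by simp
qed

lemma Cinf_on_Pair:
  fixes f :: "'a::euclidean_space \<Rightarrow> 'b::euclidean_space" and g :: "'a \<Rightarrow> 'c::euclidean_space"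
  assumes "open W" "Cinf_on f W" "Cinf_on g W"
  shows "Cinf_on (\<lambda>x. (f x, g x)) W"
proof -
  have l1: "linear (\<lambda>x::'b. (x, 0::'c))" and l2: "linear (\<lambda>x::'c. (0::'b, x))"
    by (auto intro!: linearI)
  have "Cinf_on (\<lambda>x. (f x, 0) + (0, g x)) W"
    by (rule Cinf_on_add[OF assms(1) Cinf_on_compose[OF assms(1) open_UNIV assms(2) Cinf_on_linear[OF open_UNIV l1]]
        Cinf_on_compose[OF assms(1) open_UNIV assms(3) Cinf_on_linear[OF open_UNIV l2]]]) auto
  then show ?thesis by simp
qed

lemma Cinf_on_fst: "open W \<Longrightarrow> Cinf_on (fst :: 'a::euclidean_space \<times> 'b::euclidean_space \<Rightarrow> 'a) W"
  by (auto intro!: Cinf_on_linear linear_fst)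

lemma Cinf_on_snd: "open W \<Longrightarrow> Cinf_on (snd :: 'a::euclidean_space \<times> 'b::euclidean_space \<Rightarrow> 'b) W"
  by (auto intro!: Cinf_on_linear linear_snd)

text \<open>By the chain rule each order of smoothness of \<open>g\<close> passes to its derivative and so gives one more.
  This is the situation of an inverse map.\<close>

lemma Cinf_on_if_derivative_through:
  fixes g :: "'a::euclidean_space \<Rightarrow> 'b::euclidean_space"
  assumes "open U" "open V" "g ` V \<subseteq> U" "\<And>y. y \<in> V \<Longrightarrow> (g has_derivative (\<lambda>v. \<Phi> v (g y))) (at y)"
    and "\<And>v. Cinf_on (\<Phi> v) U"
  shows "Cinf_on g V"
proof -
  have "Ck_on k g V" for k
  proof (induction k)
    case 0
    have "isCont g y" if "y \<in> V" for y
      using assms(4)[OF that] has_derivative_continuous by blast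
    then show ?case by (simp add: continuous_at_imp_continuous_on)
  next
    case (Suc k)
    have c: "Ck_on k (\<Phi> v) U" for v using assms(5)[of v] unfolding Cinf_on_def by blast
    show ?case
      by (rule Ck_on_SucI[OF assms(2) assms(4)]) (auto intro: Ck_on_compose[OF assms(2,1) Suc c assms(3)])
  qed
  then show ?thesis by (simp add: Cinf_on_def)
qed

text \<open>The solution \<open>z\<close> of \<open>f' x z = w\<close> depends differentiably on \<open>x\<close>, because it is
  the second component of the inverse of \<open>(x, z) \<mapsto> (x, f' x z)\<close>, whose derivative is invertible.
  Differentiating the equation expresses the derivative of the solution polynomially in
  solutions and second derivatives of \<open>f\<close>, so that its order of smoothness bootstraps.\<close>

lemma Cinf_on_inverse_derivative:
  fixes f :: "'a::euclidean_space \<Rightarrow> 'a"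
  assumes U: "open U" and f: "Cinf_on f U"
    and inj: "\<And>x. x \<in> U \<Longrightarrow> inj (frechet_derivative f (at x))"
  shows "Cinf_on (\<lambda>x. inv_into UNIV (frechet_derivative f (at x)) w) U"
proof -
  define D where "D = (\<lambda>x. frechet_derivative f (at x))"
  define D2 where "D2 = (\<lambda>x b. frechet_derivative (\<lambda>x. D x b) (at x))"
  define \<Phi> where "\<Phi> = (\<lambda>w x. inv_into UNIV (D x) w)"
  have lin: "linear (D x)" if "x \<in> U" for x
    using Cinf_on_has_derivative[OF f that] has_derivative_linear unfolding D_def by blast
  have bij: "bij (D x)" if "x \<in> U" for x
    using linear_injective_imp_surjective[OF lin[OF that]] inj[OF that] unfolding D_def bij_def by blast
  have D\<Phi>: "D x (\<Phi> w x) = w" if "x \<in> U" for x w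
    unfolding \<Phi>_def using bij[OF that] by (simp add: bij_is_surj surj_f_inv_f)
  have \<Phi>D: "\<Phi> (D x z) x = z" if "x \<in> U" for x z
    unfolding \<Phi>_def using bij[OF that] by (simp add: bij_is_inj inv_f_f)
  have \<Phi>lin: "linear (\<lambda>w. \<Phi> w x)" if "x \<in> U" for x
  proof (rule linearI)
    show "\<Phi> (a + b) x = \<Phi> a x + \<Phi> b x" for a b
      using \<Phi>D[OF that, of "\<Phi> a x + \<Phi> b x"] by (simp add: linear_add[OF lin[OF that]] D\<Phi>[OF that])
    show "\<Phi> (r *\<^sub>R a) x = r *\<^sub>R \<Phi> a x" for r a
      using \<Phi>D[OF that, of "r *\<^sub>R \<Phi> a x"] by (simp add: linear_cmul[OF lin[OF that]] D\<Phi>[OF that])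
  qed
  have CD: "Cinf_on (\<lambda>x. D x b) U" for b
    unfolding D_def by (rule Cinf_on_derivative[OF f])
  have D2: "((\<lambda>x. D x b) has_derivative D2 x b) (at x)" if "x \<in> U" for x b
    unfolding D2_def by (rule Cinf_on_has_derivative[OF CD that])
  have D2lin: "linear (D2 x b)" if "x \<in> U" for x b
    using D2[OF that] has_derivative_linear by blast
  \<comment> \<open>Expanded in a basis so that \<open>T\<close> is defined by smooth functions; on \<open>U\<close> it is \<open>(x, D x z)\<close>.\<close>
  define T where "T = (\<lambda>p::'a\<times>'a. (fst p, \<Sum>b\<in>Basis. (snd p \<bullet> b) *\<^sub>R D (fst p) b))"
  have T: "T (x, z) = (x, D x z)" if "x \<in> U" for x z
    unfolding T_def using bounded_linear_basis_expand[OF lin[OF that], of z] by simp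
  define S where "S = (\<lambda>p::'a\<times>'a. (fst p, \<Phi> (snd p) (fst p)))"
  define Q where "Q = (\<lambda>x z \<xi>. \<Sum>b\<in>Basis. (z \<bullet> b) *\<^sub>R D2 x b \<xi>)"
  have derT: "(T has_derivative (\<lambda>h. (fst h, Q x z (fst h) + D x (snd h)))) (at (x, z))"
    if x: "x \<in> U" for x z
  proof -
    have c: "((\<lambda>p. D (fst p) b) has_derivative (\<lambda>h. D2 x b (fst h))) (at (x, z))" for b
    proof -
      have "((\<lambda>p. (\<lambda>x. D x b) (fst p)) has_derivative (\<lambda>h. D2 x b (fst h))) (at (x, z))"
        by (rule has_derivative_compose[where f = fst and g = "\<lambda>x. D x b"])
           (simp_all add: D2[OF x] bounded_linear_fst bounded_linear_imp_has_derivative)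
      then show ?thesis .
    qed
    have e: "(\<Sum>b\<in>Basis. (h \<bullet> b) *\<^sub>R D x b) = D x h" for h
      using bounded_linear_basis_expand[OF lin[OF x], of h] by simp
    have d1: "((fst :: 'a \<times> 'a \<Rightarrow> 'a) has_derivative fst) (at (x, z))"
      and d2: "((snd :: 'a \<times> 'a \<Rightarrow> 'a) has_derivative snd) (at (x, z))"
      by (simp_all add: bounded_linear_fst bounded_linear_snd bounded_linear_imp_has_derivative)
    have s: "((\<lambda>p. (snd p \<bullet> b) *\<^sub>R D (fst p) b) has_derivative
        (\<lambda>h. (snd (x, z) \<bullet> b) *\<^sub>R D2 x b (fst h) + (snd h \<bullet> b) *\<^sub>R D (fst (x, z)) b)) (at (x, z))" for b
      by (rule has_derivative_scaleR[OF has_derivative_inner_left[OF d2] c])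
    have "(T has_derivative (\<lambda>h. (fst h, \<Sum>b\<in>Basis. (snd (x, z) \<bullet> b) *\<^sub>R D2 x b (fst h)
        + (snd h \<bullet> b) *\<^sub>R D (fst (x, z)) b))) (at (x, z))"
      unfolding T_def by (rule has_derivative_Pair[OF d1 has_derivative_sum[OF s]])
    then show ?thesis unfolding Q_def by (simp add: sum.distrib e)
  qed
  have der\<Phi>: "((\<lambda>x. \<Phi> w x) has_derivative (\<lambda>\<xi>. - \<Phi> (Q x (\<Phi> w x) \<xi>) x)) (at x)" if x: "x \<in> U" for x w
  proof -
    have Qlin: "linear (Q x z)" for z
      unfolding Q_def using D2lin[OF x]
      by (auto intro!: linear_compose_sum linear_compose_scale_right)
    have op: "open (U \<times> (UNIV::'a set))" using U by (simp add: open_Times)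
    have contT: "continuous_on (U \<times> UNIV) T"
    proof -
      have "isCont T p" if "p \<in> U \<times> UNIV" for p
        using has_derivative_continuous[OF derT[of "fst p" "snd p"]] that by auto
      then show ?thesis by (simp add: continuous_at_imp_continuous_on)
    qed
    have *: "(S has_derivative (\<lambda>h. (fst h, \<Phi> (snd h - Q x (\<Phi> w x) (fst h)) x))) (at (T (x, \<Phi> w x)))"
    proof (rule has_derivative_inverse_strong[OF op _ contT _ derT[OF x]])
      show "(x, \<Phi> w x) \<in> U \<times> UNIV" using x by simp
      show "S (T p) = p" if "p \<in> U \<times> UNIV" for p
        using that T[of "fst p" "snd p"] \<Phi>D[of "fst p" "snd p"] unfolding S_def by auto
      show "(\<lambda>h. (fst h, Q x (\<Phi> w x) (fst h) + D x (snd h))) \<circ> (\<lambda>h. (fst h, \<Phi> (snd h - Q x (\<Phi> w x) (fst h)) x)) = id"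
        using D\<Phi>[OF x] by (auto simp: fun_eq_iff)
    qed
    have "((\<lambda>\<xi>. (\<xi>, w)) has_derivative (\<lambda>\<xi>. (\<xi>, 0))) (at x)"
      by (auto intro!: derivative_eq_intros)
    note a = this
    have b: "(S has_derivative (\<lambda>h. (fst h, \<Phi> (snd h - Q x (\<Phi> w x) (fst h)) x))) (at (x, w))"
      using * unfolding T[OF x] D\<Phi>[OF x] .
    have "((\<lambda>\<xi>. S (\<xi>, w)) has_derivative
        (\<lambda>\<xi>. (fst (\<xi>, 0::'a), \<Phi> (snd (\<xi>, 0::'a) - Q x (\<Phi> w x) (fst (\<xi>, 0::'a))) x))) (at x)"
      by (rule has_derivative_compose[OF a b])
    from has_derivative_snd[OF this]
    have "((\<lambda>\<xi>. snd (S (\<xi>, w))) has_derivative (\<lambda>\<xi>. \<Phi> (0 - Q x (\<Phi> w x) \<xi>) x)) (at x)"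
      by simp
    then show ?thesis
      unfolding S_def using linear_neg[OF \<Phi>lin[OF x]] by simp
  qed
  have "\<forall>w. Ck_on k (\<Phi> w) U" for k
  proof (induction k)
    case 0
    have "isCont (\<Phi> w) x" if "x \<in> U" for x w
      using der\<Phi>[OF that] has_derivative_continuous by blast
    then show ?case by (simp add: continuous_at_imp_continuous_on)
  next
    case (Suc k)
    have exp: "- \<Phi> (Q x (\<Phi> w x) \<xi>) x
        = (\<Sum>b'\<in>Basis. (- (\<Sum>b\<in>Basis. (\<Phi> w x \<bullet> b) *\<^sub>R D2 x b \<xi>) \<bullet> b') *\<^sub>R \<Phi> b' x)" if "x \<in> U" for x w \<xi>
      using bounded_linear_basis_expand[OF \<Phi>lin[OF that], of "- Q x (\<Phi> w x) \<xi>"]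
        linear_neg[OF \<Phi>lin[OF that]] unfolding Q_def by simp
    have CD2: "Ck_on k (\<lambda>x. D2 x b \<xi>) U" for b \<xi>
      using Cinf_on_derivative[OF CD[of b], of \<xi>] unfolding D2_def Cinf_on_def by blast
    show ?case
    proof
      fix w
      show "Ck_on (Suc k) (\<Phi> w) U"
      proof (rule Ck_on_SucI[OF U der\<Phi>])
        fix \<xi>
        have sc: "Ck_on k (\<lambda>x. - g x) U" if "Ck_on k g U" for g :: "'a \<Rightarrow> 'a"
          using Ck_on_bilinear[OF bounded_bilinear_scaleR U Ck_on_const[OF U] that, of "-1"] by simp
        have "Ck_on k (\<lambda>x. \<Sum>b'\<in>Basis. (- (\<Sum>b\<in>Basis. (\<Phi> w x \<bullet> b) *\<^sub>R D2 x b \<xi>) \<bullet> b') *\<^sub>R \<Phi> b' x) U"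
          by (intro Ck_on_sum[OF U] Ck_on_bilinear[OF bounded_bilinear_scaleR U] sc
              Ck_on_bilinear[OF bounded_bilinear_inner U] Ck_on_const[OF U] CD2 Suc[rule_format])
        then show "Ck_on k (\<lambda>x. - \<Phi> (Q x (\<Phi> w x) \<xi>) x) U"
          by (rule Ck_on_cong[OF U, rotated]) (use exp in simp)
      qed
    qed
  qed
  then show ?thesis unfolding Cinf_on_def \<Phi>_def D_def by blast
qed

lemma Cinf_on_the_inv_into:
  fixes f :: "'a::euclidean_space \<Rightarrow> 'a"
  assumes U: "open U" and f: "Cinf_on f U" and inj: "inj_on f U"
    and inj': "\<And>x. x \<in> U \<Longrightarrow> inj (frechet_derivative f (at x))"
  shows "open (f ` U)" "Cinf_on (the_inv_into U f) (f ` U)"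
proof -
  have cont: "continuous_on U f" using f by (rule Cinf_on_continuous)
  show op: "open (f ` U)" by (rule invariance_of_domain[OF cont U inj])
  show "Cinf_on (the_inv_into U f) (f ` U)"
  proof (rule Cinf_on_if_derivative_through[OF U op])
    show "the_inv_into U f ` f ` U \<subseteq> U" using inj by (auto simp: the_inv_into_f_f)
    show "Cinf_on (\<lambda>x. inv_into UNIV (frechet_derivative f (at x)) v) U" for v
      by (rule Cinf_on_inverse_derivative[OF U f inj'])
    fix y assume "y \<in> f ` U"
    then obtain x where x: "x \<in> U" "y = f x" by auto
    have l: "linear (frechet_derivative f (at x))"
      using Cinf_on_has_derivative[OF f x(1)] has_derivative_linear by blast
    have "surj (frechet_derivative f (at x))"
      using linear_injective_imp_surjective[OF l] inj'[OF x(1)] by blast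
    then have "frechet_derivative f (at x) \<circ> inv_into UNIV (frechet_derivative f (at x)) = id"
      by (simp add: surj_iff)
    then have "(the_inv_into U f has_derivative inv_into UNIV (frechet_derivative f (at x))) (at (f x))"
      by (intro has_derivative_inverse_strong[OF U x(1) cont _ Cinf_on_has_derivative[OF f x(1)]])
         (auto simp: the_inv_into_f_f inj)
    then show "(the_inv_into U f has_derivative (\<lambda>v. inv_into UNIV (frechet_derivative f (at (the_inv_into U f y))) v)) (at y)"
      using x inj by (simp add: the_inv_into_f_f)
  qed
qed

lemma Cinf_on_lipschitz:
  fixes k :: "'a::euclidean_space \<Rightarrow> 'b::euclidean_space"
  assumes "Cinf_on k U" "convex S" "S \<subseteq> U"
    and B: "\<And>x. x \<in> S \<Longrightarrow> (\<Sum>b\<in>Basis. norm (frechet_derivative k (at x) b)) \<le> B"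
    and "x \<in> S" "y \<in> S"
  shows "norm (k x - k y) \<le> B * norm (x - y)"
proof (rule differentiable_bound[OF assms(2) _ _ assms(5,6)])
  fix z assume z: "z \<in> S"
  let ?D = "frechet_derivative k (at z)"
  have D: "(k has_derivative ?D) (at z)" using Cinf_on_has_derivative[OF assms(1)] z assms(3) by blast
  then show "(k has_derivative ?D) (at z within S)" by (rule has_derivative_at_withinI)
  have lin: "linear ?D" using has_derivative_linear[OF D] .
  have "norm (?D v) \<le> B * norm v" for v
  proof -
    have "norm (?D v) = norm (\<Sum>b\<in>Basis. (v \<bullet> b) *\<^sub>R ?D b)"
      by (rule arg_cong[OF bounded_linear_basis_expand[OF lin]])
    also have "\<dots> \<le> (\<Sum>b\<in>Basis. norm ((v \<bullet> b) *\<^sub>R ?D b))" by (rule norm_sum)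
    also have "\<dots> \<le> (\<Sum>b\<in>Basis. norm v * norm (?D b))"
      by (intro sum_mono) (simp add: Basis_le_norm mult_right_mono)
    also have "\<dots> = norm v * (\<Sum>b\<in>Basis. norm (?D b))" by (simp add: sum_distrib_left)
    also have "\<dots> \<le> norm v * B" by (intro mult_left_mono B z) auto
    finally show ?thesis by (simp add: mult.commute)
  qed
  then show "onorm ?D \<le> B" by (rule onorm_le)
qed

text \<open>Relative to an open subset of the subspace \<open>E\<close>, a derivative is determined only on \<open>E\<close>, where it
  is the derivative along lines.\<close>

lemma has_vector_derivative_along:
  fixes f :: "'a::real_normed_vector \<Rightarrow> 'b::real_normed_vector"
  assumes f: "(f has_derivative f') (at u within S)" and E: "subspace E"
    and S: "openin (top_of_set E) S" "u \<in> S" and v: "v \<in> E"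
  shows "((\<lambda>t. f (u + t *\<^sub>R v)) has_vector_derivative f' v) (at 0)"
proof -
  define T where "T = {t::real. u + t *\<^sub>R v \<in> S}"
  have uE: "u \<in> E" using S openin_imp_subset by blast
  have "openin (top_of_set UNIV) (UNIV \<inter> (\<lambda>t. u + t *\<^sub>R v) -` S)"
    by (rule continuous_openin_preimage[OF _ _ S(1)])
       (auto intro!: continuous_intros subspace_add[OF E] subspace_scale[OF E] uE v)
  then have T: "open T" unfolding T_def by (simp add: vimage_def)
  have 0: "0 \<in> T" using S(2) by (simp add: T_def)
  have "((\<lambda>t::real. u + t *\<^sub>R v) has_derivative (\<lambda>t. t *\<^sub>R v)) (at 0 within T)"
    by (auto intro!: derivative_eq_intros)
  moreover have "(f has_derivative f') (at (u + 0 *\<^sub>R v) within (\<lambda>t. u + t *\<^sub>R v) ` T)"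
    using f by (auto simp: T_def intro: has_derivative_subset)
  ultimately have "((\<lambda>t. f (u + t *\<^sub>R v)) has_derivative (\<lambda>t. f' (t *\<^sub>R v))) (at 0 within T)"
    by (rule has_derivative_in_compose)
  then show ?thesis
    unfolding has_vector_derivative_def at_within_open[OF 0 T] linear_cmul[OF has_derivative_linear[OF f]] .
qed

lemma has_derivative_unique_along:
  fixes f :: "'a::real_normed_vector \<Rightarrow> 'b::real_normed_vector"
  assumes "(f has_derivative f') (at u within S)" "(g has_derivative g') (at u within T)" "subspace E"
    and "openin (top_of_set E) S" "u \<in> S" "openin (top_of_set E) T" "u \<in> T" "v \<in> E"
    and "\<And>x. x \<in> S \<inter> T \<Longrightarrow> f x = g x"
  shows "f' v = g' v"
proof -
  have o: "openin (top_of_set E) (S \<inter> T)" using assms by auto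
  have g: "(g has_derivative f') (at u within S \<inter> T)"
    by (rule has_derivative_transform[OF _ _ has_derivative_subset[OF assms(1)]]) (use assms in auto)
  have "((\<lambda>t. g (u + t *\<^sub>R v)) has_vector_derivative f' v) (at 0)"
    by (rule has_vector_derivative_along[OF g assms(3) o]) (use assms in auto)
  moreover have "((\<lambda>t. g (u + t *\<^sub>R v)) has_vector_derivative g' v) (at 0)"
    by (rule has_vector_derivative_along[OF assms(2,3,6,7,8)])
  ultimately show ?thesis using vector_derivative_unique_at by blast
qed

lemma inj_derivative_if_expanding:
  fixes f :: "'a::euclidean_space \<Rightarrow> 'b::euclidean_space"
  assumes "open U" "x \<in> U" "(f has_derivative D) (at x)" "c > 0"
    and exp: "\<And>y. y \<in> U \<Longrightarrow> norm (f y - f x) \<ge> c * norm (y - x)"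
  shows "inj D"
proof -
  have lin: "linear D" using assms(3) has_derivative_linear by blast
  have "v = 0" if v: "D v = 0" for v
  proof -
    have "\<forall>e>0. \<exists>d>0. \<forall>y. norm (y - x) < d \<longrightarrow> norm (f y - f x - D (y - x)) \<le> e * norm (y - x)"
      using assms(3) unfolding has_derivative_at_alt by blast
    then obtain d where d: "d > 0"
      "\<And>y. norm (y - x) < d \<Longrightarrow> norm (f y - f x - D (y - x)) \<le> c/2 * norm (y - x)"
      using assms(4) half_gt_zero by blast
    obtain e where e: "e > 0" "ball x e \<subseteq> U" using assms(1,2) open_contains_ball by blast
    show "v = 0"
    proof (rule ccontr)
      assume "v \<noteq> 0"
      define t where "t = min d e / (2 * norm v)"
      define y where "y = x + t *\<^sub>R v"
      have n: "norm (y - x) = min d e / 2" "norm (y - x) > 0"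
        using d e \<open>v \<noteq> 0\<close> by (auto simp: y_def t_def abs_of_nonneg)
      have "D (y - x) = 0" using v lin by (simp add: y_def linear_cmul)
      moreover have "norm (y - x) < d" using n d e by linarith
      ultimately have "norm (f y - f x) \<le> c/2 * norm (y - x)" using d(2)[of y] by simp
      moreover have "dist x y < e" using n d e by (simp add: dist_norm norm_minus_commute)
      then have "c * norm (y - x) \<le> norm (f y - f x)" using e(2) by (intro exp) auto
      ultimately have "c * norm (y - x) \<le> c * norm (y - x) / 2" by simp
      then show False using n(2) assms(4) by (simp add: field_simps)
    qed
  qed
  then show ?thesis using lin by (simp add: linear_injective_0)
qed

lemma expanding_if_near_id:
  fixes f :: "'a::real_normed_vector \<Rightarrow> 'a"
  assumes "norm ((f x - x) - (f y - y)) \<le> 1/2 * norm (x - y)"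
  shows "norm (f x - f y) \<ge> 1/2 * norm (x - y)"
proof -
  have "norm (x - y) = norm ((f x - f y) - ((f x - x) - (f y - y)))" by (simp add: algebra_simps)
  also have "\<dots> \<le> norm (f x - f y) + norm ((f x - x) - (f y - y))" by (rule norm_triangle_ineq4)
  finally show ?thesis using assms by linarith
qed

text \<open>A map that differs from the identity by a map of Lipschitz constant one half is expanding up to
  the factor one half, so it and its derivatives are injective.\<close>

lemma near_id_smooth_inverse:
  fixes f :: "'a::euclidean_space \<Rightarrow> 'a"
  assumes U: "open U" and f: "Cinf_on f U"
    and lip: "\<And>x y. x \<in> U \<Longrightarrow> y \<in> U \<Longrightarrow> norm ((f x - x) - (f y - y)) \<le> 1/2 * norm (x - y)"
  shows "inj_on f U" "open (f ` U)" "Cinf_on (the_inv_into U f) (f ` U)"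
proof -
  have exp: "norm (f x - f y) \<ge> 1/2 * norm (x - y)" if "x \<in> U" "y \<in> U" for x y
    by (rule expanding_if_near_id[OF lip[OF that]])
  show inj: "inj_on f U"
  proof (rule inj_onI)
    fix x y assume "x \<in> U" "y \<in> U" "f x = f y"
    then show "x = y" using exp[of x y] by simp
  qed
  have inj': "inj (frechet_derivative f (at x))" if "x \<in> U" for x
    by (rule inj_derivative_if_expanding[OF U that Cinf_on_has_derivative[OF f that], of "1/2"])
       (use exp that in auto)
  show "open (f ` U)" "Cinf_on (the_inv_into U f) (f ` U)"
    using Cinf_on_the_inv_into[OF U f inj inj'] by auto
qed

text \<open>Continuity of the derivative of \<open>f - id\<close>, which vanishes at \<open>u\<close>, gives the Lipschitz bound on a
  small ball.\<close>

lemma local_smooth_inverse: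
  fixes f :: "'a::euclidean_space \<Rightarrow> 'a"
  assumes U: "open U" "u \<in> U" and f: "Cinf_on f U" and D: "(f has_derivative (\<lambda>v. v)) (at u)"
  obtains r where "r > 0" "ball u r \<subseteq> U" "inj_on f (ball u r)" "open (f ` ball u r)"
    "Cinf_on (the_inv_into (ball u r) f) (f ` ball u r)"
proof -
  define k where "k = (\<lambda>x. f x - x)"
  have k: "Cinf_on k U"
    unfolding k_def by (intro Cinf_on_diff U f Cinf_on_linear linear_ident)
  define s where "s = (\<lambda>x. \<Sum>b\<in>Basis. norm (frechet_derivative k (at x) b))"
  have "(k has_derivative (\<lambda>v. v - v)) (at u)"
    unfolding k_def by (intro derivative_intros D)
  then have "frechet_derivative k (at u) = (\<lambda>v. 0)"
    using frechet_derivative_at by fastforce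
  then have su: "s u = 0" by (simp add: s_def)
  have "continuous_on U s"
    unfolding s_def by (intro continuous_intros Cinf_on_continuous Cinf_on_derivative k)
  then have "isCont s u" using U continuous_on_eq_continuous_at by blast
  then obtain d where d: "d > 0" "\<And>x. dist x u < d \<Longrightarrow> dist (s x) (s u) < 1/2"
    unfolding continuous_at_eps_delta by (metis half_gt_zero zero_less_one)
  obtain e where e: "e > 0" "ball u e \<subseteq> U" using U open_contains_ball by blast
  define r where "r = min d e"
  have r: "r > 0" "ball u r \<subseteq> U" using d e by (auto simp: r_def)
  have "norm ((f x - x) - (f y - y)) \<le> 1/2 * norm (x - y)" if "x \<in> ball u r" "y \<in> ball u r" for x y
  proof -
    have "s z \<le> 1/2" if "z \<in> ball u r" for z
    proof -
      have "dist (s z) (s u) < 1/2" using that by (intro d(2)) (simp add: r_def dist_commute)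
      then show ?thesis using su by (simp add: dist_real_def)
    qed
    then have "norm (k x - k y) \<le> 1/2 * norm (x - y)"
      by (intro Cinf_on_lipschitz[OF k convex_ball r(2) _ that]) (simp add: s_def)
    then show ?thesis by (simp add: k_def)
  qed
  note * = near_id_smooth_inverse[OF open_ball Cinf_on_subset[OF f r(2)] this]
  then show ?thesis using that[OF r] by simp
qed

subsection \<open>A smooth bump\<close>

text \<open>The negative powers are included because then the family is closed under differentiation up to
  linear combinations, so that smoothness follows by induction on the order for all of its members
  at once.\<close>

definition flat_exp :: "nat \<Rightarrow> real \<Rightarrow> real" where
  "flat_exp n x = (if x > 0 then exp (- inverse x) * inverse x ^ n else 0)"

lemma flat_exp_at_0: "((flat_exp n) \<longlongrightarrow> 0) (at 0)"
proof -
  have "((\<lambda>x::real. x ^ n / exp x) \<longlongrightarrow> 0) at_top" by (rule tendsto_power_div_exp_0)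
  then have "((\<lambda>x::real. inverse x ^ n / exp (inverse x)) \<longlongrightarrow> 0) (at_right 0)"
    by (rule filterlim_compose[OF _ filterlim_inverse_at_top_right])
  then have "(flat_exp n \<longlongrightarrow> 0) (at_right 0)"
    by (rule Lim_transform_eventually)
       (auto simp: eventually_at_filter flat_exp_def exp_minus field_simps)
  moreover have "(flat_exp n \<longlongrightarrow> 0) (at_left 0)"
    by (rule Lim_transform_eventually[OF tendsto_const]) (auto simp: eventually_at_filter flat_exp_def)
  ultimately show ?thesis by (simp add: filterlim_split_at)
qed

lemma flat_exp_has_derivative:
  "(flat_exp n has_real_derivative (flat_exp (n + 2) x - n * flat_exp (n + 1) x)) (at x)"
proof -
  consider "x < 0" | "x = 0" | "x > 0" by linarith
  then show ?thesis
  proof cases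
    case 1
    have e: "((\<lambda>x. 0) has_real_derivative (flat_exp (n + 2) x - n * flat_exp (n + 1) x)) (at x)"
      using 1 by (simp add: flat_exp_def)
    show ?thesis
      by (rule has_field_derivative_transform_within_open[OF e, where S = "{..<0}"])
         (use 1 in \<open>auto simp: flat_exp_def\<close>)
  next
    case 2
    have "((\<lambda>h. (flat_exp n (0 + h) - flat_exp n 0) / h) \<longlongrightarrow> 0) (at 0)"
      by (rule Lim_transform_eventually[OF flat_exp_at_0[of "n + 1"]])
         (auto simp: eventually_at_filter flat_exp_def field_simps)
    then show ?thesis using 2 by (simp add: DERIV_def flat_exp_def)
  next
    case 3
    have e: "((\<lambda>x. exp (- inverse x) * inverse x ^ n) has_real_derivative
         (flat_exp (n + 2) x - n * flat_exp (n + 1) x)) (at x)"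
    proof (cases n)
      case 0
      have "((\<lambda>x::real. exp (- inverse x)) has_real_derivative exp (- inverse x) * (inverse x * inverse x)) (at x)"
        using 3 by (auto intro!: derivative_eq_intros)
      then show ?thesis unfolding 0 using 3
        by (simp add: flat_exp_def power2_eq_square)
    next
      case (Suc m)
      have i: "(inverse has_real_derivative - (inverse x * inverse x)) (at x)"
        using DERIV_inverse[of x] 3 by (simp add: power2_eq_square)
      have e: "((\<lambda>x::real. exp (- inverse x)) has_real_derivative exp (- inverse x) * - (- (inverse x * inverse x))) (at x)"
        by (rule DERIV_fun_exp[OF DERIV_minus[OF i]])
      have "((\<lambda>x::real. inverse x ^ Suc m) has_real_derivative
          (1 + real m) * (- (inverse x * inverse x) * inverse x ^ m)) (at x)"
        by (rule DERIV_power_Suc[OF i])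
      from DERIV_mult[OF e this]
      show ?thesis unfolding Suc
        by (rule DERIV_cong) (use 3 in \<open>simp add: flat_exp_def algebra_simps\<close>)
    qed
    show ?thesis
      by (rule has_field_derivative_transform_within_open[OF e, where S = "{0<..}"])
         (use 3 in \<open>auto simp: flat_exp_def\<close>)
  qed
qed

lemma Cinf_on_flat_exp: "Cinf_on (flat_exp n) UNIV"
proof -
  have "Ck_on k (flat_exp n) UNIV" for k n
  proof (induction k arbitrary: n)
    case 0
    show ?case
      using DERIV_isCont[OF flat_exp_has_derivative] by (auto intro!: continuous_at_imp_continuous_on)
  next
    case (Suc k)
    have sc: "Ck_on k (\<lambda>x. c * flat_exp m x) UNIV" for m and c :: real
      by (intro Ck_on_bilinear[OF bounded_bilinear_mult] Ck_on_const Suc) auto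
    have s: "Ck_on k (\<lambda>x. v * flat_exp (n + 2) x + (- v * n) * flat_exp (n + 1) x) UNIV" for v
      by (intro Ck_on_add sc) auto
    show ?case
    proof (rule Ck_on_SucI[OF open_UNIV])
      show "(flat_exp n has_derivative (\<lambda>v. v * flat_exp (n + 2) x + (- v * n) * flat_exp (n + 1) x)) (at x)" for x
      proof -
        have "(\<lambda>v::real. v * flat_exp (n + 2) x + (- v * n) * flat_exp (n + 1) x)
            = (*) (flat_exp (n + 2) x - n * flat_exp (n + 1) x)"
          by (simp add: fun_eq_iff algebra_simps)
        then show ?thesis
          using flat_exp_has_derivative[of n x] unfolding has_field_derivative_def by simp
      qed
    qed (rule s)
  qed
  then show ?thesis by (simp add: Cinf_on_def)
qed

definition bump :: "real \<Rightarrow> 'a::euclidean_space \<Rightarrow> real" where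
  "bump r x = flat_exp 0 (r\<^sup>2 - x \<bullet> x)"

lemma Cinf_on_bump: "Cinf_on (bump r) UNIV"
proof -
  have "Cinf_on (\<lambda>x::'a. r\<^sup>2 - x \<bullet> x) UNIV"
    by (intro Cinf_on_diff Cinf_on_inner Cinf_on_linear linear_ident open_UNIV Cinf_on_const)
  from Cinf_on_compose[OF open_UNIV open_UNIV this Cinf_on_flat_exp]
  show ?thesis by (simp add: bump_def[abs_def])
qed

lemma bump_nonneg: "bump r x \<ge> 0"
  by (simp add: bump_def flat_exp_def)

lemma bump_0_pos: "r > 0 \<Longrightarrow> bump r 0 > 0"
  by (simp add: bump_def flat_exp_def)

lemma bump_eq_0: "r > 0 \<Longrightarrow> norm x \<ge> r \<Longrightarrow> bump r x = 0"
  by (simp add: bump_def flat_exp_def dot_square_norm power_mono not_less)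

subsection \<open>Smooth maps on subsets\<close>

lemma smooth_on_iff:
  "smooth_on f S \<longleftrightarrow> (\<forall>x\<in>S. \<exists>W g. open W \<and> x \<in> W \<and> Cinf_on g W \<and> (\<forall>y\<in>S \<inter> W. g y = f y))"
  by (simp add: smooth_on_def Cinf_on_def)

lemma smooth_on_if_Cinf_on: "open W \<Longrightarrow> Cinf_on f W \<Longrightarrow> S \<subseteq> W \<Longrightarrow> smooth_on f S"
  unfolding smooth_on_iff by blast

lemma smooth_on_linear: "linear f \<Longrightarrow> smooth_on f S"
  by (rule smooth_on_if_Cinf_on[OF open_UNIV Cinf_on_linear[OF open_UNIV]]) auto

lemma smooth_on_ident: "smooth_on (\<lambda>x. x) S"
  by (rule smooth_on_linear[OF linear_ident])

lemma smooth_on_const: "smooth_on (\<lambda>x. c) S"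
  by (rule smooth_on_if_Cinf_on[OF open_UNIV Cinf_on_const[OF open_UNIV]]) auto

lemma smooth_on_cong:
  assumes "\<And>x. x \<in> S \<Longrightarrow> f x = g x" "smooth_on f S"
  shows "smooth_on g S"
  unfolding smooth_on_iff
proof
  fix x assume "x \<in> S"
  then obtain W h where W: "open W" "x \<in> W" "Cinf_on h W" "\<forall>y\<in>S \<inter> W. h y = f y"
    using assms(2) unfolding smooth_on_iff by blast
  then have "\<forall>y\<in>S \<inter> W. h y = g y" using assms(1) by simp
  then show "\<exists>W h. open W \<and> x \<in> W \<and> Cinf_on h W \<and> (\<forall>y\<in>S \<inter> W. h y = g y)"
    using W by blast
qed

lemma smooth_on_subset:
  assumes "smooth_on f S" "T \<subseteq> S"
  shows "smooth_on f T"
  unfolding smooth_on_iff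
proof
  fix x assume "x \<in> T"
  then obtain W h where W: "open W" "x \<in> W" "Cinf_on h W" "\<forall>y\<in>S \<inter> W. h y = f y"
    using assms unfolding smooth_on_iff by blast
  then have "\<forall>y\<in>T \<inter> W. h y = f y" using assms(2) by blast
  then show "\<exists>W h. open W \<and> x \<in> W \<and> Cinf_on h W \<and> (\<forall>y\<in>T \<inter> W. h y = f y)"
    using W by blast
qed

lemma smooth_on_compose:
  assumes f: "smooth_on f S" and g: "smooth_on g T" and sub: "f ` S \<subseteq> T"
  shows "smooth_on (\<lambda>x. g (f x)) S"
  unfolding smooth_on_iff
proof
  fix x assume x: "x \<in> S"
  then have fx: "f x \<in> T" using sub by auto
  from f x obtain W f' where W: "open W" "x \<in> W" "Cinf_on f' W" "\<forall>y\<in>S \<inter> W. f' y = f y"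
    unfolding smooth_on_iff by blast
  from g fx obtain V g' where V: "open V" "f x \<in> V" "Cinf_on g' V" "\<forall>y\<in>T \<inter> V. g' y = g y"
    unfolding smooth_on_iff by blast
  define W' where "W' = W \<inter> f' -` V"
  have W': "open W'"
    unfolding W'_def using Cinf_on_continuous[OF W(3)] W(1) V(1) continuous_on_open_vimage by (metis inf_commute)
  have "Cinf_on (\<lambda>x. g' (f' x)) W'"
    by (rule Cinf_on_compose[OF W' V(1) Cinf_on_subset[OF W(3)] V(3)]) (auto simp: W'_def)
  moreover have "x \<in> W'" using W V x by (simp add: W'_def)
  moreover have "\<forall>y\<in>S \<inter> W'. g' (f' y) = g (f y)"
    using W(4) V(4) sub by (auto simp: W'_def)
  ultimately show "\<exists>W h. open W \<and> x \<in> W \<and> Cinf_on h W \<and> (\<forall>y\<in>S \<inter> W. h y = g (f y))"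
    using W' by blast
qed

lemma smooth_on_Pair:
  assumes f: "smooth_on f S" and g: "smooth_on g S"
  shows "smooth_on (\<lambda>x. (f x, g x)) S"
  unfolding smooth_on_iff
proof
  fix x assume x: "x \<in> S"
  from f x obtain W f' where W: "open W" "x \<in> W" "Cinf_on f' W" "\<forall>y\<in>S \<inter> W. f' y = f y"
    unfolding smooth_on_iff by blast
  from g x obtain V g' where V: "open V" "x \<in> V" "Cinf_on g' V" "\<forall>y\<in>S \<inter> V. g' y = g y"
    unfolding smooth_on_iff by blast
  have "Cinf_on (\<lambda>x. (f' x, g' x)) (W \<inter> V)"
    using W V by (intro Cinf_on_Pair) (auto intro: Cinf_on_subset)
  then show "\<exists>W h. open W \<and> x \<in> W \<and> Cinf_on h W \<and> (\<forall>y\<in>S \<inter> W. h y = (f y, g y))"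
    using W V by (intro exI[of _ "W \<inter> V"] exI[of _ "\<lambda>x. (f' x, g' x)"]) auto
qed

lemma smooth_on_add:
  assumes f: "smooth_on f S" and g: "smooth_on g S"
  shows "smooth_on (\<lambda>x. f x + g x) S"
proof -
  have "linear (\<lambda>p::'b\<times>'b. fst p + snd p)" by (auto intro!: linearI simp: algebra_simps)
  from smooth_on_compose[OF smooth_on_Pair[OF f g] smooth_on_linear[OF this] subset_UNIV]
  show ?thesis by simp
qed

lemma smooth_on_linear_compose: "linear L \<Longrightarrow> smooth_on f S \<Longrightarrow> smooth_on (\<lambda>x. L (f x)) S"
  using smooth_on_compose[OF _ smooth_on_linear subset_UNIV] by blast

lemma smooth_on_sum: "(\<And>i. i \<in> I \<Longrightarrow> smooth_on (f i) S) \<Longrightarrow> smooth_on (\<lambda>x. \<Sum>i\<in>I. f i x) S"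
  by (induction I rule: infinite_finite_induct) (auto intro: smooth_on_const smooth_on_add)

lemma smooth_on_continuous: assumes "smooth_on f S" shows "continuous_on S f"
  unfolding continuous_on_eq_continuous_within
proof
  fix x assume x: "x \<in> S"
  then obtain W g where W: "open W" "x \<in> W" "Cinf_on g W" "\<forall>y\<in>S \<inter> W. g y = f y"
    using assms unfolding smooth_on_iff by blast
  have "isCont g x" using Cinf_on_continuous[OF W(3)] W continuous_on_eq_continuous_at by blast
  then have c: "continuous (at x within S) g" by (rule continuous_at_imp_continuous_within)
  obtain d where d: "d > 0" "ball x d \<subseteq> W" using W open_contains_ball by blast
  show "continuous (at x within S) f"
  proof (rule continuous_transform_within[OF c d(1) x])
    fix y assume y: "y \<in> S" "dist y x < d"
    then have "y \<in> W" using d(2) by (auto simp: dist_commute)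
    then show "g y = f y" using W(4) y by blast
  qed
qed

lemma smooth_on_differentiable:
  assumes "smooth_on f S" "x \<in> S"
  shows "(f has_derivative frechet_derivative f (at x within S)) (at x within S)"
proof -
  from assms obtain W g where W: "open W" "x \<in> W" "Cinf_on g W" "\<forall>y\<in>S \<inter> W. g y = f y"
    unfolding smooth_on_iff by blast
  have c: "(g has_derivative frechet_derivative g (at x)) (at x within S)"
    using Cinf_on_has_derivative[OF W(3,2)] by (rule has_derivative_at_withinI)
  obtain d where d: "d > 0" "ball x d \<subseteq> W" using W open_contains_ball by blast
  have "(f has_derivative frechet_derivative g (at x)) (at x within S)"
  proof (rule has_derivative_transform_within[OF c d(1) assms(2)])
    fix y assume y: "y \<in> S" "dist y x < d"
    then have "y \<in> W" using d(2) by (auto simp: dist_commute)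
    then show "g y = f y" using W(4) y by blast
  qed
  then have "f differentiable (at x within S)" by (auto simp: differentiable_def)
  then show ?thesis by (simp add: frechet_derivative_works)
qed

lemma subspace_projection_exists:
  fixes E :: "'a::euclidean_space set"
  assumes "subspace E"
  obtains P where "linear P" "\<And>x. P x \<in> E" "\<And>x. x \<in> E \<Longrightarrow> P x = x"
proof -
  obtain g where "g ` UNIV \<subseteq> E" "linear g" "\<forall>v\<in>E. g (id v) = v"
    using linear_exists_left_inverse_on[OF linear_id assms inj_on_id] by blast
  then show ?thesis using that[of g] by auto
qed

text \<open>Composition with a projection onto the model space turns smooth maps on its relatively open
  subsets into smooth maps on open sets.\<close>

lemma Cinf_on_projection:
  fixes f :: "'a::euclidean_space \<Rightarrow> 'b::euclidean_space" and P :: "'a \<Rightarrow> 'a"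
  assumes P: "linear P" "\<And>x. P x \<in> E" and S: "openin (top_of_set E) S" and f: "smooth_on f S"
  shows "open (P -` S)" "Cinf_on (\<lambda>x. f (P x)) (P -` S)"
proof -
  have contP: "continuous_on UNIV P"
    by (rule linear_continuous_on[OF P(1)[unfolded linear_conv_bounded_linear]])
  have "openin (top_of_set UNIV) (UNIV \<inter> P -` S)"
    by (rule continuous_openin_preimage[OF contP _ S]) (use P in auto)
  then show op: "open (P -` S)" by simp
  show "Cinf_on (\<lambda>x. f (P x)) (P -` S)"
  proof (rule Cinf_on_local)
    fix x assume x: "x \<in> P -` S"
    then obtain W g where W: "open W" "P x \<in> W" "Cinf_on g W" "\<forall>y\<in>S \<inter> W. g y = f y"
      using f unfolding smooth_on_iff by blast
    have oW: "open (P -` W)"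
      using contP W(1) by (simp add: open_vimage)
    have o: "open (P -` (S \<inter> W))" using op oW by (simp add: vimage_Int open_Int)
    have "Cinf_on (\<lambda>x. g (P x)) (P -` (S \<inter> W))"
      by (rule Cinf_on_compose[OF o W(1) Cinf_on_linear[OF o P(1)] W(3)]) auto
    then have "Cinf_on (\<lambda>x. f (P x)) (P -` (S \<inter> W))"
      by (rule Cinf_on_cong[OF o, rotated]) (use W(4) in auto)
    then show "\<exists>U. open U \<and> x \<in> U \<and> Cinf_on (\<lambda>x. f (P x)) U"
      using o x W(2) by blast
  qed
qed

lemma smooth_embedding_iff:
  "smooth_embedding l S T \<longleftrightarrow> smooth_on l S \<and> l ` S \<subseteq> T \<and> inj_on l S \<and> smooth_on (the_inv_into S l) (l ` S)"
proof
  assume "smooth_embedding l S T"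
  then obtain m where *: "smooth_on l S" "l ` S \<subseteq> T" "smooth_on m (l ` S)" "\<forall>x\<in>S. m (l x) = x"
    unfolding smooth_embedding_def by blast
  then have inj: "inj_on l S" by (metis inj_on_inverseI)
  have "smooth_on (the_inv_into S l) (l ` S)"
    by (rule smooth_on_cong[OF _ *(3)]) (use *(4) inj in \<open>auto simp: the_inv_into_f_f\<close>)
  then show "smooth_on l S \<and> l ` S \<subseteq> T \<and> inj_on l S \<and> smooth_on (the_inv_into S l) (l ` S)"
    using * inj by simp
next
  assume "smooth_on l S \<and> l ` S \<subseteq> T \<and> inj_on l S \<and> smooth_on (the_inv_into S l) (l ` S)"
  then show "smooth_embedding l S T"
    unfolding smooth_embedding_def by (auto simp: the_inv_into_f_f)
qed

lemma smooth_embedding_open: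
  fixes l :: "'e::euclidean_space \<Rightarrow> 'e"
  assumes "smooth_embedding l S T" "subspace E" "openin (top_of_set E) S" "T \<subseteq> E"
    "openin (top_of_set E) V" "V \<subseteq> S"
  shows "openin (top_of_set E) (l ` V)"
proof (rule invariance_of_domain_subspaces[OF assms(5,2,2) order_refl])
  have l: "smooth_on l S" "l ` S \<subseteq> T" "inj_on l S"
    using assms(1) unfolding smooth_embedding_iff by auto
  show "continuous_on V l" using smooth_on_continuous[OF l(1)] assms(6) continuous_on_subset by blast
  show "l \<in> V \<rightarrow> E" using l assms by blast
  show "inj_on l V" using l assms inj_on_subset by blast
qed

lemma smooth_embedding_subset:
  assumes "smooth_embedding l S T" "S' \<subseteq> S" "l ` S' \<subseteq> T'"
  shows "smooth_embedding l S' T'"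
proof -
  obtain m where "smooth_on l S" "smooth_on m (l ` S)" "\<forall>x\<in>S. m (l x) = x"
    using assms(1) unfolding smooth_embedding_def by blast
  then show ?thesis using assms(2,3) unfolding smooth_embedding_def
    by (meson image_mono smooth_on_subset subsetD)
qed

lemma smooth_embedding_compose:
  assumes "smooth_embedding l S T" "smooth_embedding k T R"
  shows "smooth_embedding (\<lambda>x. k (l x)) S R"
proof -
  obtain m where m: "smooth_on l S" "l ` S \<subseteq> T" "smooth_on m (l ` S)" "\<forall>x\<in>S. m (l x) = x"
    using assms(1) unfolding smooth_embedding_def by blast
  obtain n where n: "smooth_on k T" "k ` T \<subseteq> R" "smooth_on n (k ` T)" "\<forall>x\<in>T. n (k x) = x"
    using assms(2) unfolding smooth_embedding_def by blast
  have "smooth_on (\<lambda>x. k (l x)) S" by (rule smooth_on_compose[OF m(1) n(1) m(2)])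
  moreover have "smooth_on (\<lambda>x. m (n x)) ((\<lambda>x. k (l x)) ` S)"
    by (rule smooth_on_compose[OF smooth_on_subset[OF n(3)] m(3)]) (use m n in auto)
  ultimately show ?thesis unfolding smooth_embedding_def
    using m n by (intro conjI exI[of _ "\<lambda>x. m (n x)"]) (auto simp: image_subset_iff)
qed

lemma smooth_embedding_inverse:
  assumes "smooth_embedding l S T" "S' \<subseteq> l ` S"
  shows "smooth_embedding (the_inv_into S l) S' S"
proof -
  have l: "smooth_on l S" "inj_on l S" "smooth_on (the_inv_into S l) (l ` S)"
    using assms(1) unfolding smooth_embedding_iff by auto
  have im: "the_inv_into S l ` S' \<subseteq> S" using assms(2) l(2) by (auto simp: the_inv_into_f_f)
  show ?thesis unfolding smooth_embedding_def
    using l assms(2) im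
    by (intro conjI exI[of _ l]) (auto intro: smooth_on_subset simp: f_the_inv_into_f)
qed

section \<open>Orbifold charts\<close>

lemma chart_orbit_eq: "chart_orbit c u = {\<gamma> u | \<gamma>. \<gamma> \<in> Grp c}"
  by (simp add: chart_orbit_def orbit_def chart_group_def)

lemma subgroup_BijGroup_iff:
  "subgroup G (BijGroup D) \<longleftrightarrow> G \<subseteq> Bij D \<and> (\<lambda>x\<in>D. x) \<in> G \<and>
     (\<forall>\<gamma>\<in>G. \<forall>\<delta>\<in>G. compose D \<gamma> \<delta> \<in> G) \<and> (\<forall>\<gamma>\<in>G. restrict (inv_into D \<gamma>) D \<in> G)"
    (is "?L \<longleftrightarrow> ?R")
proof
  assume L: ?L
  have sub: "G \<subseteq> Bij D" using subgroup.subset[OF L] by (simp add: BijGroup_def)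
  moreover have "(\<lambda>x\<in>D. x) \<in> G" using subgroup.one_closed[OF L] by (simp add: BijGroup_def)
  moreover have "compose D \<gamma> \<delta> \<in> G" if "\<gamma> \<in> G" "\<delta> \<in> G" for \<gamma> \<delta>
    using subgroup.m_closed[OF L that] that sub by (auto simp: BijGroup_def subset_iff)
  moreover have "restrict (inv_into D \<gamma>) D \<in> G" if "\<gamma> \<in> G" for \<gamma>
    using subgroup.m_inv_closed[OF L that] that sub inv_BijGroup[of \<gamma> D] by auto
  ultimately show ?R by blast
next
  assume R: ?R
  show ?L
  proof
    show "G \<subseteq> carrier (BijGroup D)" using R by (simp add: BijGroup_def)
    show "\<one>\<^bsub>BijGroup D\<^esub> \<in> G" using R by (simp add: BijGroup_def)
    show "\<gamma> \<otimes>\<^bsub>BijGroup D\<^esub> \<delta> \<in> G" if "\<gamma> \<in> G" "\<delta> \<in> G" for \<gamma> \<delta>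
      using R that by (auto simp: BijGroup_def subset_iff)
    show "inv\<^bsub>BijGroup D\<^esub> \<gamma> \<in> G" if "\<gamma> \<in> G" for \<gamma>
      using R that inv_BijGroup[of \<gamma> D] by auto
  qed
qed

lemma topspace_quotient_topology: "topspace (quotient_topology X q) = q ` topspace X"
proof
  show "topspace (quotient_topology X q) \<subseteq> q ` topspace X"
    using openin_topspace[of "quotient_topology X q"] unfolding openin_quotient_topology by blast
  have "{x \<in> topspace X. q x \<in> q ` topspace X} = topspace X" by blast
  then have "openin (quotient_topology X q) (q ` topspace X)"
    unfolding openin_quotient_topology by simp
  then show "q ` topspace X \<subseteq> topspace (quotient_topology X q)" by (rule openin_subset)
qed

text \<open>A chart induces a homeomorphism of the orbit space onto its image exactly if its projection
  is open and has the orbits as its fibres; this form is used throughout.\<close>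

lemma orbifold_chart_iff:
  "orbifold_chart E X c \<longleftrightarrow>
     openin (top_of_set E) (Dom c) \<and> connected (Dom c) \<and> finite (Grp c) \<and>
     subgroup (Grp c) (BijGroup (Dom c)) \<and> (\<forall>\<gamma>\<in>Grp c. smooth_on \<gamma> (Dom c)) \<and>
     continuous_map (top_of_set (Dom c)) X (Proj c) \<and> open_map (top_of_set (Dom c)) X (Proj c) \<and>
     (\<forall>u\<in>Dom c. \<forall>v\<in>Dom c. Proj c u = Proj c v \<longleftrightarrow> (\<exists>\<gamma>\<in>Grp c. v = \<gamma> u))" (is "_ \<longleftrightarrow> ?R")
proof -
  define D where "D = Dom c"
  define G where "G = Grp c"
  have top: "topspace (orbit_space c) = chart_orbit c ` D"
    by (simp add: orbit_space_def topspace_quotient_topology D_def)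
  show ?thesis
  proof
    assume L: "orbifold_chart E X c"
    have sg: "subgroup G (BijGroup D)" and sm: "\<And>\<gamma>. \<gamma> \<in> G \<Longrightarrow> smooth_on \<gamma> D"
      and inv: "\<And>\<gamma> u. \<gamma> \<in> G \<Longrightarrow> u \<in> D \<Longrightarrow> Proj c (\<gamma> u) = Proj c u"
      and op: "openin X (chart_image c)"
      using L unfolding orbifold_chart_def D_def G_def by auto
    obtain \<psi> where \<psi>: "homeomorphic_map (orbit_space c) (subtopology X (chart_image c)) \<psi>"
      "\<And>u. u \<in> D \<Longrightarrow> \<psi> (chart_orbit c u) = Proj c u"
      using L unfolding orbifold_chart_def D_def by blast
    have sg': "G \<subseteq> Bij D" "(\<lambda>x\<in>D. x) \<in> G" "\<And>\<gamma> \<delta>. \<gamma> \<in> G \<Longrightarrow> \<delta> \<in> G \<Longrightarrow> compose D \<gamma> \<delta> \<in> G"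
       "\<And>\<gamma>. \<gamma> \<in> G \<Longrightarrow> restrict (inv_into D \<gamma>) D \<in> G"
      using sg unfolding subgroup_BijGroup_iff by auto
    have bij: "bij_betw \<gamma> D D" if "\<gamma> \<in> G" for \<gamma> using sg'(1) that by (auto simp: Bij_def)
    have self: "u \<in> chart_orbit c u" if "u \<in> D" for u
      using sg'(2) that unfolding chart_orbit_eq G_def
      by (intro CollectI exI[of _ "\<lambda>x\<in>D. x"]) auto
    have om: "openin X (Proj c ` V)" if V: "openin (top_of_set D) V" for V
    proof -
      have VD: "V \<subseteq> D" using V openin_imp_subset by blast
      have "{u \<in> D. chart_orbit c u \<in> chart_orbit c ` V} = (\<Union>\<gamma>\<in>G. D \<inter> \<gamma> -` V)" (is "?A = ?B")
      proof
        show "?A \<subseteq> ?B"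
        proof
          fix u assume "u \<in> ?A"
          then obtain v where v: "u \<in> D" "v \<in> V" "chart_orbit c u = chart_orbit c v" by auto
          then have "v \<in> chart_orbit c u" using self VD by auto
          then obtain \<gamma> where "\<gamma> \<in> G" "v = \<gamma> u" unfolding chart_orbit_eq G_def by auto
          then show "u \<in> ?B" using v by auto
        qed
        show "?B \<subseteq> ?A"
        proof
          fix u assume "u \<in> ?B"
          then obtain \<gamma> where g: "u \<in> D" "\<gamma> \<in> G" "\<gamma> u \<in> V" by auto
          have "Proj c (\<gamma> u) = Proj c u" using inv g by auto
          then have "\<psi> (chart_orbit c u) = \<psi> (chart_orbit c (\<gamma> u))" using \<psi>(2) g VD by auto
          then have "chart_orbit c u = chart_orbit c (\<gamma> u)"
            using homeomorphic_imp_injective_map[OF \<psi>(1)] g VD unfolding top by (auto dest: inj_onD)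
          then show "u \<in> ?A" using g by auto
        qed
      qed
      moreover have "openin (top_of_set D) (\<Union>\<gamma>\<in>G. D \<inter> \<gamma> -` V)"
      proof (intro openin_Union ballI, clarify)
        fix \<gamma> assume "\<gamma> \<in> G"
        then show "openin (top_of_set D) (D \<inter> \<gamma> -` V)"
          using bij[of \<gamma>] by (intro continuous_openin_preimage[OF smooth_on_continuous[OF sm] _ V])
            (auto simp: bij_betw_def)
      qed
      ultimately have "openin (orbit_space c) (chart_orbit c ` V)"
        unfolding orbit_space_def openin_quotient_topology using VD by (auto simp: D_def)
      then have "openin (subtopology X (chart_image c)) (\<psi> ` chart_orbit c ` V)"
        using homeomorphic_imp_open_map[OF \<psi>(1)] by (simp add: open_map_def)
      moreover have "\<psi> ` chart_orbit c ` V = Proj c ` V"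
        using \<psi>(2) VD by (force simp: image_image)
      ultimately show ?thesis using op openin_trans_full by fastforce
    qed
    have fib: "Proj c u = Proj c v \<longleftrightarrow> (\<exists>\<gamma>\<in>G. v = \<gamma> u)" if "u \<in> D" "v \<in> D" for u v
    proof
      assume "Proj c u = Proj c v"
      then have "\<psi> (chart_orbit c u) = \<psi> (chart_orbit c v)" using \<psi>(2) that by auto
      then have "chart_orbit c u = chart_orbit c v"
        using homeomorphic_imp_injective_map[OF \<psi>(1)] that unfolding top by (auto dest: inj_onD)
      then show "\<exists>\<gamma>\<in>G. v = \<gamma> u" using self[OF that(2)] unfolding chart_orbit_eq G_def by auto
    next
      assume "\<exists>\<gamma>\<in>G. v = \<gamma> u"
      then show "Proj c u = Proj c v" using inv that by auto
    qed
    show ?R using L om fib unfolding orbifold_chart_def open_map_def D_def G_def by blast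
  next
    assume R: ?R
    have sg': "(\<lambda>x\<in>D. x) \<in> G" and GB: "G \<subseteq> Bij D"
      using R unfolding subgroup_BijGroup_iff D_def G_def by auto
    have om: "openin X (Proj c ` V)" if "openin (top_of_set D) V" for V
      using R that unfolding open_map_def D_def by blast
    have cont: "continuous_map (top_of_set D) X (Proj c)" using R D_def by auto
    have fib: "Proj c u = Proj c v \<longleftrightarrow> (\<exists>\<gamma>\<in>G. v = \<gamma> u)" if "u \<in> D" "v \<in> D" for u v
      using R that unfolding D_def G_def by blast
    have inD: "\<gamma> u \<in> D" if "\<gamma> \<in> G" "u \<in> D" for \<gamma> u
      using GB that by (auto simp: Bij_def bij_betw_def)
    have orb: "chart_orbit c u = {v \<in> D. Proj c u = Proj c v}" if "u \<in> D" for u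
      unfolding chart_orbit_eq using fib[OF that] inD that by (auto simp: G_def)
    have ci: "openin X (chart_image c)" unfolding chart_image_def using om[of D] by (auto simp: D_def)
    define \<psi> where "\<psi> = (\<lambda>Q. Proj c (SOME u. u \<in> Q))"
    have \<psi>: "\<psi> (chart_orbit c u) = Proj c u" if "u \<in> D" for u
    proof -
      have "u \<in> chart_orbit c u" using orb that by auto
      then have "(SOME u'. u' \<in> chart_orbit c u) \<in> chart_orbit c u" by (rule someI)
      then show ?thesis unfolding \<psi>_def orb[OF that] by simp
    qed
    have im: "\<psi> ` chart_orbit c ` V = Proj c ` V" if "V \<subseteq> D" for V
      using \<psi> that by (force simp: image_image)
    have "homeomorphic_map (orbit_space c) (subtopology X (chart_image c)) \<psi>"
    proof (rule bijective_open_imp_homeomorphic_map)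
      show "continuous_map (orbit_space c) (subtopology X (chart_image c)) \<psi>"
        unfolding continuous_map_def
      proof (intro conjI allI impI)
        show "\<psi> \<in> topspace (orbit_space c) \<rightarrow> topspace (subtopology X (chart_image c))"
          unfolding top using \<psi> openin_subset[OF ci] by (auto simp: chart_image_def D_def)
        fix U assume "openin (subtopology X (chart_image c)) U"
        then have "openin X U" using ci openin_trans_full by blast
        then have "openin (top_of_set D) {u \<in> D. Proj c u \<in> U}"
          using cont unfolding continuous_map_def by auto
        moreover have "{u \<in> D. chart_orbit c u \<in> {Q \<in> chart_orbit c ` D. \<psi> Q \<in> U}} = {u \<in> D. Proj c u \<in> U}"
          using \<psi> by auto
        ultimately show "openin (orbit_space c) {Q \<in> topspace (orbit_space c). \<psi> Q \<in> U}"
          unfolding top unfolding orbit_space_def openin_quotient_topology by (auto simp: D_def)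
      qed
      show "open_map (orbit_space c) (subtopology X (chart_image c)) \<psi>"
        unfolding open_map_def
      proof (intro allI impI)
        fix Q assume Q: "openin (orbit_space c) Q"
        define V where "V = {u \<in> D. chart_orbit c u \<in> Q}"
        have V: "openin (top_of_set D) V" "Q = chart_orbit c ` V"
          using Q unfolding V_def D_def orbit_space_def openin_quotient_topology by auto
        have VD: "V \<subseteq> D" by (auto simp: V_def)
        have "openin X (\<psi> ` Q)" unfolding V(2) im[OF VD] by (rule om[OF V(1)])
        moreover have "\<psi> ` Q \<subseteq> chart_image c"
          unfolding V(2) im[OF VD] using VD by (auto simp: chart_image_def D_def)
        ultimately show "openin (subtopology X (chart_image c)) (\<psi> ` Q)"
          by (metis openin_subtopology_Int2 Int_absorb1 inf.absorb_iff2 openin_subtopology)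
      qed
      show "\<psi> ` topspace (orbit_space c) = topspace (subtopology X (chart_image c))"
        unfolding top im[OF order_refl] using openin_subset[OF ci] by (auto simp: chart_image_def D_def)
      show "inj_on \<psi> (topspace (orbit_space c))"
        unfolding top by (rule inj_onI) (use \<psi> orb in auto)
    qed
    then show "orbifold_chart E X c"
      unfolding orbifold_chart_def using R ci \<psi> fib inD unfolding D_def G_def
      by (metis (no_types, lifting))
  qed
qed

context
  fixes E :: "'e::euclidean_space set" and X :: "'a topology" and c :: "('e, 'a) orb_chart"
  assumes c: "orbifold_chart E X c"
begin

lemma chart_Dom: "openin (top_of_set E) (Dom c)" "connected (Dom c)" "Dom c \<subseteq> E"
  using c openin_imp_subset unfolding orbifold_chart_iff by auto

lemma chart_Grp: "finite (Grp c)" "subgroup (Grp c) (BijGroup (Dom c))"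
  "\<gamma> \<in> Grp c \<Longrightarrow> smooth_on \<gamma> (Dom c)"
  using c unfolding orbifold_chart_iff by auto

lemma chart_Proj: "continuous_map (top_of_set (Dom c)) X (Proj c)"
  "openin (top_of_set (Dom c)) V \<Longrightarrow> openin X (Proj c ` V)"
  using c unfolding orbifold_chart_iff open_map_def by auto

lemma chart_Proj_eq_iff:
  "u \<in> Dom c \<Longrightarrow> v \<in> Dom c \<Longrightarrow> Proj c u = Proj c v \<longleftrightarrow> (\<exists>\<gamma>\<in>Grp c. v = \<gamma> u)"
  using c unfolding orbifold_chart_iff by blast

lemma chart_bij: "\<gamma> \<in> Grp c \<Longrightarrow> bij_betw \<gamma> (Dom c) (Dom c)"
  using chart_Grp(2) unfolding subgroup_BijGroup_iff Bij_def by auto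

lemma chart_in: "\<gamma> \<in> Grp c \<Longrightarrow> u \<in> Dom c \<Longrightarrow> \<gamma> u \<in> Dom c"
  using chart_bij by (auto simp: bij_betw_def)

lemma chart_extensional: "\<gamma> \<in> Grp c \<Longrightarrow> \<gamma> \<in> extensional (Dom c)"
  using chart_Grp(2) unfolding subgroup_BijGroup_iff Bij_def by auto

lemma chart_invariant: "\<gamma> \<in> Grp c \<Longrightarrow> u \<in> Dom c \<Longrightarrow> Proj c (\<gamma> u) = Proj c u"
  using chart_Proj_eq_iff[of u "\<gamma> u"] chart_in by auto

lemma chart_id: "(\<lambda>x\<in>Dom c. x) \<in> Grp c"
  using chart_Grp(2) unfolding subgroup_BijGroup_iff by auto

lemma chart_compose:
  assumes "\<gamma> \<in> Grp c" "\<delta> \<in> Grp c"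
  obtains \<epsilon> where "\<epsilon> \<in> Grp c" "\<And>u. u \<in> Dom c \<Longrightarrow> \<epsilon> u = \<gamma> (\<delta> u)"
  using chart_Grp(2) assms that[of "compose (Dom c) \<gamma> \<delta>"]
  unfolding subgroup_BijGroup_iff by (simp add: compose_def)

lemma chart_inverse:
  assumes "\<gamma> \<in> Grp c"
  obtains \<delta> where "\<delta> \<in> Grp c" "\<And>u. u \<in> Dom c \<Longrightarrow> \<delta> (\<gamma> u) = u" "\<And>u. u \<in> Dom c \<Longrightarrow> \<gamma> (\<delta> u) = u"
proof (rule that[of "restrict (inv_into (Dom c) \<gamma>) (Dom c)"])
  note b = chart_bij[OF assms]
  show "restrict (inv_into (Dom c) \<gamma>) (Dom c) \<in> Grp c"
    using chart_Grp(2) assms unfolding subgroup_BijGroup_iff by simp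
  show "restrict (inv_into (Dom c) \<gamma>) (Dom c) (\<gamma> u) = u" if "u \<in> Dom c" for u
    using chart_in[OF assms that] b that by (simp add: bij_betw_inv_into_left)
  show "\<gamma> (restrict (inv_into (Dom c) \<gamma>) (Dom c) u) = u" if "u \<in> Dom c" for u
    using b that by (simp add: bij_betw_inv_into_right)
qed

lemma chart_smooth_embedding: assumes "\<gamma> \<in> Grp c" shows "smooth_embedding \<gamma> (Dom c) (Dom c)"
proof -
  obtain \<delta> where d: "\<delta> \<in> Grp c" "\<And>u. u \<in> Dom c \<Longrightarrow> \<delta> (\<gamma> u) = u" "\<And>u. u \<in> Dom c \<Longrightarrow> \<gamma> (\<delta> u) = u"
    by (rule chart_inverse[OF assms]) (erule that; blast)
  have im: "\<gamma> ` Dom c = Dom c" using chart_bij[OF assms] by (simp add: bij_betw_def)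
  show ?thesis unfolding smooth_embedding_def im
    using chart_Grp(3)[OF assms] chart_Grp(3)[OF d(1)] d(2) by blast
qed

lemma chart_image_subset: "chart_image c \<subseteq> topspace X"
  using chart_Proj(1) unfolding chart_image_def continuous_map_def by auto

lemma chart_image_open: "openin X (chart_image c)"
  unfolding chart_image_def by (rule chart_Proj(2)) simp

lemma chart_Proj_open:
  assumes "openin (top_of_set E) V" "V \<subseteq> Dom c" shows "openin X (Proj c ` V)"
  by (rule chart_Proj(2), rule openin_subset_trans[OF assms chart_Dom(3)])

text \<open>The set of points whose orbit stays close to the orbit of \<open>u\<close> element by element is invariant
  under the stabilizer of \<open>u\<close> and too small to meet its translates by other group elements; its
  component at \<open>u\<close> has the same properties.\<close>

lemma chart_small_invariant_nbhd:
  assumes E: "subspace E" and u: "u \<in> Dom c" and N: "openin (top_of_set E) N" "u \<in> N"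
  obtains D where "openin (top_of_set E) D" "connected D" "u \<in> D" "D \<subseteq> N" "D \<subseteq> Dom c"
    "\<forall>\<gamma>\<in>Grp c. \<gamma> u = u \<longrightarrow> \<gamma> ` D = D"
    "\<forall>\<gamma>\<in>Grp c. \<gamma> u \<noteq> u \<longrightarrow> \<gamma> ` D \<inter> D = {}"
proof -
  obtain e where e: "e > 0" "\<And>\<gamma>. \<gamma> \<in> Grp c \<Longrightarrow> \<gamma> u \<noteq> u \<Longrightarrow> 2 * e \<le> dist (\<gamma> u) u"
  proof -
    define M where "M = insert 1 ((\<lambda>\<gamma>. dist (\<gamma> u) u) ` {\<gamma>\<in>Grp c. \<gamma> u \<noteq> u})"
    have M: "finite M" "M \<noteq> {}" "\<forall>m\<in>M. m > 0" using chart_Grp(1) by (auto simp: M_def)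
    have "Min M > 0" using M by auto
    moreover have "Min M \<le> dist (\<gamma> u) u" if "\<gamma> \<in> Grp c" "\<gamma> u \<noteq> u" for \<gamma>
      by (rule Min_le[OF M(1)]) (use that in \<open>auto simp: M_def\<close>)
    ultimately show ?thesis using that[of "Min M / 2"] by auto
  qed
  define W where "W = (\<lambda>\<gamma>. Dom c \<inter> \<gamma> -` (E \<inter> ball (\<gamma> u) e \<inter> (if \<gamma> u = u then N else UNIV)))"
  define K where "K = Dom c \<inter> (\<Inter>\<gamma>\<in>Grp c. W \<gamma>)"
  have K: "x \<in> K \<longleftrightarrow> x \<in> Dom c \<and> (\<forall>\<gamma>\<in>Grp c. dist (\<gamma> u) (\<gamma> x) < e \<and> (\<gamma> u = u \<longrightarrow> \<gamma> x \<in> N))" for x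
    unfolding K_def W_def using chart_in chart_Dom(3) by (auto split: if_splits)
  have W: "openin (top_of_set (Dom c)) (W \<gamma>)" if "\<gamma> \<in> Grp c" for \<gamma>
    unfolding W_def
  proof (rule continuous_openin_preimage[where T = E])
    show "continuous_on (Dom c) \<gamma>" using chart_Grp(3)[OF that] by (rule smooth_on_continuous)
    show "\<gamma> \<in> Dom c \<rightarrow> E" using chart_in[OF that] chart_Dom(3) by auto
    show "openin (top_of_set E) (E \<inter> ball (\<gamma> u) e \<inter> (if \<gamma> u = u then N else UNIV))"
      using N by (auto intro: openin_Int openin_open_Int)
  qed
  have "openin (top_of_set (Dom c)) (topspace (top_of_set (Dom c)) \<inter> (\<Inter>\<gamma>\<in>Grp c. W \<gamma>))"
    by (subst Int_commute, rule openin_INT[OF chart_Grp(1) W])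
  then have "openin (top_of_set (Dom c)) K" by (simp add: K_def)
  then have oK: "openin (top_of_set E) K" using chart_Dom(1) openin_trans by blast
  have uK: "u \<in> K" using u N e by (auto simp: K)
  have KN: "x \<in> N" "dist u x < e" if "x \<in> K" for x
    using chart_id that u unfolding K by force+
  define D where "D = connected_component_set K u"
  have DK: "D \<subseteq> K" unfolding D_def by (rule connected_component_subset)
  have uD: "u \<in> D" unfolding D_def using uK by (simp add: connected_component_refl)
  have conn: "connected D" unfolding D_def by (rule connected_connected_component)
  have "locally connected K"
    by (rule locally_open_subset[OF convex_imp_locally_connected[OF subspace_imp_convex[OF E]] oK])
  then have "openin (top_of_set K) D"
    unfolding D_def by (rule openin_connected_component_locally_connected)
  then have oD: "openin (top_of_set E) D" using oK openin_trans by blast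
  have invK: "\<sigma> x \<in> K" if s: "\<sigma> \<in> Grp c" "\<sigma> u = u" "x \<in> K" for \<sigma> x
    unfolding K
  proof (intro conjI ballI)
    show "\<sigma> x \<in> Dom c" using chart_in that K by blast
    fix \<gamma> assume g: "\<gamma> \<in> Grp c"
    obtain \<epsilon> where \<epsilon>: "\<epsilon> \<in> Grp c" "\<And>u. u \<in> Dom c \<Longrightarrow> \<epsilon> u = \<gamma> (\<sigma> u)"
      by (rule chart_compose[OF g s(1)]) (erule that; blast)
    have "x \<in> Dom c" using that K by blast
    then have "dist (\<epsilon> u) (\<epsilon> x) < e" "\<epsilon> u = u \<longrightarrow> \<epsilon> x \<in> N" "\<epsilon> u = \<gamma> u" "\<epsilon> x = \<gamma> (\<sigma> x)"
      using \<epsilon> that K u by auto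
    then show "dist (\<gamma> u) (\<gamma> (\<sigma> x)) < e" "\<gamma> u = u \<longrightarrow> \<gamma> (\<sigma> x) \<in> N" by auto
  qed
  have DC: "D \<subseteq> Dom c" using DK K by blast
  have invD: "\<sigma> ` D \<subseteq> D" if "\<sigma> \<in> Grp c" "\<sigma> u = u" for \<sigma>
    unfolding D_def
  proof (rule connected_component_maximal)
    show "u \<in> \<sigma> ` connected_component_set K u"
      using uD that(2) unfolding D_def by (metis imageI)
    show "connected (\<sigma> ` connected_component_set K u)"
      using conn DC chart_Grp(3)[OF that(1)] unfolding D_def
      by (intro connected_continuous_image) (auto intro: smooth_on_continuous smooth_on_subset)
    show "\<sigma> ` connected_component_set K u \<subseteq> K"
      using invK[OF that] DK unfolding D_def by blast
  qed
  have "D \<subseteq> N" using KN DK by blast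
  moreover have "\<gamma> ` D = D" if g: "\<gamma> \<in> Grp c" "\<gamma> u = u" for \<gamma>
  proof
    show "\<gamma> ` D \<subseteq> D" by (rule invD[OF g])
    obtain \<delta> where d: "\<delta> \<in> Grp c" "\<And>u. u \<in> Dom c \<Longrightarrow> \<delta> (\<gamma> u) = u" "\<And>u. u \<in> Dom c \<Longrightarrow> \<gamma> (\<delta> u) = u"
      by (rule chart_inverse[OF g(1)]) (erule that; blast)
    have "\<delta> u = u" using d(2)[OF u] g(2) by simp
    then have dD: "\<delta> ` D \<subseteq> D" by (rule invD[OF d(1)])
    show "D \<subseteq> \<gamma> ` D"
    proof
      fix x assume "x \<in> D"
      then have "\<gamma> (\<delta> x) = x" "\<delta> x \<in> D" using d(3) DC dD by auto
      then show "x \<in> \<gamma> ` D" by (metis imageI)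
    qed
  qed
  moreover have "\<gamma> ` D \<inter> D = {}" if g: "\<gamma> \<in> Grp c" "\<gamma> u \<noteq> u" for \<gamma>
  proof (rule ccontr)
    assume "\<gamma> ` D \<inter> D \<noteq> {}"
    then obtain x where x: "x \<in> K" "\<gamma> x \<in> K" using DK by auto
    have "dist (\<gamma> u) (\<gamma> x) < e" "dist u (\<gamma> x) < e" using x g KN K by auto
    then have "dist (\<gamma> u) u < 2 * e" using dist_triangle2[of "\<gamma> u" u "\<gamma> x"] by linarith
    then show False using e(2)[OF g] by simp
  qed
  ultimately show ?thesis using that[OF oD conn uD _ DC] by blast
qed

end

subsection \<open>Pulling charts back\<close>

text \<open>The chart \<open>c\<close> in the coordinates \<open>m\<close>, with those group elements that preserve the image of \<open>m\<close>.
  If \<open>m\<close> is the identity, this is the restriction of \<open>c\<close> to \<open>D\<close>.\<close>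

definition pull_chart :: "('e::euclidean_space, 'a) orb_chart \<Rightarrow> 'e set \<Rightarrow> ('e \<Rightarrow> 'e) \<Rightarrow> ('e, 'a) orb_chart" where
  "pull_chart c D m =
     \<lparr>Dom = D,
      Grp = {restrict (\<lambda>x. the_inv_into D m (\<gamma> (m x))) D | \<gamma>. \<gamma> \<in> Grp c \<and> \<gamma> ` m ` D = m ` D},
      Proj = (\<lambda>x. Proj c (m x))\<rparr>"

lemma pull_chart_simps [simp]:
  "Dom (pull_chart c D m) = D" "Proj (pull_chart c D m) = (\<lambda>x. Proj c (m x))"
  by (auto simp: pull_chart_def)

lemma chart_image_pull: "chart_image (pull_chart c D m) = Proj c ` m ` D"
  by (auto simp: chart_image_def)

text \<open>By the dichotomy, every identification between points of the image of \<open>m\<close> is made by a group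
  element that preserves this image, so the fibres of the new projection are the orbits of the new
  group.\<close>

lemma orbifold_chart_pull:
  assumes c: "orbifold_chart E X c" and E: "subspace E"
    and D: "openin (top_of_set E) D" "connected D" and m: "smooth_embedding m D (Dom c)"
    and dich: "\<And>\<gamma>. \<gamma> \<in> Grp c \<Longrightarrow> \<gamma> ` m ` D = m ` D \<or> \<gamma> ` m ` D \<inter> m ` D = {}"
  shows "orbifold_chart E X (pull_chart c D m)"
proof -
  let ?i = "the_inv_into D m"
  define H where "H = {\<gamma> \<in> Grp c. \<gamma> ` m ` D = m ` D}"
  define r where "r = (\<lambda>\<gamma>. restrict (\<lambda>x. ?i (\<gamma> (m x))) D)"
  have Grp: "Grp (pull_chart c D m) = r ` H" by (auto simp: pull_chart_def H_def r_def)
  have ms: "smooth_on m D" "m ` D \<subseteq> Dom c" "inj_on m D" "smooth_on ?i (m ` D)"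
    using m unfolding smooth_embedding_iff by auto
  have mD: "m x \<in> Dom c" if "x \<in> D" for x using ms that by auto
  have im: "?i (m x) = x" if "x \<in> D" for x using ms(3) that by (simp add: the_inv_into_f_f)
  have mr: "m (r \<gamma> x) = \<gamma> (m x)" and rD: "r \<gamma> x \<in> D" if "\<gamma> \<in> H" "x \<in> D" for \<gamma> x
  proof -
    have "\<gamma> (m x) \<in> m ` D" using that unfolding H_def by blast
    then obtain y where "y \<in> D" "\<gamma> (m x) = m y" by auto
    then show "m (r \<gamma> x) = \<gamma> (m x)" "r \<gamma> x \<in> D" using that im by (auto simp: r_def)
  qed
  have r_eqI: "r \<gamma> x = y" if "\<gamma> \<in> H" "x \<in> D" "y \<in> D" "\<gamma> (m x) = m y" for \<gamma> x y
    using mr[OF that(1,2)] rD[OF that(1,2)] that ms(3) by (metis inj_onD)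
  have Hid: "(\<lambda>x\<in>Dom c. x) \<in> H"
    using chart_id[OF c] ms(2) by (auto simp: H_def image_iff subset_iff)
  have Hinv: "\<exists>\<delta>\<in>H. (\<forall>u\<in>Dom c. \<delta> (\<gamma> u) = u) \<and> (\<forall>u\<in>Dom c. \<gamma> (\<delta> u) = u)" if "\<gamma> \<in> H" for \<gamma>
  proof -
    have gG: "\<gamma> \<in> Grp c" using that by (simp add: H_def)
    obtain \<delta> where d: "\<delta> \<in> Grp c" "\<And>u. u \<in> Dom c \<Longrightarrow> \<delta> (\<gamma> u) = u" "\<And>u. u \<in> Dom c \<Longrightarrow> \<gamma> (\<delta> u) = u"
      by (rule chart_inverse[OF c gG]) (erule that; blast)
    have "\<delta> ` m ` D = \<delta> ` \<gamma> ` m ` D" using that unfolding H_def by simp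
    also have "\<dots> = m ` D" using d(2) mD by (force simp: image_image)
    finally show ?thesis using d unfolding H_def by blast
  qed
  have bijr: "bij_betw (r \<gamma>) D D" if g: "\<gamma> \<in> H" for \<gamma>
  proof -
    obtain \<delta> where d: "\<delta> \<in> H" "\<forall>u\<in>Dom c. \<delta> (\<gamma> u) = u" "\<forall>u\<in>Dom c. \<gamma> (\<delta> u) = u"
      using Hinv[OF g] by blast
    show ?thesis
    proof (rule bij_betw_byWitness[where f' = "r \<delta>"])
      show "\<forall>x\<in>D. r \<delta> (r \<gamma> x) = x"
        using d g mr rD mD by (intro ballI r_eqI) auto
      show "\<forall>x\<in>D. r \<gamma> (r \<delta> x) = x"
        using d g mr rD mD by (intro ballI r_eqI) auto
    qed (use rD d g in auto)
  qed
  have sg: "subgroup (r ` H) (BijGroup D)"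
    unfolding subgroup_BijGroup_iff
  proof (intro conjI ballI)
    show "r ` H \<subseteq> Bij D" using bijr by (auto simp: Bij_def r_def)
    have "r (\<lambda>x\<in>Dom c. x) = (\<lambda>x\<in>D. x)" using mD im by (auto simp: r_def restrict_def fun_eq_iff)
    then show "(\<lambda>x\<in>D. x) \<in> r ` H" using Hid by (metis imageI)
  next
    fix a b assume "a \<in> r ` H" "b \<in> r ` H"
    then obtain \<gamma> \<delta> where gd: "\<gamma> \<in> H" "\<delta> \<in> H" "a = r \<gamma>" "b = r \<delta>" by auto
    have gdG: "\<gamma> \<in> Grp c" "\<delta> \<in> Grp c" using gd by (auto simp: H_def)
    obtain \<epsilon> where e: "\<epsilon> \<in> Grp c" "\<And>u. u \<in> Dom c \<Longrightarrow> \<epsilon> u = \<gamma> (\<delta> u)"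
      by (rule chart_compose[OF c gdG]) (erule that; blast)
    have "\<epsilon> ` m ` D = \<gamma> ` \<delta> ` m ` D" using e(2) mD by (force simp: image_image)
    then have eH: "\<epsilon> \<in> H" using gd e unfolding H_def by simp
    have "r \<epsilon> = compose D a b"
    proof
      fix x show "r \<epsilon> x = compose D a b x"
      proof (cases "x \<in> D")
        case True
        have "r \<epsilon> x = r \<gamma> (r \<delta> x)"
          by (rule r_eqI[OF eH True]) (use True gd mr rD mD e in auto)
        then show ?thesis using True gd by (simp add: compose_def)
      qed (simp add: r_def compose_def)
    qed
    then show "compose D a b \<in> r ` H" using eH by (metis imageI)
  next
    fix a assume "a \<in> r ` H"
    then obtain \<gamma> where g: "\<gamma> \<in> H" "a = r \<gamma>" by auto
    obtain \<delta> where d: "\<delta> \<in> H" "\<forall>u\<in>Dom c. \<delta> (\<gamma> u) = u" "\<forall>u\<in>Dom c. \<gamma> (\<delta> u) = u"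
      using Hinv[OF g(1)] by blast
    have "r \<delta> = restrict (inv_into D a) D"
    proof
      fix x show "r \<delta> x = restrict (inv_into D a) D x"
      proof (cases "x \<in> D")
        case True
        have "a (r \<delta> x) = x" unfolding g(2) by (rule r_eqI[OF g(1)]) (use True d mr rD mD in auto)
        then have "inv_into D a x = r \<delta> x"
          using bijr[OF g(1)] rD[OF d(1) True] g(2) by (metis bij_betw_inv_into_left)
        then show ?thesis using True by simp
      qed (simp add: r_def)
    qed
    then show "restrict (inv_into D a) D \<in> r ` H" using d(1) by (metis imageI)
  qed
  have sm: "smooth_on a D" if a: "a \<in> r ` H" for a
  proof -
    obtain \<gamma> where g: "\<gamma> \<in> H" "a = r \<gamma>" using a by auto
    have "smooth_on (\<lambda>x. \<gamma> (m x)) D"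
      using g by (intro smooth_on_compose[OF ms(1) chart_Grp(3)[OF c]] ms(2)) (simp add: H_def)
    then have "smooth_on (\<lambda>x. ?i (\<gamma> (m x))) D"
      by (rule smooth_on_compose[OF _ ms(4)]) (use g in \<open>auto simp: H_def\<close>)
    then show ?thesis by (rule smooth_on_cong[rotated]) (simp add: g(2) r_def)
  qed
  have cm: "continuous_map (top_of_set D) X (\<lambda>x. Proj c (m x))"
  proof -
    have "continuous_map (top_of_set D) (top_of_set (Dom c)) m"
      using smooth_on_continuous[OF ms(1)] ms(2) by auto
    from continuous_map_compose[OF this chart_Proj(1)[OF c]] show ?thesis by (simp add: o_def)
  qed
  have om: "open_map (top_of_set D) X (\<lambda>x. Proj c (m x))"
    unfolding open_map_def
  proof (intro allI impI)
    fix V assume V: "openin (top_of_set D) V"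
    have VE: "openin (top_of_set E) V" using V D(1) openin_trans by blast
    have VD: "V \<subseteq> D" using V openin_imp_subset by blast
    have "openin (top_of_set E) (m ` V)"
      by (rule smooth_embedding_open[OF m E D(1) chart_Dom(3)[OF c] VE VD])
    then have "openin X (Proj c ` m ` V)"
      by (rule chart_Proj_open[OF c]) (use mD VD in auto)
    then show "openin X ((\<lambda>x. Proj c (m x)) ` V)" by (simp add: image_image)
  qed
  have fib: "Proj c (m u) = Proj c (m v) \<longleftrightarrow> (\<exists>a\<in>r ` H. v = a u)" if uv: "u \<in> D" "v \<in> D" for u v
  proof
    assume "Proj c (m u) = Proj c (m v)"
    then obtain \<gamma> where g: "\<gamma> \<in> Grp c" "m v = \<gamma> (m u)"
      using chart_Proj_eq_iff[OF c mD mD] uv by blast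
    then have "m v \<in> \<gamma> ` m ` D \<inter> m ` D" using uv by (metis IntI imageI)
    then have "\<gamma> \<in> H" using dich[OF g(1)] g unfolding H_def by blast
    moreover from this have "r \<gamma> u = v" using uv g by (intro r_eqI) auto
    ultimately show "\<exists>a\<in>r ` H. v = a u" by blast
  next
    assume "\<exists>a\<in>r ` H. v = a u"
    then obtain \<gamma> where "\<gamma> \<in> H" "v = r \<gamma> u" by auto
    then show "Proj c (m u) = Proj c (m v)"
      using mr[of \<gamma> u] uv chart_invariant[OF c _ mD] by (simp add: H_def)
  qed
  have fin: "finite (r ` H)" using chart_Grp(1)[OF c] by (simp add: H_def)
  show ?thesis
    unfolding orbifold_chart_iff Grp pull_chart_simps
    using D sg sm cm om fib fin by blast
qed

lemma chart_embedding_ident: "chart_embedding c c (\<lambda>x. x)"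
  unfolding chart_embedding_def smooth_embedding_def
  by (auto intro: smooth_on_ident intro!: exI[of _ "\<lambda>x. x"])

lemma locally_compatible_sym: "locally_compatible E X c b \<Longrightarrow> locally_compatible E X b c"
  unfolding locally_compatible_def Int_commute[of "chart_image c"] by blast

lemma locally_compatible_refl: "orbifold_chart E X c \<Longrightarrow> locally_compatible E X c c"
  unfolding locally_compatible_def using chart_embedding_ident by blast

text \<open>Group elements correct the two embeddings of a common chart so that they pass through the chosen
  lifts \<open>u\<close> and \<open>v\<close>; then \<open>\<nu>\<close> is the second embedding after the inverse of the first.\<close>

lemma locally_compatible_transition:
  assumes lc: "locally_compatible E X c b" and E: "subspace E"
    and c: "orbifold_chart E X c" and b: "orbifold_chart E X b"
    and u: "u \<in> Dom c" and v: "v \<in> Dom b" and uv: "Proj c u = Proj b v"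
  obtains N \<nu> where "openin (top_of_set E) N" "u \<in> N" "N \<subseteq> Dom c" "smooth_embedding \<nu> N (Dom b)"
    "\<nu> u = v" "\<forall>x\<in>N. Proj b (\<nu> x) = Proj c x"
proof -
  have "Proj c u \<in> chart_image c \<inter> chart_image b"
    using u v uv unfolding chart_image_def by (metis Int_iff image_eqI)
  then obtain w l k where w: "orbifold_chart E X w" "Proj c u \<in> chart_image w"
    and l: "chart_embedding w c l" and k: "chart_embedding w b k"
    using lc unfolding locally_compatible_def by metis
  obtain z where z: "z \<in> Dom w" "Proj w z = Proj c u" using w(2) by (auto simp: chart_image_def)
  have lz: "l z \<in> Dom c" "Proj c (l z) = Proj c u" and kz: "k z \<in> Dom b" "Proj b (k z) = Proj b v"
    using l k z uv by (auto simp: chart_embedding_def smooth_embedding_def)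
  obtain \<gamma> where g: "\<gamma> \<in> Grp c" "u = \<gamma> (l z)" using chart_Proj_eq_iff[OF c lz(1) u] lz by auto
  obtain \<delta> where d: "\<delta> \<in> Grp b" "v = \<delta> (k z)" using chart_Proj_eq_iff[OF b kz(1) v] kz by auto
  let ?l = "\<lambda>x. \<gamma> (l x)" and ?k = "\<lambda>x. \<delta> (k x)"
  have l': "smooth_embedding ?l (Dom w) (Dom c)"
    by (rule smooth_embedding_compose[OF _ chart_smooth_embedding[OF c g(1)]])
       (use l in \<open>simp add: chart_embedding_def\<close>)
  have k': "smooth_embedding ?k (Dom w) (Dom b)"
    by (rule smooth_embedding_compose[OF _ chart_smooth_embedding[OF b d(1)]])
       (use k in \<open>simp add: chart_embedding_def\<close>)
  have injl: "inj_on ?l (Dom w)" using l' unfolding smooth_embedding_iff by blast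
  have Pl: "Proj c (?l x) = Proj w x" and Pk: "Proj b (?k x) = Proj w x" if "x \<in> Dom w" for x
  proof -
    have "l x \<in> Dom c" "k x \<in> Dom b" "Proj c (l x) = Proj w x" "Proj b (k x) = Proj w x"
      using l k that by (auto simp: chart_embedding_def smooth_embedding_def)
    then show "Proj c (?l x) = Proj w x" "Proj b (?k x) = Proj w x"
      using chart_invariant[OF c g(1)] chart_invariant[OF b d(1)] by auto
  qed
  define N where "N = ?l ` Dom w"
  have N: "openin (top_of_set E) N" unfolding N_def
    by (rule smooth_embedding_open[OF l' E chart_Dom(1)[OF w(1)] chart_Dom(3)[OF c] chart_Dom(1)[OF w(1)] order_refl])
  let ?i = "the_inv_into (Dom w) ?l"
  show ?thesis
  proof (rule that[OF N])
    show "u \<in> N" using z g unfolding N_def by auto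
    show "N \<subseteq> Dom c" using l' unfolding N_def smooth_embedding_def by blast
    show "smooth_embedding (\<lambda>x. ?k (?i x)) N (Dom b)"
      by (rule smooth_embedding_compose[OF smooth_embedding_inverse[OF l'] k']) (simp add: N_def)
    have "?i u = z" unfolding g(2) by (rule the_inv_into_f_f[OF injl z(1)])
    then show "?k (?i u) = v" using d by simp
    show "\<forall>x\<in>N. Proj b (?k (?i x)) = Proj c x"
    proof
      fix x assume "x \<in> N"
      then obtain y where y: "y \<in> Dom w" "x = ?l y" by (auto simp: N_def)
      have "?i x = y" unfolding y(2) by (rule the_inv_into_f_f[OF injl y(1)])
      then show "Proj b (?k (?i x)) = Proj c x" using Pl Pk y by simp
    qed
  qed
qed

context
  fixes E :: "'e::euclidean_space set" and X :: "'a topology" and A :: "('e, 'a) orb_chart set"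
  assumes orb: "orbifold E X A"
begin

lemma orbifold_subspace: "subspace E" and orbifold_Hausdorff: "Hausdorff_space X"
  and atlas_chart: "c \<in> A \<Longrightarrow> orbifold_chart E X c"
  and atlas_compatible: "c \<in> A \<Longrightarrow> b \<in> A \<Longrightarrow> locally_compatible E X c b"
  and atlas_covers: "(\<Union>c\<in>A. chart_image c) = topspace X"
  using orb unfolding orbifold_def orbifold_atlas_def by auto

lemma atlas_maximal:
  assumes c: "orbifold_chart E X c" and lc: "\<And>b. b \<in> A \<Longrightarrow> locally_compatible E X c b"
  shows "c \<in> A"
proof -
  have "orbifold_atlas E X (insert c A)"
    unfolding orbifold_atlas_def
    using c lc atlas_chart atlas_compatible atlas_covers chart_image_subset[OF c]
      locally_compatible_refl[OF c] locally_compatible_sym[OF lc] by auto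
  then show ?thesis using orb unfolding orbifold_def by blast
qed

lemma atlas_lift: assumes "x \<in> topspace X" obtains c u where "c \<in> A" "u \<in> Dom c" "Proj c u = x"
proof -
  obtain c where c: "c \<in> A" "x \<in> chart_image c" using atlas_covers assms by blast
  then obtain u where "u \<in> Dom c" "x = Proj c u" by (auto simp: chart_image_def)
  then show ?thesis using that[OF c(1)] by blast
qed

text \<open>By maximality only compatibility has to be checked: a small restriction of \<open>c\<close> embeds into the
  pulled back chart by the inverse of \<open>m\<close>, and into any other chart of the atlas by a transition
  map.\<close>

lemma pull_chart_in_atlas:
  assumes cA: "c \<in> A" and D: "openin (top_of_set E) D" "connected D"
    and m: "smooth_embedding m D (Dom c)"
    and dich: "\<And>\<gamma>. \<gamma> \<in> Grp c \<Longrightarrow> \<gamma> ` m ` D = m ` D \<or> \<gamma> ` m ` D \<inter> m ` D = {}"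
  shows "pull_chart c D m \<in> A"
proof (rule atlas_maximal)
  note E = orbifold_subspace
  note c = atlas_chart[OF cA]
  show "orbifold_chart E X (pull_chart c D m)" by (rule orbifold_chart_pull[OF c E D m dich])
  fix b assume bA: "b \<in> A"
  note b = atlas_chart[OF bA]
  show "locally_compatible E X (pull_chart c D m) b"
    unfolding locally_compatible_def
  proof
    fix p assume "p \<in> chart_image (pull_chart c D m) \<inter> chart_image b"
    then obtain s v where s: "s \<in> D" "p = Proj c (m s)" and v: "v \<in> Dom b" "p = Proj b v"
      by (auto simp: chart_image_def)
    have sv: "Proj c (m s) = Proj b v" using s v by simp
    have ms: "m s \<in> Dom c" and mD: "m ` D \<subseteq> Dom c" using m s unfolding smooth_embedding_def by auto
    obtain N \<nu> where N: "openin (top_of_set E) N" "m s \<in> N" "N \<subseteq> Dom c" "smooth_embedding \<nu> N (Dom b)"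
      "\<nu> (m s) = v" "\<forall>x\<in>N. Proj b (\<nu> x) = Proj c x"
      by (rule locally_compatible_transition[OF atlas_compatible[OF cA bA] E c b ms v(1) sv]) (rule that)
    have "openin (top_of_set E) (m ` D)"
      by (rule smooth_embedding_open[OF m E D(1) chart_Dom(3)[OF c] D(1) order_refl])
    then have oN: "openin (top_of_set E) (N \<inter> m ` D)" using N(1) by blast
    have sN: "m s \<in> N \<inter> m ` D" using N(2) s(1) by blast
    obtain D' where D': "openin (top_of_set E) D'" "connected D'" "m s \<in> D'" "D' \<subseteq> N \<inter> m ` D" "D' \<subseteq> Dom c"
      "\<forall>\<gamma>\<in>Grp c. \<gamma> (m s) = m s \<longrightarrow> \<gamma> ` D' = D'"
      "\<forall>\<gamma>\<in>Grp c. \<gamma> (m s) \<noteq> m s \<longrightarrow> \<gamma> ` D' \<inter> D' = {}"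
      by (rule chart_small_invariant_nbhd[OF c E ms oN sN]) (rule that)
    have idD: "smooth_embedding (\<lambda>x. x) D' (Dom c)"
      unfolding smooth_embedding_def using D'(5) by (auto intro: smooth_on_ident intro!: exI[of _ "\<lambda>x. x"])
    define w where "w = pull_chart c D' (\<lambda>x. x)"
    have w: "orbifold_chart E X w" unfolding w_def
    proof (rule orbifold_chart_pull[OF c E D'(1,2) idD])
      fix \<gamma> assume "\<gamma> \<in> Grp c"
      then show "\<gamma> ` (\<lambda>x. x) ` D' = (\<lambda>x. x) ` D' \<or> \<gamma> ` (\<lambda>x. x) ` D' \<inter> (\<lambda>x. x) ` D' = {}"
        using D'(6,7) unfolding image_ident by blast
    qed
    have imw: "chart_image w = Proj c ` D'" by (simp add: w_def chart_image_pull)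
    have injm: "inj_on m D" using m unfolding smooth_embedding_iff by blast
    have "chart_embedding w (pull_chart c D m) (the_inv_into D m)"
      unfolding chart_embedding_def w_def
      using smooth_embedding_inverse[OF m, of D'] D'(4) f_the_inv_into_f[OF injm]
      unfolding pull_chart_simps by (metis Int_subset_iff subsetD)
    moreover have "chart_embedding w b \<nu>"
    proof -
      have s: "D' \<subseteq> N" using D'(4) by blast
      then have "\<nu> ` D' \<subseteq> Dom b" using N(4) unfolding smooth_embedding_def by blast
      then show ?thesis
        using smooth_embedding_subset[OF N(4) s] N(6) s unfolding chart_embedding_def w_def by auto
    qed
    moreover have "p \<in> chart_image w" using imw s D'(3) by auto
    moreover have "chart_image w \<subseteq> chart_image (pull_chart c D m)"
      unfolding imw chart_image_pull using D'(4) by blast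
    moreover have "chart_image w \<subseteq> chart_image b"
    proof
      fix q assume "q \<in> chart_image w"
      then obtain x where x: "x \<in> D'" "q = Proj c x" unfolding imw by blast
      then have "x \<in> N" using D'(4) by blast
      then have "q = Proj b (\<nu> x)" "\<nu> x \<in> Dom b" using N(4,6) x(2) by (auto simp: smooth_embedding_def)
      then show "q \<in> chart_image b" by (auto simp: chart_image_def)
    qed
    ultimately show "\<exists>w. orbifold_chart E X w \<and> p \<in> chart_image w \<and>
            chart_image w \<subseteq> chart_image (pull_chart c D m) \<inter> chart_image b \<and>
            (\<exists>l. chart_embedding w (pull_chart c D m) l) \<and> (\<exists>l. chart_embedding w b l)"
      using w by blast
  qed
qed

lemma atlas_transition:
  assumes "c \<in> A" "b \<in> A" "u \<in> Dom c" "v \<in> Dom b" "Proj c u = Proj b v"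
  obtains N \<nu> where "openin (top_of_set E) N" "u \<in> N" "N \<subseteq> Dom c" "smooth_embedding \<nu> N (Dom b)"
    "\<nu> u = v" "\<forall>x\<in>N. Proj b (\<nu> x) = Proj c x"
  by (rule locally_compatible_transition[OF atlas_compatible[OF assms(1,2)] orbifold_subspace
      atlas_chart[OF assms(1)] atlas_chart[OF assms(2)] assms(3-5)]) (rule that)

lemma atlas_restrict:
  assumes cA: "c \<in> A" and u: "u \<in> Dom c" and N: "openin (top_of_set E) N" "u \<in> N"
  obtains b where "b \<in> A" "u \<in> Dom b" "Dom b \<subseteq> N" "Dom b \<subseteq> Dom c" "Proj b = Proj c"
    "Grp b = (\<lambda>\<gamma>. restrict \<gamma> (Dom b)) ` {\<gamma> \<in> Grp c. \<gamma> u = u}"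
proof -
  note c = atlas_chart[OF cA]
  obtain D where D: "openin (top_of_set E) D" "connected D" "u \<in> D" "D \<subseteq> N" "D \<subseteq> Dom c"
    "\<forall>\<gamma>\<in>Grp c. \<gamma> u = u \<longrightarrow> \<gamma> ` D = D"
    "\<forall>\<gamma>\<in>Grp c. \<gamma> u \<noteq> u \<longrightarrow> \<gamma> ` D \<inter> D = {}"
    by (rule chart_small_invariant_nbhd[OF c orbifold_subspace u N]) (rule that)
  have m: "smooth_embedding (\<lambda>x. x) D (Dom c)"
    unfolding smooth_embedding_def using D(5) by (auto intro: smooth_on_ident intro!: exI[of _ "\<lambda>x. x"])
  have A: "pull_chart c D (\<lambda>x. x) \<in> A"
  proof (rule pull_chart_in_atlas[OF cA D(1,2) m])
    fix \<gamma> assume "\<gamma> \<in> Grp c"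
    then show "\<gamma> ` (\<lambda>x. x) ` D = (\<lambda>x. x) ` D \<or> \<gamma> ` (\<lambda>x. x) ` D \<inter> (\<lambda>x. x) ` D = {}"
      using D(6,7) unfolding image_ident by blast
  qed
  have st: "\<gamma> ` D = D \<longleftrightarrow> \<gamma> u = u" if "\<gamma> \<in> Grp c" for \<gamma>
    using D(3,6,7) that by blast
  have i: "the_inv_into D (\<lambda>x. x) y = y" if "y \<in> D" for y
    using that by (rule the_inv_into_f_f[OF inj_on_id2])
  have "restrict (\<lambda>x. the_inv_into D (\<lambda>x. x) (\<gamma> x)) D = restrict \<gamma> D" if "\<gamma> ` D = D" for \<gamma>
    using that i by (auto simp: restrict_def fun_eq_iff)
  then have "Grp (pull_chart c D (\<lambda>x. x)) = (\<lambda>\<gamma>. restrict \<gamma> D) ` {\<gamma> \<in> Grp c. \<gamma> u = u}"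
    using st unfolding pull_chart_def by (auto simp: image_iff) metis+
  then show ?thesis using that[OF A] D(3-5) by simp
qed

end

section \<open>The singular dimension in an arbitrary chart\<close>

text \<open>Suppose that \<open>E\<close> is not contained in \<open>S\<close>, and take a line through \<open>b \<in> S\<close> in a direction
  transverse to \<open>S\<close>. Of the infinitely many points of the line outside \<open>S\<close> two lie in the same member
  of the remaining family, which therefore contains the direction of the line and \<open>b\<close> itself.\<close>

lemma subspace_subset_finite_Union:
  fixes E :: "'a::real_vector set"
  assumes "finite F" and E: "subspace E" and F: "\<And>S. S \<in> F \<Longrightarrow> subspace S" and "E \<subseteq> \<Union>F"
  shows "\<exists>S\<in>F. E \<subseteq> S"
  using assms(1,3,4)
proof (induction F rule: finite_induct)
  case empty
  then show ?case using subspace_0[OF E] by auto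
next
  case (insert S F)
  have S: "subspace S" using insert.prems by auto
  show ?case
  proof (cases "E \<subseteq> S")
    case False
    then obtain a where a: "a \<in> E" "a \<notin> S" by auto
    have "E \<subseteq> \<Union>F"
    proof
      fix b assume b: "b \<in> E"
      show "b \<in> \<Union>F"
      proof (cases "b \<in> S")
        case True
        have *: "\<exists>T\<in>F. b + t *\<^sub>R a \<in> T" if "t \<in> {0<..<1::real}" for t
        proof -
          have "b + t *\<^sub>R a \<notin> S"
          proof
            assume "b + t *\<^sub>R a \<in> S"
            from subspace_diff[OF S this True] have "t *\<^sub>R a \<in> S" by simp
            then have "inverse t *\<^sub>R (t *\<^sub>R a) \<in> S" by (rule subspace_scale[OF S])
            then show False using a that by simp
          qed
          moreover have "b + t *\<^sub>R a \<in> E" using E a b by (simp add: subspace_add subspace_scale)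
          ultimately show ?thesis using insert.prems(2) by blast
        qed
        define f where "f = (\<lambda>t. SOME T. T \<in> F \<and> b + t *\<^sub>R a \<in> T)"
        have f: "f t \<in> F \<and> b + t *\<^sub>R a \<in> f t" if "t \<in> {0<..<1::real}" for t
          unfolding f_def by (rule someI_ex) (use *[OF that] in blast)
        have "finite (f ` {0<..<1})" by (rule finite_subset[OF _ insert.hyps(1)]) (use f in blast)
        moreover have "infinite {0<..<1::real}" by (rule infinite_Ioo) simp
        ultimately obtain s where s: "s \<in> {0<..<1}" "infinite {t\<in>{0<..<1}. f t = f s}"
          using pigeonhole_infinite[of "{0<..<1}" f] by blast
        then have "infinite ({t\<in>{0<..<1}. f t = f s} - {s})" by simp
        then have "{t\<in>{0<..<1}. f t = f s} - {s} \<noteq> {}" by (metis finite.emptyI)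
        then obtain t where t: "t \<in> {0<..<1}" "f t = f s" "t \<noteq> s" by blast
        define T where "T = f s"
        have T: "T \<in> F" "b + s *\<^sub>R a \<in> T" "b + t *\<^sub>R a \<in> T"
          using f[OF s(1)] f[OF t(1)] t(2) by (auto simp: T_def)
        have sT: "subspace T" using insert.prems(1) T(1) by auto
        have "(b + t *\<^sub>R a) - (b + s *\<^sub>R a) \<in> T" using sT T by (intro subspace_diff)
        then have "(t - s) *\<^sub>R a \<in> T" by (simp add: algebra_simps)
        then have "(s / (t - s)) *\<^sub>R ((t - s) *\<^sub>R a) \<in> T" by (rule subspace_scale[OF sT])
        then have "s *\<^sub>R a \<in> T" using t(3) by simp
        then have "(b + s *\<^sub>R a) - s *\<^sub>R a \<in> T" by (rule subspace_diff[OF sT T(2)])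
        then show ?thesis using T(1) by auto
      next
        case False
        then show ?thesis using insert.prems(2) b by blast
      qed
    qed
    then show ?thesis using insert.IH insert.prems(1) by blast
  qed auto
qed

abbreviation tderiv :: "('e::euclidean_space \<Rightarrow> 'f::euclidean_space) \<Rightarrow> 'e set \<Rightarrow> 'e \<Rightarrow> 'e \<Rightarrow> 'f" where
  "tderiv f S u \<equiv> frechet_derivative f (at u within S)"

lemma tderiv_linear: "smooth_on f S \<Longrightarrow> u \<in> S \<Longrightarrow> linear (tderiv f S u)"
  using smooth_on_differentiable has_derivative_linear by blast

lemma tderiv_chain:
  assumes "smooth_on f S" "smooth_on g T" "f ` S \<subseteq> T" "u \<in> S"
  shows "((\<lambda>x. g (f x)) has_derivative (\<lambda>v. tderiv g T (f u) (tderiv f S u v))) (at u within S)"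
proof (rule has_derivative_in_compose[OF smooth_on_differentiable[OF assms(1,4)]])
  have "f u \<in> T" using assms by auto
  then show "(g has_derivative tderiv g T (f u)) (at (f u) within f ` S)"
    using has_derivative_subset[OF smooth_on_differentiable[OF assms(2)] assms(3)] by blast
qed

lemma derivative_in_subspace:
  fixes f :: "'a::euclidean_space \<Rightarrow> 'b::euclidean_space"
  assumes f: "(f has_derivative f') (at u within S)" and E: "subspace E" and S: "openin (top_of_set E) S" "u \<in> S"
    and E': "subspace E'" "f ` S \<subseteq> E'" and v: "v \<in> E"
  shows "f' v \<in> E'"
proof -
  obtain P where P: "linear P" "\<And>x. P x \<in> E'" "\<And>x. x \<in> E' \<Longrightarrow> P x = x"
    using subspace_projection_exists[OF E'(1)] by blast
  have b: "bounded_linear P" using P(1) linear_conv_bounded_linear by blast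
  have "((\<lambda>x. P (f x)) has_derivative (\<lambda>v. P (f' v))) (at u within S)"
    by (rule bounded_linear.has_derivative[OF b f])
  then have "P (f' v) = f' v"
    by (rule has_derivative_unique_along[OF _ f E S S v]) (use P(3) E'(2) in auto)
  then show ?thesis using P(2) by metis
qed

text \<open>A lift of the identity that fixes \<open>u\<close> agrees at each point with some group element. Along any
  line through \<open>u\<close> one group element occurs arbitrarily close to \<open>u\<close>, so it fixes \<open>u\<close> and has the
  same derivative in the direction of the line. The directions belonging to a given group element
  form a subspace, and finitely many proper subspaces cannot exhaust the tangent space.\<close>

lemma identity_lift_derivative:
  fixes E :: "'e::euclidean_space set"
  assumes c: "orbifold_chart E X c" and E: "subspace E" and u: "u \<in> N"
    and N: "openin (top_of_set E) N" "N \<subseteq> Dom c"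
    and \<psi>: "\<And>x. x \<in> N \<Longrightarrow> \<psi> x \<in> Dom c \<and> Proj c (\<psi> x) = Proj c x" "\<psi> u = u"
    and der: "(\<psi> has_derivative \<psi>') (at u within N)"
  shows "\<exists>\<gamma>\<in>Grp c. \<gamma> u = u \<and> (\<forall>v\<in>E. \<psi>' v = tderiv \<gamma> (Dom c) u v)"
proof -
  have uD: "u \<in> Dom c" using u N by auto
  have one: "\<exists>\<gamma>\<in>Grp c. \<gamma> u = u \<and> \<psi>' v = tderiv \<gamma> (Dom c) u v" if v: "v \<in> E" for v
  proof -
    have uE: "u \<in> E" using u N(1) openin_imp_subset by blast
    have "openin (top_of_set UNIV) (UNIV \<inter> (\<lambda>t::real. u + t *\<^sub>R v) -` N)"
      by (rule continuous_openin_preimage[OF _ _ N(1)])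
         (auto intro!: continuous_intros subspace_add[OF E] subspace_scale[OF E] uE v)
    then have T: "open {t::real. u + t *\<^sub>R v \<in> N}" by (simp add: vimage_def)
    have evN: "\<forall>\<^sub>F t in at (0::real). u + t *\<^sub>R v \<in> N"
      using eventually_at_in_open[OF T, of 0] u by (auto elim: eventually_mono)
    then have "\<forall>\<^sub>F t in at (0::real). \<exists>\<gamma>\<in>Grp c. \<psi> (u + t *\<^sub>R v) = \<gamma> (u + t *\<^sub>R v)"
    proof eventually_elim
      case (elim t)
      then have "\<psi> (u + t *\<^sub>R v) \<in> Dom c" "u + t *\<^sub>R v \<in> Dom c"
        "Proj c (u + t *\<^sub>R v) = Proj c (\<psi> (u + t *\<^sub>R v))"
        using \<psi>(1)[OF elim] N(2) by auto
      then show ?case using chart_Proj_eq_iff[OF c] by blast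
    qed
    then have "\<exists>\<^sub>F t in at (0::real). \<exists>\<gamma>\<in>Grp c. \<psi> (u + t *\<^sub>R v) = \<gamma> (u + t *\<^sub>R v)"
      by (intro eventually_frequently) auto
    then obtain \<gamma> where g: "\<gamma> \<in> Grp c" and fr: "\<exists>\<^sub>F t in at (0::real). \<psi> (u + t *\<^sub>R v) = \<gamma> (u + t *\<^sub>R v)"
      unfolding frequently_bex_finite_distrib[OF chart_Grp(1)[OF c]] by blast
    define h where "h = (\<lambda>t. \<psi> (u + t *\<^sub>R v) - \<gamma> (u + t *\<^sub>R v))"
    define w where "w = \<psi>' v - tderiv \<gamma> (Dom c) u v"
    have fr: "\<exists>\<^sub>F t in at 0. h t = 0" using fr by (simp add: h_def)
    have "((\<lambda>t. \<psi> (u + t *\<^sub>R v)) has_vector_derivative \<psi>' v) (at 0)"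
      by (rule has_vector_derivative_along[OF der E N(1) u v])
    moreover have "((\<lambda>t. \<gamma> (u + t *\<^sub>R v)) has_vector_derivative tderiv \<gamma> (Dom c) u v) (at 0)"
      by (rule has_vector_derivative_along[OF smooth_on_differentiable[OF chart_Grp(3)[OF c g] uD] E chart_Dom(1)[OF c] uD v])
    ultimately have hd: "(h has_vector_derivative w) (at 0)"
      unfolding h_def w_def by (rule has_vector_derivative_diff)
    have "(h \<longlongrightarrow> h 0) (at 0)"
      using has_vector_derivative_continuous[OF hd] by (simp add: isCont_def)
    have h0: "h 0 = 0"
    proof (rule ccontr)
      assume "h 0 \<noteq> 0"
      then have "\<forall>\<^sub>F t in at 0. h t \<noteq> 0"
        using \<open>(h \<longlongrightarrow> h 0) (at 0)\<close> tendsto_imp_eventually_ne by blast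
      then show False using fr by (simp add: frequently_def)
    qed
    have "w = 0"
    proof (rule ccontr)
      assume w: "w \<noteq> 0"
      have "\<forall>e>0. \<exists>d>0. \<forall>y. norm (y - 0) < d \<longrightarrow> norm (h y - h 0 - (y - 0) *\<^sub>R w) \<le> e * norm (y - 0)"
        using hd unfolding has_vector_derivative_def has_derivative_at_alt by blast
      moreover have "norm w / 2 > 0" using w by simp
      ultimately obtain d where d: "d > 0"
        "\<And>t. norm (t - 0) < d \<Longrightarrow> norm (h t - h 0 - (t - 0) *\<^sub>R w) \<le> norm w / 2 * norm (t - 0)" by metis
      have "\<forall>\<^sub>F t in at 0. t \<noteq> 0 \<and> norm t < d"
        unfolding eventually_at using d(1) by (auto simp: dist_norm intro!: exI[of _ d])
      from frequently_eventually_frequently[OF fr this]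
      have "\<exists>\<^sub>F t in at 0. h t = 0 \<and> t \<noteq> 0 \<and> norm t < d" .
      then obtain t where t: "h t = 0" "t \<noteq> 0" "norm t < d" using frequently_ex by blast
      then have "\<bar>t\<bar> * norm w \<le> norm w / 2 * \<bar>t\<bar>" using d(2)[of t] h0 by simp
      then show False using t w by (simp add: field_simps)
    qed
    moreover have "\<gamma> u = u" using h0 \<psi>(2) by (simp add: h_def)
    ultimately show ?thesis using g by (auto simp: w_def)
  qed
  define S where "S = (\<lambda>\<gamma>. {v \<in> E. \<psi>' v = tderiv \<gamma> (Dom c) u v})"
  define F where "F = S ` {\<gamma> \<in> Grp c. \<gamma> u = u}"
  have "\<exists>T\<in>F. E \<subseteq> T"
  proof (rule subspace_subset_finite_Union[OF _ E])
    show "finite F" using chart_Grp(1)[OF c] by (simp add: F_def)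
    show "E \<subseteq> \<Union>F" using one unfolding F_def S_def by blast
    fix T assume "T \<in> F"
    then obtain \<gamma> where g: "\<gamma> \<in> Grp c" "T = S \<gamma>" by (auto simp: F_def)
    have "linear \<psi>'" "linear (tderiv \<gamma> (Dom c) u)"
      using der has_derivative_linear tderiv_linear[OF chart_Grp(3)[OF c g(1)] uD] by auto
    then show "subspace T"
      using E unfolding g(2) S_def subspace_def by (auto simp: linear_0 linear_add linear_cmul)
  qed
  then show ?thesis unfolding F_def S_def by blast
qed

text \<open>In a centered chart this is the fixed tangent space at the centre, but it makes sense at every
  point of every chart.\<close>

definition isotropy_fixed_space :: "'e::euclidean_space set \<Rightarrow> ('e, 'a) orb_chart \<Rightarrow> 'e \<Rightarrow> 'e set" where
  "isotropy_fixed_space E c u =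
     {v \<in> E. \<forall>\<gamma>\<in>Grp c. \<gamma> u = u \<longrightarrow> tderiv \<gamma> (Dom c) u v = v}"

context
  fixes E :: "'e::euclidean_space set" and X :: "'a topology" and A :: "('e, 'a) orb_chart set"
  assumes orb: "orbifold E X A"
begin

text \<open>Conjugating a group element of the second chart by a transition map gives a lift of the
  identity to the first chart, whose derivative fixes the isotropy-fixed vectors. Hence the
  derivative of the transition map carries fixed vectors to fixed vectors.\<close>

lemma dim_isotropy_fixed_space_le:
  assumes cA: "c \<in> A" "b \<in> A" and u: "u \<in> Dom c" "v \<in> Dom b" "Proj c u = Proj b v"
  shows "dim (isotropy_fixed_space E c u) \<le> dim (isotropy_fixed_space E b v)"
proof -
  note E = orbifold_subspace[OF orb]
  note c = atlas_chart[OF orb cA(1)] and b = atlas_chart[OF orb cA(2)]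
  obtain N \<nu> where N: "openin (top_of_set E) N" "u \<in> N" "N \<subseteq> Dom c" "smooth_embedding \<nu> N (Dom b)"
    "\<nu> u = v" "\<forall>x\<in>N. Proj b (\<nu> x) = Proj c x"
    by (rule atlas_transition[OF orb cA u]) (erule that; assumption)
  define m where "m = the_inv_into N \<nu>"
  have \<nu>: "smooth_on \<nu> N" "\<nu> ` N \<subseteq> Dom b" "inj_on \<nu> N" "smooth_on m (\<nu> ` N)"
    using N(4) unfolding smooth_embedding_iff m_def by auto
  have m: "m (\<nu> x) = x" if "x \<in> N" for x
    unfolding m_def using \<nu>(3) that by (rule the_inv_into_f_f)
  let ?d\<nu> = "tderiv \<nu> N u"
  have oN: "openin (top_of_set E) (\<nu> ` N)"
    by (rule smooth_embedding_open[OF N(4) E N(1) chart_Dom(3)[OF b] N(1) order_refl])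
  have lin: "linear ?d\<nu>" by (rule tderiv_linear[OF \<nu>(1) N(2)])
  have inE: "?d\<nu> w \<in> E" if "w \<in> E" for w
    by (rule derivative_in_subspace[OF smooth_on_differentiable[OF \<nu>(1) N(2)] E N(1,2) E _ that])
       (use \<nu>(2) chart_Dom(3)[OF b] in blast)
  have left: "tderiv m (\<nu> ` N) (\<nu> u) (?d\<nu> w) = w" if "w \<in> E" for w
    by (rule has_derivative_unique_along[OF tderiv_chain[OF \<nu>(1,4) order_refl N(2)] has_derivative_ident E N(1,2) N(1,2) that])
       (use m in auto)
  have fixed: "?d\<nu> w \<in> isotropy_fixed_space E b v" if w: "w \<in> isotropy_fixed_space E c u" for w
    unfolding isotropy_fixed_space_def
  proof (intro CollectI conjI ballI impI)
    have wE: "w \<in> E" using w by (simp add: isotropy_fixed_space_def)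
    show "?d\<nu> w \<in> E" by (rule inE[OF wE])
    fix \<delta> assume d: "\<delta> \<in> Grp b" "\<delta> v = v"
    define \<psi> where "\<psi> = (\<lambda>x. m (\<delta> (\<nu> x)))"
    define N1 where "N1 = N \<inter> (\<lambda>x. \<delta> (\<nu> x)) -` (\<nu> ` N)"
    have s1: "smooth_on (\<lambda>x. \<delta> (\<nu> x)) N"
      by (rule smooth_on_compose[OF \<nu>(1) chart_Grp(3)[OF b d(1)] \<nu>(2)])
    have "openin (top_of_set N) N1"
      unfolding N1_def
      by (rule continuous_openin_preimage[OF smooth_on_continuous[OF s1] _ oN])
         (use chart_in[OF b d(1)] chart_Dom(3)[OF b] \<nu>(2) in blast)
    then have oN1: "openin (top_of_set E) N1" using N(1) openin_trans by blast
    have N1N: "N1 \<subseteq> N" by (auto simp: N1_def)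
    have uN1: "u \<in> N1" using N(2,5) d(2) by (auto simp: N1_def)
    have \<psi>u: "\<psi> u = u" unfolding \<psi>_def using N(5) d(2) m[OF N(2)] by simp
    have sub: "(\<lambda>x. \<delta> (\<nu> x)) ` N1 \<subseteq> \<nu> ` N" by (auto simp: N1_def)
    have s2: "smooth_on \<psi> N1" unfolding \<psi>_def
      by (rule smooth_on_compose[OF smooth_on_subset[OF s1 N1N] \<nu>(4) sub])
    have \<psi>N: "\<psi> x \<in> N" "\<nu> (\<psi> x) = \<delta> (\<nu> x)" if x: "x \<in> N1" for x
    proof -
      obtain y where "y \<in> N" "\<delta> (\<nu> x) = \<nu> y" using x by (auto simp: N1_def)
      then show "\<psi> x \<in> N" "\<nu> (\<psi> x) = \<delta> (\<nu> x)" using m by (auto simp: \<psi>_def)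
    qed
    have "\<exists>\<gamma>\<in>Grp c. \<gamma> u = u \<and> (\<forall>x\<in>E. tderiv \<psi> N1 u x = tderiv \<gamma> (Dom c) u x)"
    proof (rule identity_lift_derivative[OF c E uN1 oN1 _ _ \<psi>u smooth_on_differentiable[OF s2 uN1]])
      show "N1 \<subseteq> Dom c" using N1N N(3) by blast
      fix x assume x: "x \<in> N1"
      then have xN: "x \<in> N" using N1N by blast
      have "Proj c (\<psi> x) = Proj b (\<delta> (\<nu> x))" using N(6) \<psi>N[OF x] by metis
      also have "\<dots> = Proj b (\<nu> x)" using chart_invariant[OF b d(1)] \<nu>(2) xN by blast
      also have "\<dots> = Proj c x" using N(6) xN by blast
      finally show "\<psi> x \<in> Dom c \<and> Proj c (\<psi> x) = Proj c x" using \<psi>N(1)[OF x] N(3) by blast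
    qed
    then have dw: "tderiv \<psi> N1 u w = w" using w wE by (auto simp: isotropy_fixed_space_def)
    have "?d\<nu> (tderiv \<psi> N1 u w) = tderiv \<delta> (Dom b) (\<nu> u) (?d\<nu> w)"
    proof (rule has_derivative_unique_along[OF _ tderiv_chain[OF \<nu>(1) chart_Grp(3)[OF b d(1)] \<nu>(2) N(2)] E oN1 uN1 N(1,2) wE])
      show "((\<lambda>x. \<nu> (\<psi> x)) has_derivative (\<lambda>x. ?d\<nu> (tderiv \<psi> N1 u x))) (at u within N1)"
        using tderiv_chain[OF s2 \<nu>(1) _ uN1] \<psi>N(1) unfolding \<psi>u by blast
    qed (use \<psi>N(2) in auto)
    then show "tderiv \<delta> (Dom b) v (?d\<nu> w) = ?d\<nu> w" using dw N(5) by simp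
  qed
  have sub: "subspace (isotropy_fixed_space E c u)"
    using E tderiv_linear[OF chart_Grp(3)[OF c] u(1)] unfolding isotropy_fixed_space_def subspace_def
    by (auto simp: linear_0 linear_add linear_cmul)
  have "inj_on ?d\<nu> (isotropy_fixed_space E c u)"
    by (rule inj_on_inverseI[of _ "tderiv m (\<nu> ` N) (\<nu> u)"]) (use left in \<open>auto simp: isotropy_fixed_space_def\<close>)
  then have "inj_on ?d\<nu> (span (isotropy_fixed_space E c u))"
    using sub span_eq_iff by metis
  then have "dim (?d\<nu> ` isotropy_fixed_space E c u) = dim (isotropy_fixed_space E c u)"
    by (rule dim_image_eq[OF lin])
  moreover have "dim (?d\<nu> ` isotropy_fixed_space E c u) \<le> dim (isotropy_fixed_space E b v)"
    by (rule dim_subset) (use fixed in blast)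
  ultimately show ?thesis by simp
qed

lemma centered_fixes:
  assumes c: "orbifold_chart E X c" and "centered_at c x" "u \<in> Dom c" "Proj c u = x" "\<gamma> \<in> Grp c"
  shows "\<gamma> u = u"
proof -
  obtain z where z: "z \<in> Dom c" "Proj c z = x" "chart_group c \<cong> isotropy_group c z"
    using assms(2) unfolding centered_at_def by blast
  have car: "carrier (chart_group c) = Grp c" "carrier (isotropy_group c z) = {\<gamma> \<in> Grp c. \<gamma> z = z}"
    by (auto simp: chart_group_def isotropy_group_def stabilizer_def)
  have "card (Grp c) = card {\<gamma> \<in> Grp c. \<gamma> z = z}"
    using iso_same_card[OF z(3)] unfolding car .
  then have "{\<gamma> \<in> Grp c. \<gamma> z = z} = Grp c"
    using chart_Grp(1)[OF c] by (intro card_subset_eq) auto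
  then have fz: "\<delta> z = z" if "\<delta> \<in> Grp c" for \<delta> using that by blast
  obtain \<delta> where "\<delta> \<in> Grp c" "u = \<delta> z"
    using chart_Proj_eq_iff[OF c z(1) assms(3)] z assms(4) by auto
  then have "u = z" using fz by simp
  then show ?thesis using fz[OF assms(5)] by simp
qed

lemma centered_atI:
  assumes "u \<in> Dom c" "\<And>\<gamma>. \<gamma> \<in> Grp c \<Longrightarrow> \<gamma> u = u"
  shows "centered_at c (Proj c u)"
proof -
  have "isotropy_group c u = chart_group c"
  proof -
    have "{\<gamma> \<in> Grp c. \<gamma> u = u} = Grp c" using assms(2) by blast
    then show ?thesis by (simp add: isotropy_group_def stabilizer_def chart_group_def)
  qed
  then show ?thesis unfolding centered_at_def using assms(1) iso_refl by metis
qed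

text \<open>Restricting \<open>c\<close> to a small neighbourhood of \<open>u\<close> gives a centered chart, and the previous
  inequality in both directions shows that all charts give the same dimension.\<close>

lemma sdim_eq_dim_isotropy_fixed_space:
  assumes cA: "c \<in> A" and u: "u \<in> Dom c"
  shows "sdim E A (Proj c u) = dim (isotropy_fixed_space E c u)"
  unfolding sdim_def
proof (rule the_equality)
  note c = atlas_chart[OF orb cA]
  have fts: "fixed_tangent_space E b v = isotropy_fixed_space E b v"
    if "\<And>\<gamma>. \<gamma> \<in> Grp b \<Longrightarrow> \<gamma> v = v" for b :: "('e, 'a) orb_chart" and v
    using that by (auto simp: fixed_tangent_space_def isotropy_fixed_space_def)
  have dim_eq: "dim (isotropy_fixed_space E b v) = dim (isotropy_fixed_space E c u)"
    if "b \<in> A" "v \<in> Dom b" "Proj b v = Proj c u" for b v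
    using dim_isotropy_fixed_space_le[OF cA that(1) u that(2)] dim_isotropy_fixed_space_le[OF that(1) cA that(2) u] that(3)
    by simp
  have "openin (top_of_set E) (Dom c)" using chart_Dom[OF c] by blast
  then obtain b where b: "b \<in> A" "u \<in> Dom b" "Dom b \<subseteq> Dom c" "Dom b \<subseteq> Dom c" "Proj b = Proj c"
    "Grp b = (\<lambda>\<gamma>. restrict \<gamma> (Dom b)) ` {\<gamma> \<in> Grp c. \<gamma> u = u}"
    using atlas_restrict[OF orb cA u _ u] by blast
  have fixb: "\<gamma> u = u" if "\<gamma> \<in> Grp b" for \<gamma> using that b(2) unfolding b(6) by auto
  show "\<exists>c'\<in>A. centered_at c' (Proj c u) \<and> (\<exists>w\<in>Dom c'. Proj c' w = Proj c u \<and>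
      dim (isotropy_fixed_space E c u) = dim (fixed_tangent_space E c' w))"
  proof (intro bexI[of _ b] conjI bexI[of _ u])
    have "centered_at b (Proj b u)" by (rule centered_atI[OF b(2)]) (rule fixb)
    then show "centered_at b (Proj c u)" by (simp add: b(5))
    have "fixed_tangent_space E b u = isotropy_fixed_space E b u" by (rule fts) (rule fixb)
    then show "dim (isotropy_fixed_space E c u) = dim (fixed_tangent_space E b u)"
      using dim_eq[OF b(1,2)] b(5) by simp
  qed (use b in auto)
  fix k assume "\<exists>c'\<in>A. centered_at c' (Proj c u) \<and> (\<exists>w\<in>Dom c'. Proj c' w = Proj c u \<and>
      k = dim (fixed_tangent_space E c' w))"
  then obtain c' w where c': "c' \<in> A" "centered_at c' (Proj c u)" "w \<in> Dom c'" "Proj c' w = Proj c u"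
      "k = dim (fixed_tangent_space E c' w)" by blast
  have "\<gamma> w = w" if "\<gamma> \<in> Grp c'" for \<gamma>
    by (rule centered_fixes[OF atlas_chart[OF orb c'(1)] c'(2,3,4) that])
  then show "k = dim (isotropy_fixed_space E c u)" using fts c'(5) dim_eq[OF c'(1,3,4)] by simp
qed

end

section \<open>Linear charts\<close>

text \<open>The set \<open>\<L>\<close> is kept as a separate argument, because the chart determines its linear maps only on
  the model space \<open>E\<close>.\<close>

definition linear_chart :: "'e::euclidean_space set \<Rightarrow> ('e, 'a) orb_chart \<Rightarrow> ('e \<Rightarrow> 'e) set \<Rightarrow> bool" where
  "linear_chart E c \<L> \<longleftrightarrow> convex (Dom c) \<and> 0 \<in> Dom c \<and> finite \<L> \<and> (\<forall>L\<in>\<L>. linear L \<and> L ` E \<subseteq> E) \<and>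
     Grp c = (\<lambda>L. restrict L (Dom c)) ` \<L>"

definition fixed_subspace :: "'e::euclidean_space set \<Rightarrow> ('e \<Rightarrow> 'e) set \<Rightarrow> 'e set" where
  "fixed_subspace E \<L> = {v \<in> E. \<forall>L\<in>\<L>. L v = v}"

lemma subspace_fixed_subspace:
  "subspace E \<Longrightarrow> (\<And>L. L \<in> \<L> \<Longrightarrow> linear L) \<Longrightarrow> subspace (fixed_subspace E \<L>)"
  unfolding fixed_subspace_def subspace_def by (auto simp: linear_0 linear_add linear_cmul)

context
  fixes E :: "'e::euclidean_space set" and X :: "'a topology" and A :: "('e, 'a) orb_chart set"
  assumes orb: "orbifold E X A"
begin

lemma linear_chart_sdim:
  assumes cA: "c \<in> A" and lc: "linear_chart E c \<L>" and u: "u \<in> Dom c"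
  shows "sdim E A (Proj c u) = dim (fixed_subspace E {L \<in> \<L>. L u = u})"
proof -
  note c = atlas_chart[OF orb cA] and E = orbifold_subspace[OF orb]
  have d: "tderiv (restrict L (Dom c)) (Dom c) u v = L v" if L: "L \<in> \<L>" and v: "v \<in> E" for L v
  proof (rule has_derivative_unique_along[OF _ _ E chart_Dom(1)[OF c] u chart_Dom(1)[OF c] u v])
    have "restrict L (Dom c) \<in> Grp c" using lc L by (auto simp: linear_chart_def)
    then show "(restrict L (Dom c) has_derivative tderiv (restrict L (Dom c)) (Dom c) u) (at u within Dom c)"
      using smooth_on_differentiable[OF chart_Grp(3)[OF c]] u by blast
    have "bounded_linear L" using lc L linear_conv_bounded_linear unfolding linear_chart_def by blast
    then show "(L has_derivative L) (at u within Dom c)" by (rule bounded_linear_imp_has_derivative)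
  qed auto
  have "isotropy_fixed_space E c u = fixed_subspace E {L \<in> \<L>. L u = u}"
  proof -
    have G: "Grp c = (\<lambda>L. restrict L (Dom c)) ` \<L>" using lc by (simp add: linear_chart_def)
    show ?thesis
      unfolding isotropy_fixed_space_def fixed_subspace_def G using u d by auto
  qed
  then show ?thesis using sdim_eq_dim_isotropy_fixed_space[OF orb cA u] by simp
qed

text \<open>The stabilizer of any point fixes at least the vectors fixed by the whole group. Equality of the
  dimensions forces equality of the two fixed subspaces, and \<open>u\<close> is fixed by its own stabilizer.\<close>

lemma linear_chart_stratum_iff:
  assumes cA: "c \<in> A" and lc: "linear_chart E c \<L>" and u: "u \<in> Dom c"
  shows "sdim E A (Proj c u) = sdim E A (Proj c 0) \<longleftrightarrow> u \<in> fixed_subspace E \<L>"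
proof -
  note c = atlas_chart[OF orb cA] and E = orbifold_subspace[OF orb]
  have lin: "linear L" if "L \<in> \<L>" for L using lc that by (auto simp: linear_chart_def)
  have z: "0 \<in> Dom c" using lc by (simp add: linear_chart_def)
  have "{L \<in> \<L>. L 0 = 0} = \<L>" using lin linear_0 by auto
  then have s0: "sdim E A (Proj c 0) = dim (fixed_subspace E \<L>)"
    using linear_chart_sdim[OF cA lc z] by simp
  have su: "sdim E A (Proj c u) = dim (fixed_subspace E {L \<in> \<L>. L u = u})"
    by (rule linear_chart_sdim[OF cA lc u])
  have uE: "u \<in> E" using u chart_Dom(3)[OF c] by blast
  show ?thesis
  proof
    assume eq: "sdim E A (Proj c u) = sdim E A (Proj c 0)"
    have "fixed_subspace E \<L> = fixed_subspace E {L \<in> \<L>. L u = u}"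
    proof (rule subspace_dim_equal)
      show "subspace (fixed_subspace E \<L>)" by (rule subspace_fixed_subspace[OF E lin])
      show "subspace (fixed_subspace E {L \<in> \<L>. L u = u})" by (rule subspace_fixed_subspace[OF E]) (use lin in auto)
    qed (use eq s0 su in \<open>auto simp: fixed_subspace_def\<close>)
    moreover have "u \<in> fixed_subspace E {L \<in> \<L>. L u = u}" using uE by (simp add: fixed_subspace_def)
    ultimately show "u \<in> fixed_subspace E \<L>" by simp
  next
    assume "u \<in> fixed_subspace E \<L>"
    then have "{L \<in> \<L>. L u = u} = \<L>" by (auto simp: fixed_subspace_def)
    then show "sdim E A (Proj c u) = sdim E A (Proj c 0)" using s0 su by simp
  qed
qed

end

lemma chart_right_translation:
  assumes c: "orbifold_chart E X c" and d: "\<delta> \<in> Grp c"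
  shows "bij_betw (\<lambda>\<gamma>. compose (Dom c) \<gamma> \<delta>) (Grp c) (Grp c)"
proof -
  let ?\<kappa> = "\<lambda>\<gamma>. compose (Dom c) \<gamma> \<delta>"
  obtain \<epsilon> where e: "\<epsilon> \<in> Grp c" "\<And>u. u \<in> Dom c \<Longrightarrow> \<epsilon> (\<delta> u) = u" "\<And>u. u \<in> Dom c \<Longrightarrow> \<delta> (\<epsilon> u) = u"
    by (rule chart_inverse[OF c d]) (erule that; blast)
  have "inj_on ?\<kappa> (Grp c)"
  proof (rule inj_onI)
    fix \<gamma> \<gamma>' assume g: "\<gamma> \<in> Grp c" "\<gamma>' \<in> Grp c" "?\<kappa> \<gamma> = ?\<kappa> \<gamma>'"
    show "\<gamma> = \<gamma>'"
    proof (rule extensionalityI[OF chart_extensional[OF c g(1)] chart_extensional[OF c g(2)]])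
      fix w assume w: "w \<in> Dom c"
      have "?\<kappa> \<gamma> (\<epsilon> w) = ?\<kappa> \<gamma>' (\<epsilon> w)" using g(3) by simp
      then show "\<gamma> w = \<gamma>' w" using chart_in[OF c e(1) w] e(3)[OF w] by (simp add: compose_def)
    qed
  qed
  moreover have "?\<kappa> ` Grp c \<subseteq> Grp c"
    using chart_Grp(2)[OF c] d unfolding subgroup_BijGroup_iff by blast
  ultimately show ?thesis
    using endo_inj_surj[OF chart_Grp(1)[OF c]] by (auto simp: bij_betw_def)
qed

text \<open>Linearization: averaging the displacement \<open>\<gamma> s - u\<close> over the isotropy group, after undoing
  the derivative of \<open>\<gamma>\<close>, gives an equivariant map from the chart to its tangent space whose
  derivative at the centre is the identity. Restricting its local inverse to a small convex
  invariant neighbourhood of the origin pulls the chart back to a linear one.\<close>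

lemma linear_chart_exists:
  fixes E :: "'e::euclidean_space set" and X :: "'a topology" and A :: "('e, 'a) orb_chart set"
  assumes orb: "orbifold E X A" and x: "x \<in> topspace X" and Q: "openin X Q" "x \<in> Q"
  obtains c \<L> where "c \<in> A" "linear_chart E c \<L>" "Proj c 0 = x" "chart_image c \<subseteq> Q"
proof -
  note E = orbifold_subspace[OF orb]
  obtain c0 u where c0: "c0 \<in> A" "u \<in> Dom c0" "Proj c0 u = x"
    by (rule atlas_lift[OF orb x]) (erule that; assumption)
  note c0c = atlas_chart[OF orb c0(1)]
  define N0 where "N0 = {w \<in> Dom c0. Proj c0 w \<in> Q}"
  have "openin (top_of_set (Dom c0)) N0"
    using chart_Proj(1)[OF c0c] Q(1) unfolding continuous_map_def N0_def by auto
  then have N0: "openin (top_of_set E) N0" "u \<in> N0"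
    using chart_Dom(1)[OF c0c] openin_trans c0 Q(2) by (auto simp: N0_def)
  obtain b where b: "b \<in> A" "u \<in> Dom b" "Dom b \<subseteq> N0" "Dom b \<subseteq> Dom c0" "Proj b = Proj c0"
    "Grp b = (\<lambda>\<gamma>. restrict \<gamma> (Dom b)) ` {\<gamma> \<in> Grp c0. \<gamma> u = u}"
    by (rule atlas_restrict[OF orb c0(1,2) N0]) (erule that; assumption)
  note bc = atlas_chart[OF orb b(1)]
  define D where "D = Dom b"
  define G where "G = Grp b"
  have oD: "openin (top_of_set E) D" and DE: "D \<subseteq> E" and uD: "u \<in> D"
    using chart_Dom[OF bc] b(2) by (auto simp: D_def)
  have finG: "finite G" and smG: "\<And>\<gamma>. \<gamma> \<in> G \<Longrightarrow> smooth_on \<gamma> D"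
    and inD: "\<And>\<gamma> w. \<gamma> \<in> G \<Longrightarrow> w \<in> D \<Longrightarrow> \<gamma> w \<in> D"
    using chart_Grp[OF bc] chart_in[OF bc] by (auto simp: D_def G_def)
  have fixG: "\<gamma> u = u" if "\<gamma> \<in> G" for \<gamma> using that b(2) unfolding G_def b(6) by auto
  have G: "(\<lambda>x\<in>D. x) \<in> G" "\<And>\<gamma> \<delta>. \<gamma> \<in> G \<Longrightarrow> \<delta> \<in> G \<Longrightarrow> compose D \<gamma> \<delta> \<in> G"
    using chart_Grp(2)[OF bc] unfolding subgroup_BijGroup_iff D_def G_def by auto
  have "\<exists>\<delta>. \<delta> \<in> G \<and> (\<forall>w\<in>D. \<delta> (\<gamma> w) = w) \<and> (\<forall>w\<in>D. \<gamma> (\<delta> w) = w)" if g: "\<gamma> \<in> G" for \<gamma>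
    by (rule chart_inverse[OF bc g[unfolded G_def]]) (auto simp: G_def D_def)
  then obtain j where j: "\<And>\<gamma>. \<gamma> \<in> G \<Longrightarrow> j \<gamma> \<in> G" "\<And>\<gamma> w. \<gamma> \<in> G \<Longrightarrow> w \<in> D \<Longrightarrow> j \<gamma> (\<gamma> w) = w"
    "\<And>\<gamma> w. \<gamma> \<in> G \<Longrightarrow> w \<in> D \<Longrightarrow> \<gamma> (j \<gamma> w) = w" by metis
  obtain P where P: "linear P" "\<And>x. P x \<in> E" "\<And>x. x \<in> E \<Longrightarrow> P x = x"
    using subspace_projection_exists[OF E] by blast
  define d where "d = (\<lambda>\<gamma>::'e \<Rightarrow> 'e. tderiv \<gamma> D u)"
  define L where "L = (\<lambda>\<gamma> x. d \<gamma> (P x))"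
  have der: "(\<gamma> has_derivative d \<gamma>) (at u within D)" if "\<gamma> \<in> G" for \<gamma>
    unfolding d_def by (rule smooth_on_differentiable[OF smG[OF that] uD])
  have lind: "linear (d \<gamma>)" if "\<gamma> \<in> G" for \<gamma> using has_derivative_linear[OF der[OF that]] .
  have linL: "linear (L \<gamma>)" if "\<gamma> \<in> G" for \<gamma>
    unfolding L_def using linear_compose[OF P(1) lind[OF that]] by (simp add: o_def)
  have dE: "d \<gamma> v \<in> E" if "\<gamma> \<in> G" "v \<in> E" for \<gamma> v
    by (rule derivative_in_subspace[OF der[OF that(1)] E oD uD E _ that(2)]) (use inD that DE in blast)
  have LE: "L \<gamma> v \<in> E" if "\<gamma> \<in> G" for \<gamma> v unfolding L_def by (rule dE[OF that P(2)])
  have Ld: "L \<gamma> v = d \<gamma> v" if "v \<in> E" for \<gamma> v using P(3)[OF that] by (simp add: L_def)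
  have dcomp: "d \<epsilon> v = d \<gamma> (d \<delta> v)"
    if "\<gamma> \<in> G" "\<delta> \<in> G" "\<epsilon> \<in> G" "\<And>w. w \<in> D \<Longrightarrow> \<epsilon> w = \<gamma> (\<delta> w)" "v \<in> E" for \<gamma> \<delta> \<epsilon> v
  proof (rule has_derivative_unique_along[OF der[OF that(3)] _ E oD uD oD uD that(5)])
    have "\<delta> ` D \<subseteq> D" using inD that(2) by blast
    from tderiv_chain[OF smG[OF that(2)] smG[OF that(1)] this uD]
    show "((\<lambda>w. \<gamma> (\<delta> w)) has_derivative (\<lambda>v. d \<gamma> (d \<delta> v))) (at u within D)"
      unfolding d_def fixG[OF that(2)] .
  qed (use that(4) in auto)
  have did: "d \<gamma> (d \<delta> v) = v" if "\<gamma> \<in> G" "\<delta> \<in> G" "\<And>w. w \<in> D \<Longrightarrow> \<gamma> (\<delta> w) = w" "v \<in> E" for \<gamma> \<delta> v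
  proof -
    have "d (\<lambda>x\<in>D. x) v = v"
      by (rule has_derivative_unique_along[OF der[OF G(1)] has_derivative_ident E oD uD oD uD that(4)]) auto
    moreover have "d (\<lambda>x\<in>D. x) v = d \<gamma> (d \<delta> v)"
      by (rule dcomp[OF that(1,2) G(1) _ that(4)]) (use that(3) in auto)
    ultimately show ?thesis by simp
  qed
  have Lid: "L (\<lambda>x\<in>D. x) v = v" if "v \<in> E" for v
    unfolding Ld[OF that]
    by (rule has_derivative_unique_along[OF der[OF G(1)] has_derivative_ident E oD uD oD uD that]) auto
  have Lcomp: "L (compose D \<gamma> \<delta>) v = L \<gamma> (L \<delta> v)" if "\<gamma> \<in> G" "\<delta> \<in> G" "v \<in> E" for \<gamma> \<delta> v
    using dcomp[OF that(1,2) G(2)[OF that(1,2)] _ that(3)] Ld that dE by (simp add: compose_def)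
  define n where "n = card G"
  have n: "n > 0" using G(1) finG by (auto simp: n_def card_gt_0_iff)
  define h where "h = (\<lambda>s. (1 / real n) *\<^sub>R (\<Sum>\<gamma>\<in>G. L (j \<gamma>) (\<gamma> s - u)))"
  have hE: "h s \<in> E" for s
    unfolding h_def by (intro subspace_scale[OF E] subspace_sum[OF E] LE j)
  have hu: "h u = 0"
  proof -
    have "L (j \<gamma>) (\<gamma> u - u) = 0" if "\<gamma> \<in> G" for \<gamma>
      using fixG[OF that] linear_0[OF linL[OF j(1)[OF that]]] by simp
    then show ?thesis by (simp add: h_def)
  qed
  have heq: "h (\<delta> s) = L \<delta> (h s)" if dl: "\<delta> \<in> G" and s: "s \<in> D" for \<delta> s
  proof -
    define \<kappa> where "\<kappa> = (\<lambda>\<gamma>::'e \<Rightarrow> 'e. compose D \<gamma> \<delta>)"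
    have \<kappa>G: "\<kappa> \<gamma> \<in> G" if "\<gamma> \<in> G" for \<gamma> unfolding \<kappa>_def by (rule G(2)[OF that dl])
    have \<kappa>: "\<kappa> \<gamma> w = \<gamma> (\<delta> w)" if "w \<in> D" for \<gamma> w using that by (simp add: \<kappa>_def compose_def)
    have bij: "bij_betw \<kappa> G G"
      using chart_right_translation[OF bc] dl unfolding \<kappa>_def G_def D_def by blast
    have trm: "L (j \<gamma>) (\<gamma> (\<delta> s) - u) = L \<delta> (L (j (\<kappa> \<gamma>)) (\<kappa> \<gamma> s - u))" if g: "\<gamma> \<in> G" for \<gamma>
    proof -
      have v: "\<kappa> \<gamma> s - u \<in> E"
        using inD[OF \<kappa>G[OF g] s] DE uD by (intro subspace_diff[OF E]) auto
      have jg: "j \<gamma> w = \<delta> (j (\<kappa> \<gamma>) w)" if w: "w \<in> D" for w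
      proof -
        have w': "j (\<kappa> \<gamma>) w \<in> D" by (rule inD[OF j(1)[OF \<kappa>G[OF g]] w])
        have "\<gamma> (\<delta> (j (\<kappa> \<gamma>) w)) = w" using j(3)[OF \<kappa>G[OF g] w] \<kappa>[OF w'] by simp
        then have "j \<gamma> w = j \<gamma> (\<gamma> (\<delta> (j (\<kappa> \<gamma>) w)))" by simp
        also have "\<dots> = \<delta> (j (\<kappa> \<gamma>) w)" by (rule j(2)[OF g inD[OF dl w']])
        finally show ?thesis .
      qed
      have "d (j \<gamma>) (\<kappa> \<gamma> s - u) = d \<delta> (d (j (\<kappa> \<gamma>)) (\<kappa> \<gamma> s - u))"
        by (rule dcomp[OF dl j(1)[OF \<kappa>G[OF g]] j(1)[OF g] jg v])
      then show ?thesis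
        using Ld[OF v] Ld[OF dE[OF j(1)[OF \<kappa>G[OF g]] v]] \<kappa>[OF s] by simp
    qed
    have "h (\<delta> s) = (1 / real n) *\<^sub>R (\<Sum>\<gamma>\<in>G. L \<delta> (L (j (\<kappa> \<gamma>)) (\<kappa> \<gamma> s - u)))"
      unfolding h_def using trm by simp
    also have "(\<Sum>\<gamma>\<in>G. L \<delta> (L (j (\<kappa> \<gamma>)) (\<kappa> \<gamma> s - u))) = (\<Sum>\<gamma>\<in>G. L \<delta> (L (j \<gamma>) (\<gamma> s - u)))"
      by (rule sum.reindex_bij_betw[OF bij])
    also have "\<dots> = L \<delta> (\<Sum>\<gamma>\<in>G. L (j \<gamma>) (\<gamma> s - u))"
      by (rule linear_sum[OF linL[OF dl], symmetric])
    finally show ?thesis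
      unfolding h_def by (simp only: linear_cmul[OF linL[OF dl]])
  qed
  have hsm: "smooth_on h D"
    unfolding h_def
  proof (rule smooth_on_linear_compose[OF linear_scaleR], rule smooth_on_sum)
    fix \<gamma> assume g: "\<gamma> \<in> G"
    have "smooth_on (\<lambda>s. \<gamma> s + (- u)) D" by (rule smooth_on_add[OF smG[OF g] smooth_on_const])
    then show "smooth_on (\<lambda>s. L (j \<gamma>) (\<gamma> s - u)) D"
      using smooth_on_linear_compose[OF linL[OF j(1)[OF g]]] by fastforce
  qed
  define h' where "h' = (\<lambda>v. (1 / real n) *\<^sub>R (\<Sum>\<gamma>\<in>G. L (j \<gamma>) (d \<gamma> v)))"
  have hder: "(h has_derivative h') (at u within D)"
    unfolding h_def h'_def
  proof (rule has_derivative_scaleR_right, rule has_derivative_sum)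
    fix \<gamma> assume g: "\<gamma> \<in> G"
    have b: "bounded_linear (L (j \<gamma>))" using linL[OF j(1)[OF g]] linear_conv_bounded_linear by blast
    have "((\<lambda>s. \<gamma> s - u) has_derivative (\<lambda>v. d \<gamma> v - 0)) (at u within D)"
      by (rule has_derivative_diff[OF der[OF g] has_derivative_const])
    from bounded_linear.has_derivative[OF b this]
    show "((\<lambda>s. L (j \<gamma>) (\<gamma> s - u)) has_derivative (\<lambda>v. L (j \<gamma>) (d \<gamma> v))) (at u within D)" by simp
  qed
  have h'id: "h' v = v" if v: "v \<in> E" for v
  proof -
    have "L (j \<gamma>) (d \<gamma> v) = v" if g: "\<gamma> \<in> G" for \<gamma>
      unfolding Ld[OF dE[OF g v]] by (rule did[OF j(1)[OF g] g j(2)[OF g] v])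
    then have "h' v = (1 / real n) *\<^sub>R (\<Sum>\<gamma>\<in>G. v)" unfolding h'_def by simp
    then show ?thesis using n by (simp add: n_def sum_constant_scaleR)
  qed
  define U where "U = P -` D"
  \<comment> \<open>The extension of \<open>h\<close> by the identity along the kernel of \<open>P\<close>, to which the inverse
    function theorem on the full space applies.\<close>
  define hh where "hh = (\<lambda>x. h (P x) + (x - P x))"
  have U: "open U" unfolding U_def by (rule Cinf_on_projection(1)[OF P(1,2) oD hsm])
  have uU: "u \<in> U" using uD DE P(3) by (auto simp: U_def)
  have hhC: "Cinf_on hh U"
    unfolding hh_def
  proof (rule Cinf_on_add[OF U])
    show "Cinf_on (\<lambda>x. h (P x)) U" unfolding U_def by (rule Cinf_on_projection(2)[OF P(1,2) oD hsm])
    show "Cinf_on (\<lambda>x. x - P x) U"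
      by (rule Cinf_on_diff[OF U Cinf_on_linear[OF U linear_ident] Cinf_on_linear[OF U P(1)]])
  qed
  have hhder: "(hh has_derivative (\<lambda>v. v)) (at u)"
  proof -
    have "bounded_linear P" using P(1) linear_conv_bounded_linear by blast
    then have Pd: "(P has_derivative P) (at u within S)" for S by (rule bounded_linear_imp_has_derivative)
    have "P ` U \<subseteq> D" by (auto simp: U_def)
    then have "(h has_derivative h') (at (P u) within P ` U)"
      using has_derivative_subset[OF hder] P(3)[OF subsetD[OF DE uD]] by metis
    from has_derivative_in_compose[OF Pd this]
    have "((\<lambda>x. h (P x)) has_derivative (\<lambda>v. h' (P v))) (at u)"
      unfolding at_within_open[OF uU U] .
    from has_derivative_add[OF this has_derivative_diff[OF has_derivative_ident Pd]]
    show ?thesis unfolding hh_def using h'id[OF P(2)] by simp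
  qed
  obtain r where r: "r > 0" "ball u r \<subseteq> U" "inj_on hh (ball u r)" "open (hh ` ball u r)"
    "Cinf_on (the_inv_into (ball u r) hh) (hh ` ball u r)"
    by (rule local_smooth_inverse[OF U uU hhC hhder]) (erule that; assumption)
  define B where "B = ball u r"
  define m where "m = the_inv_into B hh"
  have hhE: "hh s = h s" if "s \<in> E" for s using P(3)[OF that] by (simp add: hh_def)
  have mC: "Cinf_on m (hh ` B)" "open (hh ` B)" using r unfolding m_def B_def by auto
  have mh: "m (h s) = s" if "s \<in> B" "s \<in> E" for s
    using r(3) that hhE unfolding m_def B_def by (metis the_inv_into_f_f)
  define N1 where "N1 = D \<inter> (\<Inter>\<gamma>\<in>G. D \<inter> \<gamma> -` (E \<inter> B))"
  have N1: "s \<in> N1 \<longleftrightarrow> s \<in> D \<and> (\<forall>\<gamma>\<in>G. \<gamma> s \<in> B)" for s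
    using inD DE unfolding N1_def by auto
  have "openin (top_of_set D) (D \<inter> \<gamma> -` (E \<inter> B))" if "\<gamma> \<in> G" for \<gamma>
  proof (rule continuous_openin_preimage[OF smooth_on_continuous[OF smG[OF that]], where T = E])
    show "\<gamma> \<in> D \<rightarrow> E" using inD[OF that] DE by auto
    show "openin (top_of_set E) (E \<inter> B)" unfolding B_def by (rule openin_open_Int[OF open_ball])
  qed
  then have "openin (top_of_set D) ((\<Inter>\<gamma>\<in>G. D \<inter> \<gamma> -` (E \<inter> B)) \<inter> topspace (top_of_set D))"
    by (rule openin_INT[OF finG])
  then have "openin (top_of_set D) N1" by (simp add: N1_def Int_commute)
  then have oN1: "openin (top_of_set E) N1" using oD openin_trans by blast
  have uN1: "u \<in> N1" unfolding N1 B_def using uD r(1) by (auto simp: fixG)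
  have N1D: "N1 \<subseteq> D" by (auto simp: N1_def)
  have N1E: "N1 \<subseteq> E" using N1D DE by blast
  have N1B: "s \<in> B" if "s \<in> N1" for s
  proof -
    have "(\<lambda>x\<in>D. x) s \<in> B" "s \<in> D" using that G(1) unfolding N1 by blast+
    then show ?thesis by simp
  qed
  have N1inv: "\<delta> s \<in> N1" if dl: "\<delta> \<in> G" and s: "s \<in> N1" for \<delta> s
    unfolding N1
  proof (intro conjI ballI)
    have sD: "s \<in> D" using s N1D by blast
    show "\<delta> s \<in> D" by (rule inD[OF dl sD])
    fix \<gamma> assume g: "\<gamma> \<in> G"
    have "compose D \<gamma> \<delta> s \<in> B" using s G(2)[OF g dl] unfolding N1 by blast
    then show "\<gamma> (\<delta> s) \<in> B" using sD by (simp add: compose_def)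
  qed
  have mhN: "m (h s) = s" if "s \<in> N1" for s by (rule mh) (use that N1B N1E in auto)
  have hN: "h ` N1 \<subseteq> hh ` B"
  proof
    fix y assume "y \<in> h ` N1"
    then obtain s where "s \<in> N1" "y = h s" by blast
    then show "y \<in> hh ` B" using hhE[of s] N1B[of s] N1E by (metis image_eqI subsetD)
  qed
  have "smooth_embedding h N1 E"
    unfolding smooth_embedding_def
    using smooth_on_subset[OF hsm N1D] hE smooth_on_if_Cinf_on[OF mC(2,1) hN] mhN by blast
  then have "openin (top_of_set E) (h ` N1)"
    by (rule smooth_embedding_open[OF _ E oN1 order_refl oN1 order_refl])
  moreover have "0 \<in> h ` N1" using uN1 hu by (metis imageI)
  ultimately obtain \<rho> where \<rho>: "\<rho> > 0" "ball 0 \<rho> \<inter> E \<subseteq> h ` N1"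
    unfolding openin_contains_ball by blast
  define D' where "D' = E \<inter> (\<Inter>\<gamma>\<in>G. L \<gamma> -` ball 0 \<rho>)"
  have D': "y \<in> D' \<longleftrightarrow> y \<in> E \<and> (\<forall>\<gamma>\<in>G. L \<gamma> y \<in> ball 0 \<rho>)" for y by (auto simp: D'_def)
  have zD': "0 \<in> D'" unfolding D' using subspace_0[OF E] linear_0[OF linL] \<rho>(1) by simp
  have cvx: "convex D'"
    unfolding D'_def
    by (intro convex_Int convex_INT convex_linear_vimage linL subspace_imp_convex[OF E] convex_ball)
  have oD': "openin (top_of_set E) D'"
  proof -
    have "open (L \<gamma> -` ball 0 \<rho>)" if "\<gamma> \<in> G" for \<gamma>
    proof -
      have "bounded_linear (L \<gamma>)" using linL[OF that] linear_conv_bounded_linear by blast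
      then show ?thesis by (intro open_vimage[OF open_ball] linear_continuous_on)
    qed
    then have "open (\<Inter>\<gamma>\<in>G. L \<gamma> -` ball 0 \<rho>)" using finG by blast
    then show ?thesis unfolding D'_def by (rule openin_open_Int)
  qed
  have mD': "m y \<in> N1" "h (m y) = y" if "y \<in> D'" for y
  proof -
    have yE: "y \<in> E" using that D' by blast
    have "L (\<lambda>x\<in>D. x) y \<in> ball 0 \<rho>" using that G(1) unfolding D' by blast
    then have "y \<in> ball 0 \<rho>" unfolding Lid[OF yE] .
    then obtain s where s: "s \<in> N1" "y = h s" using \<rho>(2) yE by blast
    then show "m y \<in> N1" "h (m y) = y" using mhN[OF s(1)] by auto
  qed
  have LD': "L \<delta> y \<in> D'" if dl: "\<delta> \<in> G" and y: "y \<in> D'" for \<delta> y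
    unfolding D'
  proof (intro conjI ballI LE[OF dl])
    fix \<gamma> assume g: "\<gamma> \<in> G"
    have "L (compose D \<gamma> \<delta>) y \<in> ball 0 \<rho>" using y G(2)[OF g dl] unfolding D' by blast
    then show "L \<gamma> (L \<delta> y) \<in> ball 0 \<rho>" using Lcomp[OF g dl] y unfolding D' by simp
  qed
  have mL: "m (L \<delta> y) = \<delta> (m y)" if dl: "\<delta> \<in> G" and y: "y \<in> D'" for \<delta> y
  proof -
    have "m (h (\<delta> (m y))) = \<delta> (m y)" by (rule mhN[OF N1inv[OF dl mD'(1)[OF y]]])
    moreover have "h (\<delta> (m y)) = L \<delta> y"
      using heq[OF dl, of "m y"] mD'[OF y] N1D by auto
    ultimately show ?thesis by simp
  qed
  have injm: "inj_on m D'" by (rule inj_on_inverseI[of _ h]) (rule mD'(2))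
  have "D' \<subseteq> hh ` B"
  proof
    fix y assume "y \<in> D'"
    then have "y \<in> h ` N1" using mD'[of y] by (metis imageI)
    then show "y \<in> hh ` B" using hN by blast
  qed
  then have smm: "smooth_on m D'" by (rule smooth_on_if_Cinf_on[OF mC(2,1)])
  have mim: "m ` D' \<subseteq> Dom b" using mD'(1) N1D by (auto simp: D_def)
  have emb: "smooth_embedding m D' (Dom b)"
    unfolding smooth_embedding_def
  proof (intro conjI exI[of _ h] ballI)
    show "smooth_on h (m ` D')" by (rule smooth_on_subset[OF hsm]) (use mim in \<open>simp add: D_def\<close>)
  qed (use smm mim mD'(2) in auto)
  have inv: "\<gamma> ` m ` D' = m ` D'" if g: "\<gamma> \<in> G" for \<gamma>
  proof
    show "\<gamma> ` m ` D' \<subseteq> m ` D'"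
    proof clarify
      fix y assume y: "y \<in> D'"
      show "\<gamma> (m y) \<in> m ` D'" using mL[OF g y] LD'[OF g y] by (metis imageI)
    qed
    show "m ` D' \<subseteq> \<gamma> ` m ` D'"
    proof clarify
      fix y assume y: "y \<in> D'"
      have "m y \<in> D" using mD'(1)[OF y] N1D by blast
      then have "m y = \<gamma> (m (L (j \<gamma>) y))"
        using j(3)[OF g] mL[OF j(1)[OF g] y] by simp
      then show "m y \<in> \<gamma> ` m ` D'" using LD'[OF j(1)[OF g] y] by blast
    qed
  qed
  define c where "c = pull_chart b D' m"
  have cA: "c \<in> A" unfolding c_def
    by (rule pull_chart_in_atlas[OF orb b(1) oD' convex_connected[OF cvx] emb]) (use inv in \<open>auto simp: G_def\<close>)
  have rL: "restrict (\<lambda>x. the_inv_into D' m (\<gamma> (m x))) D' = restrict (L \<gamma>) D'" if g: "\<gamma> \<in> G" for \<gamma>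
  proof
    fix y
    show "restrict (\<lambda>x. the_inv_into D' m (\<gamma> (m x))) D' y = restrict (L \<gamma>) D' y"
      using mL[OF g, of y] the_inv_into_f_f[OF injm LD'[OF g, of y]] by (cases "y \<in> D'") auto
  qed
  have "Grp c = (\<lambda>\<gamma>. restrict (\<lambda>x. the_inv_into D' m (\<gamma> (m x))) D') ` G"
    unfolding c_def pull_chart_def using inv unfolding G_def by fastforce
  also have "\<dots> = (\<lambda>\<gamma>. restrict (L \<gamma>) D') ` G" by (rule image_cong[OF refl rL])
  finally have Gc: "Grp c = (\<lambda>K. restrict K D') ` L ` G" by (simp add: image_image)
  have "linear_chart E c (L ` G)"
    unfolding linear_chart_def using cvx zD' finG linL LE Gc by (auto simp: c_def)
  moreover have "Proj c 0 = x"
  proof -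
    have "m 0 = u" using mhN[OF uN1] hu by simp
    then show ?thesis using b(5) c0(3) by (simp add: c_def)
  qed
  moreover have "chart_image c \<subseteq> Q"
    unfolding c_def chart_image_pull using mim b(3,5) by (auto simp: N0_def)
  ultimately show ?thesis using that cA by blast
qed

section \<open>Smooth families of orbifold maps\<close>

definition time_nbhd :: "real \<Rightarrow> real set \<Rightarrow> bool" where
  "time_nbhd t I \<longleftrightarrow> t \<in> I \<and> is_interval I \<and> openin (top_of_set {0..1}) I"

lemma time_nbhd_full: "t \<in> {0..1} \<Longrightarrow> time_nbhd t {0..1}"
  by (simp add: time_nbhd_def is_interval_cc)

lemma time_nbhd_subset: "time_nbhd t I \<Longrightarrow> I \<subseteq> {0..1}"
  unfolding time_nbhd_def using openin_imp_subset by blast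

lemma time_nbhd_Int: "time_nbhd t I \<Longrightarrow> time_nbhd t J \<Longrightarrow> time_nbhd t (I \<inter> J)"
  unfolding time_nbhd_def by (auto intro: is_interval_Int)

lemma product_box:
  fixes g :: "'a::euclidean_space \<times> real \<Rightarrow> 'b::euclidean_space"
  assumes N: "openin (top_of_set E) N" "u \<in> N" and I: "time_nbhd t I"
    and g: "continuous_on (N \<times> I) g" "g ` (N \<times> I) \<subseteq> E'" and M: "openin (top_of_set E') M" "g (u, t) \<in> M"
  obtains N1 I1 where "openin (top_of_set E) N1" "u \<in> N1" "N1 \<subseteq> N" "time_nbhd t I1" "I1 \<subseteq> I"
    "g ` (N1 \<times> I1) \<subseteq> M"
proof -
  have I': "t \<in> I" "openin (top_of_set {0..1}) I" using I by (auto simp: time_nbhd_def)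
  have "openin (top_of_set (N \<times> I)) (N \<times> I \<inter> g -` M)"
    by (rule continuous_openin_preimage[OF g(1) _ M(1)]) (use g(2) in blast)
  then have op: "openin (prod_topology (top_of_set N) (top_of_set I)) (N \<times> I \<inter> g -` M)" by simp
  have "(u, t) \<in> N \<times> I \<inter> g -` M" using N I' M by simp
  from op[unfolded openin_prod_topology_alt, rule_format, OF this]
  obtain V J where V: "openin (top_of_set N) V" "openin (top_of_set I) J" "u \<in> V" "t \<in> J"
    "V \<times> J \<subseteq> N \<times> I \<inter> g -` M"
    by (elim exE conjE)
  have J: "openin (top_of_set {0..1}) J" using V(2) I'(2) openin_trans by blast
  then obtain e where e: "e > 0" "ball t e \<inter> {0..1} \<subseteq> J"
    using V(4) unfolding openin_contains_ball by blast
  show ?thesis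
  proof (rule that[of V "ball t e \<inter> {0..1}"])
    show "openin (top_of_set E) V" using V(1) N(1) openin_trans by blast
    show "V \<subseteq> N" using V(1) openin_imp_subset by blast
    have "t \<in> {0..1}" using time_nbhd_subset[OF I] I'(1) by blast
    then show "time_nbhd t (ball t e \<inter> {0..1})"
      unfolding time_nbhd_def using e(1)
      by (auto intro!: is_interval_Int openin_open_Int simp: Int_commute[of "ball t e"] is_interval_ball_real is_interval_cc)
    show "ball t e \<inter> {0..1} \<subseteq> I" using e(2) V(2) openin_imp_subset by blast
    show "g ` (V \<times> (ball t e \<inter> {0..1})) \<subseteq> M" using V(5) e(2) by blast
  qed (use V in auto)
qed

definition smooth_family :: "'a topology \<Rightarrow> ('e::euclidean_space, 'a) orb_chart set \<Rightarrow> ('a \<times> real \<Rightarrow> 'a) \<Rightarrow> bool" where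
  "smooth_family X A F \<longleftrightarrow>
     smooth_orbifold_map (interval_product_space X) (interval_product_atlas A) X A F"

definition local_lift ::
    "('e::euclidean_space, 'a) orb_chart \<Rightarrow> ('e, 'a) orb_chart \<Rightarrow> ('a \<times> real \<Rightarrow> 'a) \<Rightarrow>
     'e set \<Rightarrow> real set \<Rightarrow> ('e \<times> real \<Rightarrow> 'e) \<Rightarrow> bool" where
  "local_lift c d F N I h \<longleftrightarrow> N \<subseteq> Dom c \<and> smooth_on h (N \<times> I) \<and> h ` (N \<times> I) \<subseteq> Dom d \<and>
     (\<forall>s\<in>N. \<forall>\<tau>\<in>I. Proj d (h (s, \<tau>)) = F (Proj c s, \<tau>))"

lemma topspace_interval_product: "topspace (interval_product_space X) = topspace X \<times> {0..1}"
  by (simp add: interval_product_space_def)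

lemma chart_image_product: "chart_image (product_chart c I) = chart_image c \<times> I"
  by (auto simp: chart_image_def product_chart_def map_prod_def image_iff)

lemma smooth_family_in: "smooth_family X A F \<Longrightarrow> x \<in> topspace X \<Longrightarrow> t \<in> {0..1} \<Longrightarrow> F (x, t) \<in> topspace X"
  unfolding smooth_family_def smooth_orbifold_map_def continuous_map_def topspace_interval_product by auto

lemma smooth_family_continuous:
  "smooth_family X A F \<Longrightarrow> continuous_map (prod_topology X (top_of_set {0..1})) X F"
  unfolding smooth_family_def smooth_orbifold_map_def interval_product_space_def by auto

context
  fixes E :: "'e::euclidean_space set" and X :: "'a topology" and A :: "('e, 'a) orb_chart set"
  assumes orb: "orbifold E X A"
begin

lemma smooth_familyI:
  assumes loc: "\<And>x t. x \<in> topspace X \<Longrightarrow> t \<in> {0..1} \<Longrightarrow>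
      \<exists>c\<in>A. \<exists>u\<in>Dom c. Proj c u = x \<and> (\<exists>I. time_nbhd t I \<and> (\<exists>d\<in>A. \<exists>h. local_lift c d F (Dom c) I h))"
  shows "smooth_family X A F"
proof -
  let ?Y = "prod_topology X (top_of_set {0..1::real})"
  have "continuous_map ?Y X F"
    unfolding continuous_map_def
  proof (intro conjI allI impI)
    show "F \<in> topspace ?Y \<rightarrow> topspace X"
    proof
      fix p assume "p \<in> topspace ?Y"
      then obtain x t where p: "p = (x, t)" "x \<in> topspace X" "t \<in> {0..1}" by auto
      obtain c u I d h where *: "u \<in> Dom c" "Proj c u = x" "time_nbhd t I" "d \<in> A" "local_lift c d F (Dom c) I h"
        using loc[OF p(2,3)] by blast
      have "t \<in> I" using *(3) by (simp add: time_nbhd_def)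
      then have "F p = Proj d (h (u, t))" "h (u, t) \<in> Dom d"
        using * p(1) unfolding local_lift_def by auto
      then show "F p \<in> topspace X"
        using chart_image_subset[OF atlas_chart[OF orb *(4)]] by (auto simp: chart_image_def)
    qed
    fix U assume U: "openin X U"
    show "openin ?Y {p \<in> topspace ?Y. F p \<in> U}"
      unfolding openin_prod_topology_alt
    proof (intro allI impI)
      fix x t assume "(x, t) \<in> {p \<in> topspace ?Y. F p \<in> U}"
      then have p: "x \<in> topspace X" "t \<in> {0..1}" "F (x, t) \<in> U" by auto
      obtain c u I d h where cA: "c \<in> A" and u: "u \<in> Dom c" "Proj c u = x" and I: "time_nbhd t I"
        and dA: "d \<in> A" and h: "local_lift c d F (Dom c) I h"
        using loc[OF p(1,2)] by blast
      note c = atlas_chart[OF orb cA] and d = atlas_chart[OF orb dA]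
      have tI: "t \<in> I" using I by (simp add: time_nbhd_def)
      have hs: "smooth_on h (Dom c \<times> I)" "h ` (Dom c \<times> I) \<subseteq> Dom d"
        and hF: "\<And>s \<tau>. s \<in> Dom c \<Longrightarrow> \<tau> \<in> I \<Longrightarrow> Proj d (h (s, \<tau>)) = F (Proj c s, \<tau>)"
        using h unfolding local_lift_def by auto
      define M where "M = {v \<in> Dom d. Proj d v \<in> U}"
      have M: "openin (top_of_set (Dom d)) M"
        using chart_Proj(1)[OF d] U unfolding continuous_map_def M_def by auto
      have hM: "h (u, t) \<in> M" using hs(2) hF[OF u(1) tI] p(3) u tI unfolding M_def by auto
      obtain N1 I1 where N1: "openin (top_of_set E) N1" "u \<in> N1" "N1 \<subseteq> Dom c" "time_nbhd t I1" "I1 \<subseteq> I"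
        "h ` (N1 \<times> I1) \<subseteq> M"
        by (rule product_box[OF chart_Dom(1)[OF c] u(1) I smooth_on_continuous[OF hs(1)] hs(2) M hM]) (erule that; assumption)
      have "openin X (Proj c ` N1)" by (rule chart_Proj_open[OF c N1(1,3)])
      moreover have "openin (top_of_set {0..1}) I1" "t \<in> I1" "I1 \<subseteq> {0..1}"
        using N1(4) time_nbhd_subset[OF N1(4)] by (auto simp: time_nbhd_def)
      moreover have "x \<in> Proj c ` N1" using N1(2) u(2) by blast
      moreover have "Proj c ` N1 \<times> I1 \<subseteq> {p \<in> topspace ?Y. F p \<in> U}"
      proof clarify
        fix s \<tau> assume s: "s \<in> N1" "\<tau> \<in> I1"
        have sc: "s \<in> Dom c" "\<tau> \<in> I" using s N1 by auto
        have "h (s, \<tau>) \<in> M" using N1(6) s by blast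
        then have "F (Proj c s, \<tau>) \<in> U" using hF[OF sc] unfolding M_def by simp
        moreover have "Proj c s \<in> topspace X" using chart_image_subset[OF c] sc by (auto simp: chart_image_def)
        ultimately show "(Proj c s, \<tau>) \<in> topspace ?Y \<and> F (Proj c s, \<tau>) \<in> U"
          using s(2) \<open>I1 \<subseteq> {0..1}\<close> by auto
      qed
      ultimately show "\<exists>V W. openin X V \<and> openin (top_of_set {0..1}) W \<and> x \<in> V \<and> t \<in> W \<and>
          V \<times> W \<subseteq> {p \<in> topspace ?Y. F p \<in> U}" by blast
    qed
  qed
  moreover have "\<exists>C\<in>interval_product_atlas A. \<exists>d\<in>A. p \<in> chart_image C \<and> F p \<in> chart_image d \<and>
      F ` chart_image C \<subseteq> chart_image d \<and> (\<exists>h. smooth_on h (Dom C) \<and> h ` Dom C \<subseteq> Dom d \<and>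
             (\<forall>u\<in>Dom C. Proj d (h u) = F (Proj C u)))"
    if pp: "p \<in> topspace (interval_product_space X)" for p
  proof -
    obtain x t where p: "p = (x, t)" "x \<in> topspace X" "t \<in> {0..1}"
      using pp by (auto simp: topspace_interval_product)
    obtain c u I d h where cA: "c \<in> A" and u: "u \<in> Dom c" "Proj c u = x" and I: "time_nbhd t I"
      and dA: "d \<in> A" and h: "local_lift c d F (Dom c) I h"
      using loc[OF p(2,3)] by blast
    have hs: "smooth_on h (Dom c \<times> I)" "h ` (Dom c \<times> I) \<subseteq> Dom d"
      and hF: "\<And>s \<tau>. s \<in> Dom c \<Longrightarrow> \<tau> \<in> I \<Longrightarrow> Proj d (h (s, \<tau>)) = F (Proj c s, \<tau>)"
      using h unfolding local_lift_def by auto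
    have tI: "t \<in> I" using I by (simp add: time_nbhd_def)
    have C: "product_chart c I \<in> interval_product_atlas A"
      using cA I unfolding interval_product_atlas_def time_nbhd_def by blast
    have D: "Dom (product_chart c I) = Dom c \<times> I" "Proj (product_chart c I) = map_prod (Proj c) id"
      by (simp_all add: product_chart_def)
    have im: "F q \<in> chart_image d" if q: "q \<in> chart_image c \<times> I" for q
    proof -
      obtain s \<tau> where s: "s \<in> Dom c" "\<tau> \<in> I" "q = (Proj c s, \<tau>)" using q by (auto simp: chart_image_def)
      then have "F q = Proj d (h (s, \<tau>))" "h (s, \<tau>) \<in> Dom d" using hF hs(2) by auto
      then show ?thesis by (simp add: chart_image_def)
    qed
    have pc: "p \<in> chart_image c \<times> I" using p(1) u tI by (auto simp: chart_image_def)
    show ?thesis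
    proof (intro bexI[OF _ C] bexI[OF _ dA] conjI exI[of _ h])
      show "p \<in> chart_image (product_chart c I)" using pc unfolding chart_image_product .
      show "F p \<in> chart_image d" by (rule im[OF pc])
      show "F ` chart_image (product_chart c I) \<subseteq> chart_image d"
        unfolding chart_image_product using im by blast
      show "smooth_on h (Dom (product_chart c I))" "h ` Dom (product_chart c I) \<subseteq> Dom d"
        unfolding D by (rule hs)+
      show "\<forall>u\<in>Dom (product_chart c I). Proj d (h u) = F (Proj (product_chart c I) u)"
        unfolding D using hF by auto
    qed
  qed
  ultimately show ?thesis
    unfolding smooth_family_def smooth_orbifold_map_def interval_product_space_def[symmetric] by blast
qed

lemma smooth_family_weak_lift:
  assumes F: "smooth_family X A F" and x: "x \<in> topspace X" and t: "t \<in> {0..1}"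
  obtains c u I d h where "c \<in> A" "u \<in> Dom c" "Proj c u = x" "time_nbhd t I" "d \<in> A" "local_lift c d F (Dom c) I h"
proof -
  have "(x, t) \<in> topspace (interval_product_space X)" using x t by (simp add: topspace_interval_product)
  then obtain C d h where C: "C \<in> interval_product_atlas A" "d \<in> A" "(x, t) \<in> chart_image C"
    and h: "smooth_on h (Dom C)" "h ` Dom C \<subseteq> Dom d" "\<forall>u\<in>Dom C. Proj d (h u) = F (Proj C u)"
    using F unfolding smooth_family_def smooth_orbifold_map_def by metis
  obtain c I where c: "C = product_chart c I" "c \<in> A" "is_interval I" "openin (top_of_set {0..1}) I"
    using C(1) unfolding interval_product_atlas_def by blast
  have D: "Dom C = Dom c \<times> I" "Proj C = map_prod (Proj c) id"
    by (simp_all add: c(1) product_chart_def)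
  obtain u where u: "u \<in> Dom c" "Proj c u = x" and tI: "t \<in> I"
    using C(3) unfolding c(1) chart_image_product by (auto simp: chart_image_def)
  have "local_lift c d F (Dom c) I h" unfolding local_lift_def using h unfolding D by auto
  then show ?thesis using that[OF c(2) u _ C(2)] c(3,4) tI unfolding time_nbhd_def by blast
qed

text \<open>Transition maps at the source and at the target turn the lift in some pair of charts into a lift
  between any two prescribed charts through prescribed lifts of the points.\<close>

lemma smooth_family_lift:
  assumes F: "smooth_family X A F" and t: "t \<in> {0..1}"
    and cA: "c \<in> A" and u: "u \<in> Dom c" and dA: "d \<in> A" and v: "v \<in> Dom d" "Proj d v = F (Proj c u, t)"
  obtains N I h where "openin (top_of_set E) N" "u \<in> N" "time_nbhd t I" "local_lift c d F N I h" "h (u, t) = v"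
proof -
  note c = atlas_chart[OF orb cA] and d = atlas_chart[OF orb dA]
  have x: "Proj c u \<in> topspace X" using chart_image_subset[OF c] u by (auto simp: chart_image_def)
  obtain c' u' I d' h where c': "c' \<in> A" "u' \<in> Dom c'" "Proj c' u' = Proj c u" and I: "time_nbhd t I"
    and d': "d' \<in> A" and h: "local_lift c' d' F (Dom c') I h"
    by (rule smooth_family_weak_lift[OF F x t]) (erule that; assumption)
  have tI: "t \<in> I" using I by (simp add: time_nbhd_def)
  have hs: "smooth_on h (Dom c' \<times> I)" "h ` (Dom c' \<times> I) \<subseteq> Dom d'"
    and hF: "\<And>s \<tau>. s \<in> Dom c' \<Longrightarrow> \<tau> \<in> I \<Longrightarrow> Proj d' (h (s, \<tau>)) = F (Proj c' s, \<tau>)"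
    using h unfolding local_lift_def by auto
  obtain N \<nu> where N: "openin (top_of_set E) N" "u \<in> N" "N \<subseteq> Dom c" "smooth_embedding \<nu> N (Dom c')"
    "\<nu> u = u'" "\<forall>x\<in>N. Proj c' (\<nu> x) = Proj c x"
    by (rule atlas_transition[OF orb cA c'(1) u c'(2) c'(3)[symmetric]]) (erule that; assumption)
  have hu: "h (u', t) \<in> Dom d'" using hs(2) c'(2) tI by blast
  have hv: "Proj d' (h (u', t)) = Proj d v" using hF[OF c'(2) tI] c'(3) v(2) by simp
  obtain M \<mu> where M: "openin (top_of_set E) M" "h (u', t) \<in> M" "M \<subseteq> Dom d'" "smooth_embedding \<mu> M (Dom d)"
    "\<mu> (h (u', t)) = v" "\<forall>x\<in>M. Proj d (\<mu> x) = Proj d' x"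
    by (rule atlas_transition[OF orb d' dA hu v(1) hv]) (erule that; assumption)
  have \<nu>: "smooth_on \<nu> N" "\<nu> ` N \<subseteq> Dom c'" and \<mu>: "smooth_on \<mu> M" "\<mu> ` M \<subseteq> Dom d"
    using N(4) M(4) by (auto simp: smooth_embedding_def)
  define g where "g = (\<lambda>p. h (\<nu> (fst p), snd p))"
  have gs: "smooth_on g (N \<times> I)"
    unfolding g_def
  proof (rule smooth_on_compose[OF _ hs(1)])
    have "smooth_on (\<lambda>p. \<nu> (fst p)) (N \<times> I)"
      by (rule smooth_on_compose[OF smooth_on_linear[OF linear_fst] \<nu>(1)]) auto
    then show "smooth_on (\<lambda>p. (\<nu> (fst p), snd p)) (N \<times> I)"
      by (rule smooth_on_Pair[OF _ smooth_on_linear[OF linear_snd]])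
  qed (use \<nu>(2) in auto)
  have gim: "g ` (N \<times> I) \<subseteq> E"
    using hs(2) \<nu>(2) chart_Dom(3)[OF atlas_chart[OF orb d']] unfolding g_def by fastforce
  have gM: "g (u, t) \<in> M" using M(2) N(5) by (simp add: g_def)
  obtain N1 I1 where N1: "openin (top_of_set E) N1" "u \<in> N1" "N1 \<subseteq> N" "time_nbhd t I1" "I1 \<subseteq> I"
    "g ` (N1 \<times> I1) \<subseteq> M"
    by (rule product_box[OF N(1,2) I smooth_on_continuous[OF gs] gim M(1) gM]) (erule that; assumption)
  show ?thesis
  proof (rule that[OF N1(1,2,4)])
    show "local_lift c d F N1 I1 (\<lambda>p. \<mu> (g p))"
      unfolding local_lift_def
    proof (intro conjI ballI)
      show "N1 \<subseteq> Dom c" using N1(3) N(3) by blast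
      show "smooth_on (\<lambda>p. \<mu> (g p)) (N1 \<times> I1)"
        by (rule smooth_on_compose[OF smooth_on_subset[OF gs] \<mu>(1) N1(6)]) (use N1(3,5) in blast)
      show "(\<lambda>p. \<mu> (g p)) ` (N1 \<times> I1) \<subseteq> Dom d" using N1(6) \<mu>(2) by blast
      fix s \<tau> assume s: "s \<in> N1" "\<tau> \<in> I1"
      have sN: "s \<in> N" "\<tau> \<in> I" using s N1(3,5) by auto
      have "g (s, \<tau>) \<in> M" using N1(6) s by blast
      then have "Proj d (\<mu> (g (s, \<tau>))) = Proj d' (g (s, \<tau>))" using M(6) by blast
      also have "\<dots> = F (Proj c' (\<nu> s), \<tau>)" unfolding g_def using hF[of "\<nu> s" \<tau>] \<nu>(2) sN by auto
      also have "\<dots> = F (Proj c s, \<tau>)" using N(6) sN(1) by simp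
      finally show "Proj d (\<mu> (g (s, \<tau>))) = F (Proj c s, \<tau>)" .
    qed
    show "\<mu> (g (u, t)) = v" using M(5) N(5) by (simp add: g_def)
  qed
qed

lemma smooth_family_compose:
  assumes F: "smooth_family X A F" and H: "smooth_family X A H"
  shows "smooth_family X A (\<lambda>p. F (H p, snd p))"
proof (rule smooth_familyI)
  fix x t assume x: "x \<in> topspace X" and t: "t \<in> {0..1::real}"
  obtain c u where c: "c \<in> A" "u \<in> Dom c" "Proj c u = x" by (rule atlas_lift[OF orb x]) (erule that; assumption)
  have Hx: "H (x, t) \<in> topspace X" by (rule smooth_family_in[OF H x t])
  obtain d v where d: "d \<in> A" "v \<in> Dom d" "Proj d v = H (x, t)"
    by (rule atlas_lift[OF orb Hx]) (erule that; assumption)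
  obtain e w where e: "e \<in> A" "w \<in> Dom e" "Proj e w = F (H (x, t), t)"
    by (rule atlas_lift[OF orb smooth_family_in[OF F Hx t]]) (erule that; assumption)
  have d3: "Proj d v = H (Proj c u, t)" and e3: "Proj e w = F (Proj d v, t)" using c d e by auto
  obtain N I h where N: "openin (top_of_set E) N" "u \<in> N" "time_nbhd t I" "local_lift c d H N I h" "h (u, t) = v"
    by (rule smooth_family_lift[OF H t c(1,2) d(1,2) d3]) (erule that; assumption)
  obtain M J k where M: "openin (top_of_set E) M" "v \<in> M" "time_nbhd t J" "local_lift d e F M J k" "k (v, t) = w"
    by (rule smooth_family_lift[OF F t d(1,2) e(1,2) e3]) (erule that; assumption)
  have h: "N \<subseteq> Dom c" "smooth_on h (N \<times> I)" "h ` (N \<times> I) \<subseteq> Dom d"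
    and hF: "\<And>s \<tau>. s \<in> N \<Longrightarrow> \<tau> \<in> I \<Longrightarrow> Proj d (h (s, \<tau>)) = H (Proj c s, \<tau>)"
    using N(4) unfolding local_lift_def by auto
  have k: "smooth_on k (M \<times> J)" "k ` (M \<times> J) \<subseteq> Dom e"
    and kF: "\<And>s \<tau>. s \<in> M \<Longrightarrow> \<tau> \<in> J \<Longrightarrow> Proj e (k (s, \<tau>)) = F (Proj d s, \<tau>)"
    using M(4) unfolding local_lift_def by auto
  have hE: "h ` (N \<times> I) \<subseteq> E" using h(3) chart_Dom(3)[OF atlas_chart[OF orb d(1)]] by blast
  have hM: "h (u, t) \<in> M" using N(5) M(2) by simp
  obtain N1 I1 where N1: "openin (top_of_set E) N1" "u \<in> N1" "N1 \<subseteq> N" "time_nbhd t I1" "I1 \<subseteq> I"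
    "h ` (N1 \<times> I1) \<subseteq> M"
    by (rule product_box[OF N(1,2,3) smooth_on_continuous[OF h(2)] hE M(1) hM]) (erule that; assumption)
  obtain b where b: "b \<in> A" "u \<in> Dom b" "Dom b \<subseteq> N1" "Dom b \<subseteq> Dom c" "Proj b = Proj c"
    "Grp b = (\<lambda>\<gamma>. restrict \<gamma> (Dom b)) ` {\<gamma> \<in> Grp c. \<gamma> u = u}"
    by (rule atlas_restrict[OF orb c(1,2) N1(1,2)]) (erule that; assumption)
  define K where "K = I1 \<inter> J"
  have K: "time_nbhd t K" unfolding K_def by (rule time_nbhd_Int[OF N1(4) M(3)])
  have sub: "Dom b \<times> K \<subseteq> N \<times> I" using b(3) N1(3,5) by (auto simp: K_def)
  have "local_lift b e (\<lambda>p. F (H p, snd p)) (Dom b) K (\<lambda>p. k (h p, snd p))"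
    unfolding local_lift_def
  proof (intro conjI ballI order_refl)
    have im: "(\<lambda>p. (h p, snd p)) ` (Dom b \<times> K) \<subseteq> M \<times> J" using b(3) N1(6) by (auto simp: K_def)
    show "smooth_on (\<lambda>p. k (h p, snd p)) (Dom b \<times> K)"
      by (rule smooth_on_compose[OF smooth_on_Pair[OF smooth_on_subset[OF h(2) sub] smooth_on_linear[OF linear_snd]] k(1) im])
    show "(\<lambda>p. k (h p, snd p)) ` (Dom b \<times> K) \<subseteq> Dom e" using im k(2) by fastforce
    fix s \<tau> assume s: "s \<in> Dom b" "\<tau> \<in> K"
    have "s \<in> N" "\<tau> \<in> I" "h (s, \<tau>) \<in> M" "\<tau> \<in> J" using s sub im by (auto simp: K_def)
    then show "Proj e (k (h (s, \<tau>), snd (s, \<tau>))) = F (H (Proj b s, \<tau>), snd (Proj b s, \<tau>))"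
      using hF kF b(5) by simp
  qed
  then show "\<exists>c\<in>A. \<exists>u\<in>Dom c. Proj c u = x \<and> (\<exists>I. time_nbhd t I \<and> (\<exists>d\<in>A. \<exists>h.
      local_lift c d (\<lambda>p. F (H p, snd p)) (Dom c) I h))"
    using K b(5) c(3) by (intro bexI[OF _ b(1)] bexI[OF _ b(2)] conjI exI[of _ K] bexI[OF _ e(1)]
        exI[of _ "\<lambda>p. k (h p, snd p)"]) auto
qed

lemma smooth_family_slice:
  assumes F: "smooth_family X A F" and t: "t \<in> {0..1}"
  shows "smooth_orbifold_map X A X A (\<lambda>x. F (x, t))"
  unfolding smooth_orbifold_map_def
proof (intro conjI ballI)
  have "continuous_map X (prod_topology X (top_of_set {0..1})) (\<lambda>x. (x, t))"
    using t by (intro continuous_map_pairedI) auto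
  from continuous_map_compose[OF this smooth_family_continuous[OF F]]
  show "continuous_map X X (\<lambda>x. F (x, t))" by (simp add: o_def)
  fix x assume x: "x \<in> topspace X"
  obtain c u I d h where c: "c \<in> A" "u \<in> Dom c" "Proj c u = x" and I: "time_nbhd t I"
    and d: "d \<in> A" and h: "local_lift c d F (Dom c) I h"
    by (rule smooth_family_weak_lift[OF F x t]) (erule that; assumption)
  have tI: "t \<in> I" using I by (simp add: time_nbhd_def)
  have hs: "smooth_on h (Dom c \<times> I)" "h ` (Dom c \<times> I) \<subseteq> Dom d"
    and hF: "\<And>s. s \<in> Dom c \<Longrightarrow> Proj d (h (s, t)) = F (Proj c s, t)"
    using h tI unfolding local_lift_def by auto
  have hd: "h (s, t) \<in> Dom d" if "s \<in> Dom c" for s using hs(2) that tI by blast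
  have im: "F (Proj c s, t) \<in> chart_image d" if "s \<in> Dom c" for s
    using hF[OF that, symmetric] hd[OF that] by (simp add: chart_image_def)
  show "\<exists>c\<in>A. \<exists>d\<in>A. x \<in> chart_image c \<and> F (x, t) \<in> chart_image d \<and>
      (\<lambda>x. F (x, t)) ` chart_image c \<subseteq> chart_image d \<and>
      (\<exists>h. smooth_on h (Dom c) \<and> h ` Dom c \<subseteq> Dom d \<and> (\<forall>u\<in>Dom c. Proj d (h u) = F (Proj c u, t)))"
  proof (rule bexI[OF _ c(1)], rule bexI[OF _ d], intro conjI exI[of _ "\<lambda>s. h (s, t)"])
    show "x \<in> chart_image c" using c by (auto simp: chart_image_def)
    show "F (x, t) \<in> chart_image d" using im c by blast
    show "(\<lambda>x. F (x, t)) ` chart_image c \<subseteq> chart_image d" using im by (auto simp: chart_image_def[of c])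
    show "smooth_on (\<lambda>s. h (s, t)) (Dom c)"
      by (rule smooth_on_compose[OF smooth_on_Pair[OF smooth_on_ident smooth_on_const] hs(1)]) (use tI in auto)
  qed (use hd hF in auto)
qed

end

text \<open>The family \<open>F'\<close> of inverses is carried along so that inverting an isotopy and composing two of
  them require nothing beyond the composition of smooth families.\<close>

definition isotopy_pair ::
    "'e::euclidean_space set \<Rightarrow> 'a topology \<Rightarrow> ('e, 'a) orb_chart set \<Rightarrow>
     ('a \<times> real \<Rightarrow> 'a) \<Rightarrow> ('a \<times> real \<Rightarrow> 'a) \<Rightarrow> bool" where
  "isotopy_pair E X A F F' \<longleftrightarrow> smooth_family X A F \<and> smooth_family X A F' \<and>
     (\<forall>x\<in>topspace X. \<forall>t\<in>{0..1}. F' (F (x, t), t) = x \<and> F (F' (x, t), t) = x) \<and>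
     (\<forall>x\<in>topspace X. F (x, 0) = x) \<and>
     (\<exists>K. compactin X K \<and> (\<forall>x\<in>topspace X - K. \<forall>t\<in>{0..1}. F (x, t) = x)) \<and>
     (\<forall>x\<in>topspace X. \<forall>t\<in>{0..1}. sdim E A (F (x, t)) = sdim E A x)"

context
  fixes E :: "'e::euclidean_space set" and X :: "'a topology" and A :: "('e, 'a) orb_chart set"
  assumes orb: "orbifold E X A"
begin

lemma isotopy_pair_swap:
  assumes F: "isotopy_pair E X A F F'" shows "isotopy_pair E X A F' F"
proof -
  have sF: "smooth_family X A F" and sF': "smooth_family X A F'"
    and i: "\<And>x t. x \<in> topspace X \<Longrightarrow> t \<in> {0..1} \<Longrightarrow> F' (F (x, t), t) = x \<and> F (F' (x, t), t) = x"
    and z: "\<And>x. x \<in> topspace X \<Longrightarrow> F (x, 0) = x"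
    and s: "\<And>x t. x \<in> topspace X \<Longrightarrow> t \<in> {0..1} \<Longrightarrow> sdim E A (F (x, t)) = sdim E A x"
    using F unfolding isotopy_pair_def by auto
  obtain K where K: "compactin X K" "\<forall>x\<in>topspace X - K. \<forall>t\<in>{0..1}. F (x, t) = x"
    using F unfolding isotopy_pair_def by blast
  have "F' (x, t) = x" if "x \<in> topspace X - K" "t \<in> {0..1}" for x t
    using i[of x t] K(2) that by auto
  moreover have "F' (x, 0) = x" if "x \<in> topspace X" for x using i[OF that, of 0] z[OF that] by simp
  moreover have "sdim E A (F' (x, t)) = sdim E A x" if "x \<in> topspace X" "t \<in> {0..1}" for x t
    using s[OF smooth_family_in[OF sF' that] that(2)] i[OF that] by simp
  ultimately show ?thesis unfolding isotopy_pair_def using sF sF' i K(1) by blast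
qed

lemma isotopy_pair_compose:
  assumes F: "isotopy_pair E X A F F'" and H: "isotopy_pair E X A H H'"
  shows "isotopy_pair E X A (\<lambda>p. F (H p, snd p)) (\<lambda>p. H' (F' p, snd p))"
proof -
  have sF: "smooth_family X A F" and sF': "smooth_family X A F'"
    and i: "\<And>x t. x \<in> topspace X \<Longrightarrow> t \<in> {0..1} \<Longrightarrow> F' (F (x, t), t) = x \<and> F (F' (x, t), t) = x"
    and z: "\<And>x. x \<in> topspace X \<Longrightarrow> F (x, 0) = x"
    and s: "\<And>x t. x \<in> topspace X \<Longrightarrow> t \<in> {0..1} \<Longrightarrow> sdim E A (F (x, t)) = sdim E A x"
    using F unfolding isotopy_pair_def by auto
  have sH: "smooth_family X A H" and sH': "smooth_family X A H'"
    and iH: "\<And>x t. x \<in> topspace X \<Longrightarrow> t \<in> {0..1} \<Longrightarrow> H' (H (x, t), t) = x \<and> H (H' (x, t), t) = x"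
    and zH: "\<And>x. x \<in> topspace X \<Longrightarrow> H (x, 0) = x"
    and dH: "\<And>x t. x \<in> topspace X \<Longrightarrow> t \<in> {0..1} \<Longrightarrow> sdim E A (H (x, t)) = sdim E A x"
    using H unfolding isotopy_pair_def by auto
  obtain K where K: "compactin X K" "\<forall>x\<in>topspace X - K. \<forall>t\<in>{0..1}. F (x, t) = x"
    using F unfolding isotopy_pair_def by blast
  obtain L where L: "compactin X L" "\<forall>x\<in>topspace X - L. \<forall>t\<in>{0..1}. H (x, t) = x"
    using H unfolding isotopy_pair_def by blast
  show ?thesis
    unfolding isotopy_pair_def
  proof (intro conjI ballI exI[of _ "K \<union> L"])
    show "smooth_family X A (\<lambda>p. F (H p, snd p))" by (rule smooth_family_compose[OF orb sF sH])
    show "smooth_family X A (\<lambda>p. H' (F' p, snd p))" by (rule smooth_family_compose[OF orb sH' sF'])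
    show "compactin X (K \<union> L)" by (rule compactin_Un[OF K(1) L(1)])
  qed (use i z s iH zH dH K(2) L(2) smooth_family_in[OF sH] smooth_family_in[OF sF'] in auto)
qed

lemma isotopy_pair_isotopy:
  assumes F: "isotopy_pair E X A F F'"
  shows "orbifold_isotopy X A id (\<lambda>x. F (x, 1)) F" "compactly_supported X F"
    "orbifold_diffeomorphism X A (\<lambda>x. F (x, 1))"
proof -
  have d: "orbifold_diffeomorphism X A (\<lambda>x. F (x, t))" if t: "t \<in> {0..1}" for t
  proof -
    have s: "smooth_family X A F" "smooth_family X A F'" using F by (simp_all add: isotopy_pair_def)
    have i: "\<forall>x\<in>topspace X. F' (F (x, t), t) = x" "\<forall>x\<in>topspace X. F (F' (x, t), t) = x"
      using F t by (simp_all add: isotopy_pair_def)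
    show ?thesis
      unfolding orbifold_diffeomorphism_def
      by (rule conjI[OF smooth_family_slice[OF orb s(1) t]], rule exI[of _ "\<lambda>x. F' (x, t)"],
          intro conjI smooth_family_slice[OF orb s(2) t] i)
  qed
  then show "orbifold_isotopy X A id (\<lambda>x. F (x, 1)) F"
    using F unfolding orbifold_isotopy_def isotopy_pair_def smooth_family_def by auto
  show "compactly_supported X F"
    using F unfolding compactly_supported_def isotopy_pair_def by blast
  show "orbifold_diffeomorphism X A (\<lambda>x. F (x, 1))" by (rule d) simp
qed

text \<open>Points travel along paths inside their stratum.\<close>

lemma isotopy_pair_stratum_component:
  assumes F: "isotopy_pair E X A F F'" and x: "x \<in> topspace X"
  shows "F (x, 1) \<in> stratum_component E X A x"
proof -
  have sF: "smooth_family X A F" and z: "F (x, 0) = x"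
    and s: "\<And>t. t \<in> {0..1} \<Longrightarrow> sdim E A (F (x, t)) = sdim E A x"
    using F x unfolding isotopy_pair_def by auto
  let ?S = "stratum E X A (sdim E A x)"
  have "continuous_map (top_of_set {0..1::real}) (prod_topology X (top_of_set {0..1})) (\<lambda>t. (x, t))"
    using x by (intro continuous_map_pairedI) auto
  from continuous_map_compose[OF this smooth_family_continuous[OF sF]]
  have c: "continuous_map (top_of_set {0..1}) X (\<lambda>t. F (x, t))" by (simp add: o_def)
  have inS: "(\<lambda>t. F (x, t)) ` {0..1} \<subseteq> ?S"
    using s smooth_family_in[OF sF x] by (auto simp: stratum_def)
  then have c': "continuous_map (top_of_set {0..1}) (subtopology X ?S) (\<lambda>t. F (x, t))"
    using c by (auto simp: continuous_map_in_subtopology)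
  have "connectedin (top_of_set {0..1::real}) {0..1}" by (simp add: connectedin_subtopology)
  from connectedin_continuous_map_image[OF c' this]
  have "connectedin (subtopology X ?S) ((\<lambda>t. F (x, t)) ` {0..1})" .
  moreover have "x \<in> (\<lambda>t. F (x, t)) ` {0..1}" using z by (intro image_eqI[of _ _ 0]) auto
  moreover have "F (x, 1) \<in> (\<lambda>t. F (x, t)) ` {0..1}" by simp
  ultimately show ?thesis
    unfolding stratum_component_def connected_component_of_def mem_Collect_eq by blast
qed

end

section \<open>Pushing a point inside a linear chart\<close>

definition chart_deformation ::
    "('e::euclidean_space, 'a) orb_chart \<Rightarrow> 'e set \<Rightarrow> ('e \<times> real \<Rightarrow> 'e) \<Rightarrow> bool" where
  "chart_deformation c K H \<longleftrightarrow> smooth_on H (Dom c \<times> {0..1}) \<and>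
     (\<forall>s\<in>Dom c. \<forall>t\<in>{0..1}. H (s, t) \<in> Dom c) \<and>
     (\<forall>\<gamma>\<in>Grp c. \<forall>s\<in>Dom c. \<forall>t\<in>{0..1}. H (\<gamma> s, t) = \<gamma> (H (s, t))) \<and>
     (\<forall>s\<in>Dom c - K. \<forall>t\<in>{0..1}. H (s, t) = s)"

text \<open>The chosen lift of the point does not matter if \<open>H\<close> is equivariant.\<close>

definition chart_move :: "('e::euclidean_space, 'a) orb_chart \<Rightarrow> ('e \<times> real \<Rightarrow> 'e) \<Rightarrow> 'a \<times> real \<Rightarrow> 'a" where
  "chart_move c H p =
     (if fst p \<in> chart_image c then Proj c (H (SOME s. s \<in> Dom c \<and> Proj c s = fst p, snd p)) else fst p)"

lemma chart_move_Proj: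
  assumes c: "orbifold_chart E X c" and H: "chart_deformation c K H" and s: "s \<in> Dom c" and t: "t \<in> {0..1}"
  shows "chart_move c H (Proj c s, t) = Proj c (H (s, t))"
proof -
  define s' where "s' = (SOME s'. s' \<in> Dom c \<and> Proj c s' = Proj c s)"
  have s': "s' \<in> Dom c \<and> Proj c s' = Proj c s"
    unfolding s'_def by (rule someI[of _ s]) (use s in simp)
  then obtain \<gamma> where g: "\<gamma> \<in> Grp c" "s' = \<gamma> s" using chart_Proj_eq_iff[OF c s, of s'] by auto
  have "H (s', t) = \<gamma> (H (s, t))" "H (s, t) \<in> Dom c"
    using H g s t unfolding chart_deformation_def by auto
  then have "Proj c (H (s', t)) = Proj c (H (s, t))" using chart_invariant[OF c g(1)] by simp
  moreover have "Proj c s \<in> chart_image c" using s by (simp add: chart_image_def)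
  ultimately show ?thesis unfolding chart_move_def s'_def by simp
qed

lemma chart_move_outside: "x \<notin> chart_image c \<Longrightarrow> chart_move c H (x, t) = x"
  by (simp add: chart_move_def)

context
  fixes E :: "'e::euclidean_space set" and X :: "'a topology" and A :: "('e, 'a) orb_chart set"
  assumes orb: "orbifold E X A"
begin

lemma chart_move_smooth_family:
  assumes cA: "c \<in> A" and K: "compact K" "K \<subseteq> Dom c" and H: "chart_deformation c K H"
  shows "compactin X (Proj c ` K)" "\<And>x t. x \<notin> Proj c ` K \<Longrightarrow> t \<in> {0..1} \<Longrightarrow> chart_move c H (x, t) = x"
    "smooth_family X A (chart_move c H)"
proof -
  note c = atlas_chart[OF orb cA]
  have "compactin (top_of_set (Dom c)) K" using K by (simp add: compactin_subtopology)
  then show cK: "compactin X (Proj c ` K)" using image_compactin[OF _ chart_Proj(1)[OF c]] by blast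
  have K_closed: "closedin X (Proj c ` K)"
    by (rule compactin_imp_closedin[OF orbifold_Hausdorff[OF orb] cK])
  show out: "chart_move c H (x, t) = x" if x: "x \<notin> Proj c ` K" and t: "t \<in> {0..1}" for x t
  proof (cases "x \<in> chart_image c")
    case True
    then obtain s where s: "s \<in> Dom c" "x = Proj c s" by (auto simp: chart_image_def)
    then have "s \<in> Dom c - K" using x by blast
    then have "H (s, t) = s" using H t unfolding chart_deformation_def by blast
    then show ?thesis using chart_move_Proj[OF c H s(1) t] s(2) by simp
  qed (rule chart_move_outside)
  show "smooth_family X A (chart_move c H)"
  proof (rule smooth_familyI[OF orb])
    fix x t assume x: "x \<in> topspace X" and t: "t \<in> {0..1::real}"
    show "\<exists>c'\<in>A. \<exists>u\<in>Dom c'. Proj c' u = x \<and>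
       (\<exists>I. time_nbhd t I \<and> (\<exists>d\<in>A. \<exists>h. local_lift c' d (chart_move c H) (Dom c') I h))"
    proof (cases "x \<in> chart_image c")
      case True
      then obtain u where u: "u \<in> Dom c" "Proj c u = x" by (auto simp: chart_image_def)
      have "local_lift c c (chart_move c H) (Dom c) {0..1} H"
        unfolding local_lift_def
      proof (intro conjI ballI)
        fix s \<tau> assume "s \<in> Dom c" "\<tau> \<in> {0..1::real}"
        then show "Proj c (H (s, \<tau>)) = chart_move c H (Proj c s, \<tau>)"
          by (rule chart_move_Proj[OF c H, symmetric])
      qed (use H in \<open>auto simp: chart_deformation_def\<close>)
      then show ?thesis using cA u time_nbhd_full[OF t] by blast
    next
      case False
      obtain b u where b: "b \<in> A" "u \<in> Dom b" "Proj b u = x" by (rule atlas_lift[OF orb x]) (erule that; assumption)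
      note bc = atlas_chart[OF orb b(1)]
      define N where "N = {s \<in> Dom b. Proj b s \<in> topspace X - Proj c ` K}"
      have "openin X (topspace X - Proj c ` K)" using K_closed by (simp add: closedin_def)
      then have "openin (top_of_set (Dom b)) N"
        using chart_Proj(1)[OF bc] unfolding continuous_map_def N_def by auto
      then have N: "openin (top_of_set E) N" using chart_Dom(1)[OF bc] openin_trans by blast
      have uN: "u \<in> N"
        using b x False K(2) unfolding N_def by (auto simp: chart_image_def)
      obtain b' where b': "b' \<in> A" "u \<in> Dom b'" "Dom b' \<subseteq> N" "Dom b' \<subseteq> Dom b" "Proj b' = Proj b"
        "Grp b' = (\<lambda>\<gamma>. restrict \<gamma> (Dom b')) ` {\<gamma> \<in> Grp b. \<gamma> u = u}"
        by (rule atlas_restrict[OF orb b(1,2) N uN]) (erule that; assumption)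
      have "local_lift b' b' (chart_move c H) (Dom b') {0..1} fst"
        unfolding local_lift_def
      proof (intro conjI ballI)
        show "smooth_on fst (Dom b' \<times> {0..1::real})" by (rule smooth_on_linear[OF linear_fst])
        fix s \<tau> assume s: "s \<in> Dom b'" and \<tau>: "\<tau> \<in> {0..1::real}"
        have "Proj b s \<notin> Proj c ` K" using s b'(3) unfolding N_def by blast
        from out[OF this \<tau>] show "Proj b' (fst (s, \<tau>)) = chart_move c H (Proj b' s, \<tau>)"
          by (simp add: b'(5))
      qed auto
      moreover have "Proj b' u = x" using b(3) b'(5) by simp
      ultimately show ?thesis using b'(1,2) time_nbhd_full[OF t] by blast
    qed
  qed
qed

text \<open>The singular dimension is preserved because an equivariant injective map preserves stabilizers,
  which determine it in a linear chart.\<close>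

lemma chart_move_isotopy_pair:
  assumes cA: "c \<in> A" and lc: "linear_chart E c \<L>" and K: "compact K" "K \<subseteq> Dom c"
    and H: "chart_deformation c K H" and H': "chart_deformation c K H'"
    and inv: "\<And>s t. s \<in> Dom c \<Longrightarrow> t \<in> {0..1} \<Longrightarrow> H' (H (s, t), t) = s"
      "\<And>s t. s \<in> Dom c \<Longrightarrow> t \<in> {0..1} \<Longrightarrow> H (H' (s, t), t) = s"
    and zero: "\<And>s. s \<in> Dom c \<Longrightarrow> H (s, 0) = s"
  shows "isotopy_pair E X A (chart_move c H) (chart_move c H')"
proof -
  note c = atlas_chart[OF orb cA]
  note m = chart_move_Proj[OF c H] and m' = chart_move_Proj[OF c H']
  note sm = chart_move_smooth_family[OF cA K H] and sm' = chart_move_smooth_family[OF cA K H']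
  have inD: "H (s, t) \<in> Dom c" "H' (s, t) \<in> Dom c" if "s \<in> Dom c" "t \<in> {0..1}" for s t
    using H H' that unfolding chart_deformation_def by auto
  have sd: "sdim E A (Proj c (H (s, t))) = sdim E A (Proj c s)" if s: "s \<in> Dom c" and t: "t \<in> {0..1}" for s t
  proof -
    have "L (H (s, t)) = H (s, t) \<longleftrightarrow> L s = s" if L: "L \<in> \<L>" for L
    proof -
      have g: "restrict L (Dom c) \<in> Grp c" using lc L by (auto simp: linear_chart_def)
      then have "H (L s, t) = L (H (s, t))"
        using H s t inD(1)[OF s t] unfolding chart_deformation_def by fastforce
      moreover have "L s \<in> Dom c" using chart_in[OF c g s] s by simp
      ultimately show ?thesis using inv(1)[OF s t] inv(1)[OF _ t, of "L s"] by metis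
    qed
    then have "{L \<in> \<L>. L (H (s, t)) = H (s, t)} = {L \<in> \<L>. L s = s}" by blast
    then show ?thesis
      using linear_chart_sdim[OF orb cA lc s] linear_chart_sdim[OF orb cA lc inD(1)[OF s t]] by simp
  qed
  have io: "x \<in> chart_image c \<Longrightarrow> \<exists>s\<in>Dom c. x = Proj c s" for x by (auto simp: chart_image_def)
  show ?thesis
    unfolding isotopy_pair_def
  proof (intro conjI ballI exI[of _ "Proj c ` K"] sm(1,3) sm'(3))
    fix x t assume t: "t \<in> {0..1::real}"
    show "chart_move c H' (chart_move c H (x, t), t) = x"
    proof (cases "x \<in> chart_image c")
      case True
      then obtain s where "s \<in> Dom c" "x = Proj c s" using io by blast
      then show ?thesis using m m' inD inv t by simp
    qed (simp add: chart_move_outside)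
    show "chart_move c H (chart_move c H' (x, t), t) = x"
    proof (cases "x \<in> chart_image c")
      case True
      then obtain s where "s \<in> Dom c" "x = Proj c s" using io by blast
      then show ?thesis using m m' inD inv t by simp
    qed (simp add: chart_move_outside)
    show "sdim E A (chart_move c H (x, t)) = sdim E A x"
    proof (cases "x \<in> chart_image c")
      case True
      then obtain s where "s \<in> Dom c" "x = Proj c s" using io by blast
      then show ?thesis using m sd t by simp
    qed (simp add: chart_move_outside)
  next
    fix x
    show "chart_move c H (x, 0) = x"
    proof (cases "x \<in> chart_image c")
      case True
      then obtain s where "s \<in> Dom c" "x = Proj c s" using io by blast
      then show ?thesis using m[of s 0] zero by simp
    qed (simp add: chart_move_outside)
  next
    fix x t assume "x \<in> topspace X - Proj c ` K" "t \<in> {0..1::real}"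
    then show "chart_move c H (x, t) = x" using sm(2) by blast
  qed
qed

end

lemma bump_le_1: "bump r x \<le> 1"
  by (simp add: bump_def flat_exp_def)

lemma bump_lipschitz:
  assumes r: "r > 0"
  obtains a where "a \<ge> 0" "\<And>x y :: 'a::euclidean_space. \<bar>bump r x - bump r y\<bar> \<le> a * norm (x - y)"
proof -
  define g where "g = (\<lambda>x::'a. \<Sum>b\<in>Basis. norm (frechet_derivative (bump r) (at x) b))"
  have "continuous_on UNIV g"
    unfolding g_def by (intro continuous_intros Cinf_on_continuous Cinf_on_derivative Cinf_on_bump)
  then have "compact (g ` cball 0 (r + 1))"
    by (intro compact_continuous_image compact_cball) (auto intro: continuous_on_subset)
  then obtain B where B: "\<And>y. y \<in> g ` cball 0 (r + 1) \<Longrightarrow> norm y \<le> B"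
    using compact_imp_bounded bounded_iff by metis
  define a where "a = max B 0"
  have ga: "g x \<le> a" for x
  proof (cases "norm x \<le> r + 1")
    case True
    then have "norm (g x) \<le> B" by (intro B) auto
    then show ?thesis by (simp add: a_def)
  next
    case False
    have op: "open {y::'a. r < norm y}" by (intro open_Collect_less continuous_intros)
    have "(bump r has_derivative (\<lambda>v. 0)) (at x)"
      by (rule has_derivative_transform_within_open[OF has_derivative_const op, of x 0])
         (use False r in \<open>auto simp: bump_eq_0\<close>)
    then have "frechet_derivative (bump r) (at x) = (\<lambda>v. 0)" using frechet_derivative_at by fastforce
    then show ?thesis by (simp add: g_def a_def)
  qed
  have "norm (bump r x - bump r y) \<le> a * norm (x - y)" for x y :: 'a
    by (rule Cinf_on_lipschitz[OF Cinf_on_bump convex_UNIV]) (use ga in \<open>auto simp: g_def\<close>)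
  then show ?thesis using that[of a] by (simp add: a_def)
qed

text \<open>The maps \<open>s \<mapsto> s + t \<rho>(s) w\<close> with small \<open>w\<close> are diffeomorphisms, smoothly in \<open>t\<close>: together they
  differ from the identity of the product by a map of small Lipschitz constant, and a preimage is
  found on the line in direction \<open>w\<close> by the intermediate value theorem. Times slightly outside the
  unit interval are included to have an open domain.\<close>

lemma push_smooth_inverse:
  fixes \<rho> :: "'e::euclidean_space \<Rightarrow> real"
  assumes \<rho>: "Cinf_on \<rho> UNIV" "\<And>x y. \<bar>\<rho> x - \<rho> y\<bar> \<le> a * norm (x - y)" "\<And>x. 0 \<le> \<rho> x" "\<And>x. \<rho> x \<le> B"
    and w: "(2 * a + B) * norm w \<le> 1/2" and a: "a \<ge> 0"
  obtains H' where "Cinf_on H' (UNIV \<times> {-2<..<2})"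
    "\<And>y t. t \<in> {-2<..<2} \<Longrightarrow> \<exists>r. H' (y, t) = y + r *\<^sub>R w"
    "\<And>y t. t \<in> {-2<..<2} \<Longrightarrow> H' (y, t) + (t * \<rho> (H' (y, t))) *\<^sub>R w = y"
    "\<And>s t. t \<in> {-2<..<2} \<Longrightarrow> H' (s + (t * \<rho> s) *\<^sub>R w, t) = s"
proof -
  define U :: "('e \<times> real) set" where "U = UNIV \<times> {-2<..<2}"
  define f :: "'e \<times> real \<Rightarrow> 'e \<times> real" where "f = (\<lambda>p. (fst p + (snd p * \<rho> (fst p)) *\<^sub>R w, snd p))"
  have U: "open U" unfolding U_def by (intro open_Times) auto
  have B: "B \<ge> 0" using \<rho>(3,4) order_trans by blast
  have \<rho>f: "Cinf_on (\<lambda>p::'e\<times>real. \<rho> (fst p)) U"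
    by (rule Cinf_on_compose[OF U open_UNIV Cinf_on_fst[OF U] \<rho>(1)]) simp
  have f: "Cinf_on f U"
    unfolding f_def
    by (intro Cinf_on_Pair Cinf_on_add Cinf_on_scaleR Cinf_on_mult Cinf_on_const Cinf_on_fst Cinf_on_snd U \<rho>f)
  have lip: "norm ((f p - p) - (f q - q)) \<le> 1/2 * norm (p - q)" if pq: "p \<in> U" "q \<in> U" for p q
  proof -
    obtain s t s' t' where e: "p = (s, t)" "q = (s', t')" by fastforce
    have t: "\<bar>t\<bar> \<le> 2" using pq(1) by (auto simp: e U_def)
    have n1: "norm (s - s') \<le> norm (p - q)" and n2: "\<bar>t - t'\<bar> \<le> norm (p - q)"
      using norm_fst_le[of "s - s'" "t - t'"] norm_snd_le[of "t - t'" "s - s'"] by (auto simp: e)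
    have "t * \<rho> s - t' * \<rho> s' = t * (\<rho> s - \<rho> s') + (t - t') * \<rho> s'" by (simp add: algebra_simps)
    then have "\<bar>t * \<rho> s - t' * \<rho> s'\<bar> \<le> \<bar>t\<bar> * \<bar>\<rho> s - \<rho> s'\<bar> + \<bar>t - t'\<bar> * \<bar>\<rho> s'\<bar>"
      by (metis abs_mult abs_triangle_ineq)
    also have "\<dots> \<le> 2 * (a * norm (p - q)) + norm (p - q) * B"
    proof (intro add_mono mult_mono)
      show "\<bar>\<rho> s - \<rho> s'\<bar> \<le> a * norm (p - q)"
        using \<rho>(2)[of s s'] mult_left_mono[OF n1 a] by linarith
      show "\<bar>\<rho> s'\<bar> \<le> B" using \<rho>(3,4)[of s'] by simp
    qed (use t n2 a in auto)
    finally have "\<bar>t * \<rho> s - t' * \<rho> s'\<bar> \<le> (2 * a + B) * norm (p - q)" by (simp add: algebra_simps)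
    then have "\<bar>t * \<rho> s - t' * \<rho> s'\<bar> * norm w \<le> ((2 * a + B) * norm (p - q)) * norm w"
      by (rule mult_right_mono) simp
    also have "\<dots> = ((2 * a + B) * norm w) * norm (p - q)" by (simp add: algebra_simps)
    also have "\<dots> \<le> 1/2 * norm (p - q)" by (rule mult_right_mono[OF w]) simp
    finally have "\<bar>t * \<rho> s - t' * \<rho> s'\<bar> * norm w \<le> 1/2 * norm (p - q)" .
    moreover have "(f p - p) - (f q - q) = ((t * \<rho> s - t' * \<rho> s') *\<^sub>R w, 0)"
      by (simp add: f_def e algebra_simps)
    ultimately show ?thesis by (simp add: norm_Pair)
  qed
  note inj = near_id_smooth_inverse(1)[OF U f lip] and sm = near_id_smooth_inverse(3)[OF U f lip]
  define g where "g = the_inv_into U f"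
  have gf: "g (f p) = p" if "p \<in> U" for p unfolding g_def by (rule the_inv_into_f_f[OF inj that])
  have line: "\<exists>r. f (y + r *\<^sub>R w, t) = (y, t)" for y t
  proof -
    define \<phi> where "\<phi> = (\<lambda>r. r - t * \<rho> (y - r *\<^sub>R w))"
    have c\<rho>: "continuous_on UNIV \<rho>" using \<rho>(1) by (rule Cinf_on_continuous)
    have c\<phi>: "continuous_on {- \<bar>t\<bar> * B .. \<bar>t\<bar> * B} \<phi>"
      unfolding \<phi>_def by (intro continuous_intros continuous_on_compose2[OF c\<rho>]) auto
    have b: "\<bar>t * \<rho> z\<bar> \<le> \<bar>t\<bar> * B" for z
      using mult_left_mono[OF \<rho>(4)[of z], of "\<bar>t\<bar>"] \<rho>(3)[of z] by (simp add: abs_mult)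
    have "\<phi> (- \<bar>t\<bar> * B) \<le> 0" "0 \<le> \<phi> (\<bar>t\<bar> * B)"
      using b[of "y - (- \<bar>t\<bar> * B) *\<^sub>R w"] b[of "y - (\<bar>t\<bar> * B) *\<^sub>R w"] unfolding \<phi>_def abs_le_iff by linarith+
    moreover have "- \<bar>t\<bar> * B \<le> \<bar>t\<bar> * B" using B by simp
    ultimately obtain r where "\<phi> r = 0" using IVT'[OF _ _ _ c\<phi>] by metis
    then have "f (y + (- r) *\<^sub>R w, t) = (y, t)" by (simp add: f_def \<phi>_def)
    then show ?thesis by blast
  qed
  have fU: "f ` U = U"
  proof
    show "f ` U \<subseteq> U" by (auto simp: f_def U_def)
    show "U \<subseteq> f ` U"
    proof
      fix p assume p: "p \<in> U"
      obtain y t where e: "p = (y, t)" by fastforce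
      obtain r where r: "f (y + r *\<^sub>R w, t) = (y, t)" using line by blast
      have "(y + r *\<^sub>R w, t) \<in> U" using p by (auto simp: e U_def)
      then show "p \<in> f ` U" using r e by (metis imageI)
    qed
  qed
  define H' where "H' = (\<lambda>p. fst (g p))"
  have key: "\<exists>r. g (y, t) = (y + r *\<^sub>R w, t) \<and> f (y + r *\<^sub>R w, t) = (y, t)" if t: "t \<in> {-2<..<2}" for y t
  proof -
    obtain r where r: "f (y + r *\<^sub>R w, t) = (y, t)" using line by blast
    have "(y + r *\<^sub>R w, t) \<in> U" using t by (simp add: U_def)
    from gf[OF this] r show ?thesis by auto
  qed
  show ?thesis
  proof (rule that[of H'])
    have gC: "Cinf_on g U" using sm unfolding g_def fU .
    show "Cinf_on H' (UNIV \<times> {-2<..<2})"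
      unfolding H'_def U_def[symmetric]
      by (rule Cinf_on_compose[OF U open_UNIV gC Cinf_on_fst[OF open_UNIV]]) simp
    fix y :: 'e and t :: real assume t: "t \<in> {-2<..<2}"
    obtain r where r: "g (y, t) = (y + r *\<^sub>R w, t)" "f (y + r *\<^sub>R w, t) = (y, t)" using key[OF t] by blast
    then show "\<exists>r. H' (y, t) = y + r *\<^sub>R w" by (auto simp: H'_def)
    show "H' (y, t) + (t * \<rho> (H' (y, t))) *\<^sub>R w = y" using r by (simp add: H'_def f_def)
    have "(y, t) \<in> U" using t by (simp add: U_def)
    from gf[OF this] show "H' (y + (t * \<rho> y) *\<^sub>R w, t) = y" by (simp add: H'_def f_def)
  qed
qed

context
  fixes E :: "'e::euclidean_space set" and X :: "'a topology" and A :: "('e, 'a) orb_chart set"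
  assumes orb: "orbifold E X A"
begin

text \<open>A vector fixed by the linear group is pushed along a translation cut off by an invariant
  bump function, namely a bump averaged over the group.\<close>

lemma linear_chart_push:
  assumes cA: "c \<in> A" and lc: "linear_chart E c \<L>"
  obtains \<epsilon> where "\<epsilon> > 0"
    "\<forall>w\<in>fixed_subspace E \<L>. norm w < \<epsilon> \<longrightarrow> w \<in> Dom c \<and> (\<exists>F F'. isotopy_pair E X A F F' \<and>
       F (Proj c 0, 1) = Proj c w \<and> (\<forall>x\<in>topspace X - chart_image c. \<forall>t\<in>{0..1}. F (x, t) = x))"
proof -
  note c = atlas_chart[OF orb cA] and E = orbifold_subspace[OF orb]
  define D where "D = Dom c"
  define G where "G = Grp c"
  have D0: "0 \<in> D" and oD: "openin (top_of_set E) D" and DE: "D \<subseteq> E"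
    using lc chart_Dom[OF c] by (auto simp: linear_chart_def D_def)
  have GL: "G = (\<lambda>L. restrict L D) ` \<L>" and linL: "\<And>L. L \<in> \<L> \<Longrightarrow> linear L" and LE: "\<And>L v. L \<in> \<L> \<Longrightarrow> v \<in> E \<Longrightarrow> L v \<in> E"
    using lc by (auto simp: linear_chart_def D_def G_def)
  have finG: "finite G" using chart_Grp(1)[OF c] by (simp add: G_def)
  have idG: "(\<lambda>x\<in>D. x) \<in> G" using chart_id[OF c] by (simp add: G_def D_def)
  have inD: "\<gamma> s \<in> D" if "\<gamma> \<in> G" "s \<in> D" for \<gamma> s using chart_in[OF c] that by (auto simp: G_def D_def)
  have "\<exists>L. L \<in> \<L> \<and> restrict L D = \<gamma>" if g: "\<gamma> \<in> G" for \<gamma> using g unfolding GL by blast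
  then obtain \<Lambda> where \<Lambda>: "\<And>\<gamma>. \<gamma> \<in> G \<Longrightarrow> \<Lambda> \<gamma> \<in> \<L>" "\<And>\<gamma>. \<gamma> \<in> G \<Longrightarrow> restrict (\<Lambda> \<gamma>) D = \<gamma>" by metis
  have \<Lambda>D: "\<Lambda> \<gamma> s = \<gamma> s" if "\<gamma> \<in> G" "s \<in> D" for \<gamma> s
    using \<Lambda>(2)[OF that(1)] that(2) by (metis restrict_apply')
  obtain R where R: "R > 0" "cball 0 R \<inter> E \<subseteq> D"
    using oD D0 unfolding openin_contains_cball by blast
  \<comment> \<open>By scaling into \<open>D\<close>, the linear extensions of inverse group elements are inverse to each other on
    all of \<open>E\<close>. Hence a point of \<open>E\<close> outside \<open>D\<close> is not mapped into \<open>D\<close>, and \<open>\<beta>\<close> below vanishes there.\<close>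
  have retract: "s \<in> D" if g: "\<gamma> \<in> G" and s: "s \<in> E" "\<Lambda> \<gamma> s \<in> D" for \<gamma> s
  proof -
    obtain \<delta> where d: "\<delta> \<in> Grp c" "\<And>u. u \<in> Dom c \<Longrightarrow> \<delta> (\<gamma> u) = u" "\<And>u. u \<in> Dom c \<Longrightarrow> \<gamma> (\<delta> u) = u"
      by (rule chart_inverse[OF c g[unfolded G_def]]) (erule that; blast)
    have dG: "\<delta> \<in> G" using d(1) by (simp add: G_def)
    define \<tau> where "\<tau> = R / (norm s + 1)"
    have \<tau>: "\<tau> > 0" using R(1) by (simp add: \<tau>_def add_nonneg_pos)
    have "norm (\<tau> *\<^sub>R s) \<le> R"
    proof -
      have "norm (\<tau> *\<^sub>R s) = R * (norm s / (norm s + 1))" using R(1) by (simp add: \<tau>_def)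
      also have "\<dots> \<le> R * 1" using R(1) by (intro mult_left_mono) (auto simp: divide_le_eq_1 add_nonneg_pos)
      finally show ?thesis by simp
    qed
    then have ts: "\<tau> *\<^sub>R s \<in> D" using R(2) subspace_scale[OF E s(1)] by auto
    have "\<Lambda> \<delta> (\<Lambda> \<gamma> (\<tau> *\<^sub>R s)) = \<tau> *\<^sub>R s"
      using \<Lambda>D[OF g ts] \<Lambda>D[OF dG inD[OF g ts]] d(2) ts by (simp add: D_def)
    then have "\<tau> *\<^sub>R \<Lambda> \<delta> (\<Lambda> \<gamma> s) = \<tau> *\<^sub>R s"
      by (simp add: linear_cmul[OF linL[OF \<Lambda>(1)[OF g]]] linear_cmul[OF linL[OF \<Lambda>(1)[OF dG]]])
    then have "s = \<Lambda> \<delta> (\<Lambda> \<gamma> s)" using \<tau> by simp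
    also have "\<dots> = \<delta> (\<Lambda> \<gamma> s)" by (rule \<Lambda>D[OF dG s(2)])
    finally show ?thesis using inD[OF dG s(2)] by simp
  qed
  \<comment> \<open>The sum runs over the group and not over \<open>\<L>\<close>, in which a group element can have several linear
    extensions; only the former sum is permuted by translations.\<close>
  define \<beta> where "\<beta> = (\<lambda>s. \<Sum>\<gamma>\<in>G. bump R (\<Lambda> \<gamma> s))"
  have \<beta>C: "Cinf_on \<beta> UNIV"
    unfolding \<beta>_def
  proof (rule Cinf_on_sum[OF open_UNIV])
    fix \<gamma> assume "\<gamma> \<in> G"
    then show "Cinf_on (\<lambda>s. bump R (\<Lambda> \<gamma> s)) UNIV"
      by (intro Cinf_on_compose[OF open_UNIV open_UNIV Cinf_on_linear[OF open_UNIV linL[OF \<Lambda>(1)]] Cinf_on_bump]) auto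
  qed
  have \<beta>nn: "0 \<le> \<beta> s" for s unfolding \<beta>_def by (intro sum_nonneg bump_nonneg)
  have \<beta>le: "\<beta> s \<le> real (card G)" for s
    unfolding \<beta>_def using sum_mono[of G "\<lambda>\<gamma>. bump R (\<Lambda> \<gamma> s)" "\<lambda>_. 1"] by (simp add: bump_le_1)
  have \<beta>0: "\<beta> 0 > 0"
  proof -
    have "bump R (\<Lambda> \<gamma> 0) > 0" if "\<gamma> \<in> G" for \<gamma>
      using linear_0[OF linL[OF \<Lambda>(1)[OF that]]] bump_0_pos[OF R(1)] by simp
    then show ?thesis unfolding \<beta>_def using finG idG by (intro sum_pos) auto
  qed
  have \<beta>inv: "\<beta> (\<delta> s) = \<beta> s" if dl: "\<delta> \<in> G" and s: "s \<in> D" for \<delta> s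
  proof -
    have "\<beta> (\<delta> s) = (\<Sum>\<gamma>\<in>G. bump R (\<gamma> (\<delta> s)))"
      unfolding \<beta>_def by (rule sum.cong[OF refl]) (simp add: \<Lambda>D[OF _ inD[OF dl s]])
    also have "\<dots> = (\<Sum>\<gamma>\<in>G. bump R (compose D \<gamma> \<delta> s))" using s by (simp add: compose_def)
    also have "\<dots> = (\<Sum>\<gamma>\<in>G. bump R (\<gamma> s))"
      by (rule sum.reindex_bij_betw[OF chart_right_translation[OF c dl[unfolded G_def], folded G_def D_def]])
    also have "\<dots> = \<beta> s" unfolding \<beta>_def by (rule sum.cong[OF refl]) (simp add: \<Lambda>D[OF _ s])
    finally show ?thesis .
  qed
  define K where "K = (\<Union>\<gamma>\<in>G. \<gamma> ` (cball 0 R \<inter> E))"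
  have "compact (\<gamma> ` (cball 0 R \<inter> E))" if "\<gamma> \<in> G" for \<gamma>
  proof (rule compact_continuous_image)
    have "smooth_on \<gamma> D" using chart_Grp(3)[OF c] that by (simp add: G_def D_def)
    then show "continuous_on (cball 0 R \<inter> E) \<gamma>"
      using smooth_on_continuous R(2) continuous_on_subset by blast
    show "compact (cball 0 R \<inter> E)" by (intro compact_Int_closed compact_cball closed_subspace[OF E])
  qed
  then have cK: "compact K" unfolding K_def using finG by (intro compact_UN) auto
  have KD: "K \<subseteq> Dom c" using R(2) inD unfolding K_def by (force simp: D_def)
  have supp: "s \<in> D \<and> s \<in> K" if s: "s \<in> E" "\<beta> s \<noteq> 0" for s
  proof -
    obtain \<gamma> where g: "\<gamma> \<in> G" "bump R (\<Lambda> \<gamma> s) \<noteq> 0"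
      using s(2) unfolding \<beta>_def by (meson sum.not_neutral_contains_not_neutral)
    have n: "norm (\<Lambda> \<gamma> s) < R" using bump_eq_0[OF R(1), of "\<Lambda> \<gamma> s"] g(2) by linarith
    then have i: "\<Lambda> \<gamma> s \<in> cball 0 R \<inter> E" using LE[OF \<Lambda>(1)[OF g(1)] s(1)] by simp
    then have sD: "s \<in> D" using retract[OF g(1) s(1)] R(2) by blast
    obtain \<delta> where d: "\<delta> \<in> Grp c" "\<And>u. u \<in> Dom c \<Longrightarrow> \<delta> (\<gamma> u) = u" "\<And>u. u \<in> Dom c \<Longrightarrow> \<gamma> (\<delta> u) = u"
      by (rule chart_inverse[OF c g(1)[unfolded G_def]]) (erule that; blast)
    have "s = \<delta> (\<Lambda> \<gamma> s)" using \<Lambda>D[OF g(1) sD] d(2) sD by (simp add: D_def)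
    then have "s \<in> \<delta> ` (cball 0 R \<inter> E)" using i by (rule image_eqI)
    then show ?thesis using sD d(1) unfolding K_def G_def by blast
  qed
  obtain a0 where a0: "a0 \<ge> 0" "\<And>x y :: 'e. \<bar>bump R x - bump R y\<bar> \<le> a0 * norm (x - y)"
    using bump_lipschitz[OF R(1)] by metis
  define M where "M = (\<Sum>\<gamma>\<in>G. a0 * onorm (\<Lambda> \<gamma>))"
  have bl: "bounded_linear (\<Lambda> \<gamma>)" if "\<gamma> \<in> G" for \<gamma>
    using linL[OF \<Lambda>(1)[OF that]] linear_conv_bounded_linear by blast
  have M: "M \<ge> 0" unfolding M_def using a0(1) onorm_pos_le[OF bl] by (intro sum_nonneg) auto
  have \<beta>lip: "\<bar>\<beta> x - \<beta> y\<bar> \<le> M * norm (x - y)" for x y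
  proof -
    have "\<bar>\<beta> x - \<beta> y\<bar> \<le> (\<Sum>\<gamma>\<in>G. \<bar>bump R (\<Lambda> \<gamma> x) - bump R (\<Lambda> \<gamma> y)\<bar>)"
      unfolding \<beta>_def sum_subtractf[symmetric] by (rule sum_abs)
    also have "\<dots> \<le> (\<Sum>\<gamma>\<in>G. a0 * onorm (\<Lambda> \<gamma>) * norm (x - y))"
    proof (rule sum_mono)
      fix \<gamma> assume g: "\<gamma> \<in> G"
      have "\<bar>bump R (\<Lambda> \<gamma> x) - bump R (\<Lambda> \<gamma> y)\<bar> \<le> a0 * norm (\<Lambda> \<gamma> x - \<Lambda> \<gamma> y)" by (rule a0(2))
      also have "\<dots> = a0 * norm (\<Lambda> \<gamma> (x - y))" by (simp add: linear_diff[OF linL[OF \<Lambda>(1)[OF g]]])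
      also have "\<dots> \<le> a0 * (onorm (\<Lambda> \<gamma>) * norm (x - y))" by (rule mult_left_mono[OF onorm[OF bl[OF g]] a0(1)])
      finally show "\<bar>bump R (\<Lambda> \<gamma> x) - bump R (\<Lambda> \<gamma> y)\<bar> \<le> a0 * onorm (\<Lambda> \<gamma>) * norm (x - y)" by (simp add: mult.assoc)
    qed
    also have "\<dots> = M * norm (x - y)" by (simp add: M_def sum_distrib_right)
    finally show ?thesis .
  qed
  define \<rho> where "\<rho> = (\<lambda>s. \<beta> s / \<beta> 0)"
  define a where "a = M / \<beta> 0"
  define B where "B = real (card G) / \<beta> 0"
  have a: "a \<ge> 0" and B: "B \<ge> 0" using M \<beta>0 by (auto simp: a_def B_def)
  have \<rho>C: "Cinf_on \<rho> UNIV"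
    using Cinf_on_mult[OF open_UNIV \<beta>C Cinf_on_const[OF open_UNIV, of "inverse (\<beta> 0)"]]
    by (simp add: \<rho>_def divide_inverse)
  have \<rho>lip: "\<bar>\<rho> x - \<rho> y\<bar> \<le> a * norm (x - y)" for x y
    using divide_right_mono[OF \<beta>lip[of x y], of "\<beta> 0"] \<beta>0
    by (simp add: \<rho>_def a_def diff_divide_distrib[symmetric])
  have \<rho>nn: "0 \<le> \<rho> x" for x using \<beta>nn[of x] \<beta>0 by (simp add: \<rho>_def)
  have \<rho>le: "\<rho> x \<le> B" for x using divide_right_mono[OF \<beta>le[of x]] \<beta>0 by (simp add: \<rho>_def B_def)
  have \<rho>supp: "s \<in> D \<and> s \<in> K" if "s \<in> E" "\<rho> s \<noteq> 0" for s using supp that by (auto simp: \<rho>_def)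
  define \<epsilon> where "\<epsilon> = min R (1 / (2 * (2 * a + B) + 1))"
  have \<epsilon>: "\<epsilon> > 0" using R(1) a B by (simp add: \<epsilon>_def add_nonneg_pos)
  have "w \<in> Dom c \<and> (\<exists>F F'. isotopy_pair E X A F F' \<and>
       F (Proj c 0, 1) = Proj c w \<and> (\<forall>x\<in>topspace X - chart_image c. \<forall>t\<in>{0..1}. F (x, t) = x))"
    if wV: "w \<in> fixed_subspace E \<L>" and wn: "norm w < \<epsilon>" for w
  proof -
    have wE: "w \<in> E" and wL: "\<And>L. L \<in> \<L> \<Longrightarrow> L w = w" using wV by (auto simp: fixed_subspace_def)
    have wD: "w \<in> D" using R(2) wE wn by (auto simp: \<epsilon>_def)
    have small: "(2 * a + B) * norm w \<le> 1/2"
    proof -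
      have "norm w \<le> 1 / (2 * (2 * a + B) + 1)" using wn by (simp add: \<epsilon>_def)
      then have "(2 * a + B) * norm w \<le> (2 * a + B) * (1 / (2 * (2 * a + B) + 1))"
        using a B by (intro mult_left_mono) auto
      also have "\<dots> \<le> 1/2" using a B by (simp add: field_simps)
      finally show ?thesis .
    qed
    obtain H' where H': "Cinf_on H' (UNIV \<times> {-2<..<2})"
      "\<And>y t. t \<in> {-2<..<2} \<Longrightarrow> \<exists>r. H' (y, t) = y + r *\<^sub>R w"
      "\<And>y t. t \<in> {-2<..<2} \<Longrightarrow> H' (y, t) + (t * \<rho> (H' (y, t))) *\<^sub>R w = y"
      "\<And>s t. t \<in> {-2<..<2} \<Longrightarrow> H' (s + (t * \<rho> s) *\<^sub>R w, t) = s"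
      using push_smooth_inverse[OF \<rho>C \<rho>lip \<rho>nn \<rho>le small a] by metis
    define H where "H = (\<lambda>p. fst p + (snd p * \<rho> (fst p)) *\<^sub>R w)"
    have H: "H (s, t) = s + (t * \<rho> s) *\<^sub>R w" for s t by (simp add: H_def)
    have t2: "t \<in> {-2<..<2}" if "t \<in> {0..1}" for t :: real using that by auto
    have H'H: "H' (H (s, t), t) = s" and HH': "H (H' (s, t), t) = s" if "t \<in> {0..1}" for s t
      using H'(3,4)[OF t2[OF that]] by (auto simp: H)
    have stay: "H (s, t) = s" if "s \<in> E" "s \<notin> D \<or> s \<notin> K" for s t
      using \<rho>supp[OF that(1)] that(2) by (auto simp: H)
    have HE: "H (s, t) \<in> E" if "s \<in> E" for s t
      unfolding H by (intro subspace_add[OF E] subspace_scale[OF E] that wE)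
    have H'E: "H' (s, t) \<in> E" if s: "s \<in> E" and t: "t \<in> {0..1}" for s t
    proof -
      obtain r where "H' (s, t) = s + r *\<^sub>R w" using H'(2)[OF t2[OF t]] by blast
      then show ?thesis using subspace_add[OF E s subspace_scale[OF E wE]] by simp
    qed
    have HD: "H (s, t) \<in> D" if s: "s \<in> D" and t: "t \<in> {0..1}" for s t
    proof (rule ccontr)
      assume n: "H (s, t) \<notin> D"
      have "H (s, t) \<in> E" using HE s DE by blast
      then have "H (H (s, t), t) = H (s, t)" using stay n by blast
      then have "H (s, t) = s" using H'H[OF t] by metis
      then show False using n s by simp
    qed
    have H'D: "H' (s, t) \<in> D" if s: "s \<in> D" and t: "t \<in> {0..1}" for s t
    proof (rule ccontr)
      assume n: "H' (s, t) \<notin> D"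
      have "H' (s, t) \<in> E" using H'E s t DE by blast
      then have "H (H' (s, t), t) = H' (s, t)" using stay n by blast
      then show False using HH'[OF t, of s] n s by simp
    qed
    have eqv: "H (\<gamma> s, t) = \<gamma> (H (s, t))" if g: "\<gamma> \<in> G" and s: "s \<in> D" and t: "t \<in> {0..1}" for \<gamma> s t
    proof -
      note l = linL[OF \<Lambda>(1)[OF g]]
      have "\<gamma> (H (s, t)) = \<Lambda> \<gamma> (H (s, t))" by (rule \<Lambda>D[OF g HD[OF s t], symmetric])
      also have "\<dots> = \<Lambda> \<gamma> s + (t * \<rho> s) *\<^sub>R w"
        unfolding H by (simp add: linear_add[OF l] linear_cmul[OF l] wL[OF \<Lambda>(1)[OF g]])
      also have "\<dots> = H (\<gamma> s, t)" using \<Lambda>D[OF g s] \<beta>inv[OF g s] by (simp add: H \<rho>_def)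
      finally show ?thesis by simp
    qed
    have eqv': "H' (\<gamma> s, t) = \<gamma> (H' (s, t))" if g: "\<gamma> \<in> G" and s: "s \<in> D" and t: "t \<in> {0..1}" for \<gamma> s t
    proof -
      have "H (\<gamma> (H' (s, t)), t) = \<gamma> s" using eqv[OF g H'D[OF s t] t] HH'[OF t] by simp
      then show ?thesis using H'H[OF t] by metis
    qed
    have smH: "smooth_on H (D \<times> {0..1})"
    proof (rule smooth_on_if_Cinf_on[OF open_UNIV _ subset_UNIV])
      have "Cinf_on (\<lambda>p::'e\<times>real. \<rho> (fst p)) UNIV"
        by (rule Cinf_on_compose[OF open_UNIV open_UNIV Cinf_on_fst[OF open_UNIV] \<rho>C]) simp
      then show "Cinf_on H UNIV" unfolding H_def
        by (intro Cinf_on_add Cinf_on_scaleR Cinf_on_mult Cinf_on_const Cinf_on_fst Cinf_on_snd open_UNIV)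
    qed
    have smH': "smooth_on H' (D \<times> {0..1})"
      by (rule smooth_on_if_Cinf_on[OF _ H'(1)]) (auto intro: open_Times)
    have defH: "chart_deformation c K H"
      unfolding chart_deformation_def using smH HD eqv stay DE by (auto simp: D_def G_def)
    have H'stay: "H' (s, t) = s" if "s \<in> D - K" "t \<in> {0..1}" for s t
      using H'H[OF that(2), of s] stay[of s t] that(1) DE by auto
    have defH': "chart_deformation c K H'"
      unfolding chart_deformation_def using smH' H'D eqv' H'stay by (auto simp: D_def G_def)
    have pair: "isotopy_pair E X A (chart_move c H) (chart_move c H')"
      by (rule chart_move_isotopy_pair[OF orb cA lc cK KD defH defH']) (use H'H HH' H in auto)
    have "\<rho> 0 = 1" using \<beta>0 by (simp add: \<rho>_def)
    then have "chart_move c H (Proj c 0, 1) = Proj c w"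
      using chart_move_Proj[OF c defH, of 0 1] D0 by (simp add: D_def H)
    then show ?thesis using wD pair chart_move_outside[of _ c H] by (auto simp: D_def)
  qed
  then show ?thesis using that[OF \<epsilon>] by blast
qed

end

section \<open>Moving points along strata\<close>

definition reachable ::
    "'e::euclidean_space set \<Rightarrow> 'a topology \<Rightarrow> ('e, 'a) orb_chart set \<Rightarrow> 'a set \<Rightarrow> 'a \<Rightarrow> 'a \<Rightarrow> bool" where
  "reachable E X A Z x y \<longleftrightarrow>
     (\<exists>F F'. isotopy_pair E X A F F' \<and> F (x, 1) = y \<and> (\<forall>z\<in>Z. F (z, 1) = z))"

context
  fixes E :: "'e::euclidean_space set" and X :: "'a topology" and A :: "('e, 'a) orb_chart set"
  assumes orb: "orbifold E X A"
begin

lemma reachable_sym: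
  assumes "reachable E X A Z x y" "x \<in> topspace X" "Z \<subseteq> topspace X"
  shows "reachable E X A Z y x"
proof -
  obtain F F' where F: "isotopy_pair E X A F F'" "F (x, 1) = y" "\<forall>z\<in>Z. F (z, 1) = z"
    using assms(1) unfolding reachable_def by blast
  have inv: "F' (F (z, 1), 1) = z" if "z \<in> topspace X" for z
    using F(1) that unfolding isotopy_pair_def by auto
  have "F' (y, 1) = x" using inv[OF assms(2)] F(2) by simp
  moreover have "F' (z, 1) = z" if "z \<in> Z" for z using inv[of z] F(3) assms(3) that by auto
  ultimately show ?thesis unfolding reachable_def using isotopy_pair_swap[OF orb F(1)] by blast
qed

lemma reachable_trans:
  assumes "reachable E X A Z x y" "reachable E X A Z y z"
  shows "reachable E X A Z x z"
proof -
  obtain F F' where F: "isotopy_pair E X A F F'" "F (x, 1) = y" "\<forall>z\<in>Z. F (z, 1) = z"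
    using assms(1) unfolding reachable_def by blast
  obtain G G' where G: "isotopy_pair E X A G G'" "G (y, 1) = z" "\<forall>z\<in>Z. G (z, 1) = z"
    using assms(2) unfolding reachable_def by blast
  show ?thesis unfolding reachable_def
    by (rule exI, rule exI, rule conjI[OF isotopy_pair_compose[OF orb G(1) F(1)]]) (use F G in auto)
qed

lemma closedin_finite: "finite Z \<Longrightarrow> Z \<subseteq> topspace X \<Longrightarrow> closedin X Z"
  using orbifold_Hausdorff[OF orb] Hausdorff_imp_t1_space t1_space_closedin_finite by blast

text \<open>The isotopy is supported in a linear chart at \<open>p\<close> that avoids \<open>Z\<close>.\<close>

lemma reachable_nearby:
  assumes p: "p \<in> topspace X" "p \<notin> Z" and Z: "finite Z" "Z \<subseteq> topspace X"
  obtains N where "openin X N" "p \<in> N" "\<forall>q\<in>N. sdim E A q = sdim E A p \<longrightarrow> reachable E X A Z p q"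
proof -
  have Q: "openin X (topspace X - Z)" using closedin_finite[OF Z] by (simp add: closedin_def)
  have pQ: "p \<in> topspace X - Z" using p by blast
  obtain c \<L> where c: "c \<in> A" "linear_chart E c \<L>" "Proj c 0 = p" "chart_image c \<subseteq> topspace X - Z"
    by (rule linear_chart_exists[OF orb p(1) Q pQ]) (erule that; assumption)
  note cc = atlas_chart[OF orb c(1)]
  obtain \<epsilon> where e: "\<epsilon> > 0"
    "\<forall>w\<in>fixed_subspace E \<L>. norm w < \<epsilon> \<longrightarrow> w \<in> Dom c \<and> (\<exists>F F'. isotopy_pair E X A F F' \<and>
       F (Proj c 0, 1) = Proj c w \<and> (\<forall>x\<in>topspace X - chart_image c. \<forall>t\<in>{0..1}. F (x, t) = x))"
    by (rule linear_chart_push[OF orb c(1,2)]) (erule that; assumption)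
  have 0: "0 \<in> Dom c" using c(2) by (simp add: linear_chart_def)
  show ?thesis
  proof (rule that[of "Proj c ` (Dom c \<inter> ball 0 \<epsilon>)"])
    show "openin X (Proj c ` (Dom c \<inter> ball 0 \<epsilon>))"
      by (rule chart_Proj(2)[OF cc]) (rule openin_open_Int[OF open_ball])
    show "p \<in> Proj c ` (Dom c \<inter> ball 0 \<epsilon>)" using 0 e(1) c(3) by force
    show "\<forall>q\<in>Proj c ` (Dom c \<inter> ball 0 \<epsilon>). sdim E A q = sdim E A p \<longrightarrow> reachable E X A Z p q"
    proof (intro ballI impI)
      fix q assume "q \<in> Proj c ` (Dom c \<inter> ball 0 \<epsilon>)" and sd: "sdim E A q = sdim E A p"
      then obtain w where w: "w \<in> Dom c" "norm w < \<epsilon>" "q = Proj c w" by auto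
      have "w \<in> fixed_subspace E \<L>"
        using linear_chart_stratum_iff[OF orb c(1,2) w(1)] sd w(3) c(3) by simp
      then obtain F F' where F: "isotopy_pair E X A F F'" "F (Proj c 0, 1) = Proj c w"
        "\<forall>x\<in>topspace X - chart_image c. \<forall>t\<in>{0..1}. F (x, t) = x"
        using e(2) w(2) by blast
      have "F (z, 1) = z" if z: "z \<in> Z" for z
      proof -
        have "z \<in> topspace X - chart_image c" using z Z(2) c(4) by blast
        then show ?thesis using F(3)[rule_format, of z 1] by simp
      qed
      then show "reachable E X A Z p q" unfolding reachable_def using F(1,2) w(3) c(3) by blast
    qed
  qed
qed

lemma reachable_refl:
  assumes "p \<in> topspace X" "p \<notin> Z" "finite Z" "Z \<subseteq> topspace X"
  shows "reachable E X A Z p p"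
proof -
  obtain N where "openin X N" "p \<in> N" "\<forall>q\<in>N. sdim E A q = sdim E A p \<longrightarrow> reachable E X A Z p q"
    by (rule reachable_nearby[OF assms]) (erule that; assumption)
  then show ?thesis by blast
qed

text \<open>On a stratum without \<open>Z\<close>, reachability is an equivalence relation with open classes.\<close>

lemma reachable_in_connected:
  assumes T: "connectedin X T" "T \<subseteq> stratum E X A k - Z" and Z: "finite Z" "Z \<subseteq> topspace X"
    and xy: "x \<in> T" "y \<in> T"
  shows "reachable E X A Z x y"
proof (rule ccontr)
  let ?R = "reachable E X A Z"
  assume n: "\<not> ?R x y"
  have T': "q \<in> topspace X" "q \<notin> Z" "sdim E A q = k" if "q \<in> T" for q
    using T(2) that by (auto simp: stratum_def)
  have "\<exists>N. openin X N \<and> q \<in> N \<and> (\<forall>s\<in>N. sdim E A s = sdim E A q \<longrightarrow> ?R q s)" if q: "q \<in> T" for q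
    by (rule reachable_nearby[OF T'(1,2)[OF q] Z]) blast
  then obtain N where N: "\<And>q. q \<in> T \<Longrightarrow> openin X (N q)" "\<And>q. q \<in> T \<Longrightarrow> q \<in> N q"
    "\<And>q s. q \<in> T \<Longrightarrow> s \<in> N q \<Longrightarrow> sdim E A s = sdim E A q \<Longrightarrow> ?R q s" by metis
  define U where "U = (\<Union>q\<in>{q\<in>T. ?R x q}. N q)"
  define V where "V = (\<Union>q\<in>{q\<in>T. \<not> ?R x q}. N q)"
  have "openin X U" "openin X V" unfolding U_def V_def using N(1) by auto
  moreover have "T \<subseteq> U \<union> V" unfolding U_def V_def using N(2) by blast
  moreover have "U \<inter> V \<inter> T = {}"
  proof (rule ccontr)
    assume "U \<inter> V \<inter> T \<noteq> {}"
    then obtain s q q' where s: "s \<in> T" "q \<in> T" "?R x q" "s \<in> N q" "q' \<in> T" "\<not> ?R x q'" "s \<in> N q'"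
      unfolding U_def V_def by blast
    have "?R q s" "?R q' s" using N(3) s T'(3) by auto
    then have "?R x q'" using reachable_trans reachable_sym s T'(1) Z(2) by metis
    then show False using s by blast
  qed
  moreover have "U \<inter> T \<noteq> {}"
  proof -
    have "?R x x" by (rule reachable_refl[OF T'(1,2)[OF xy(1)] Z])
    then show ?thesis unfolding U_def using N(2) xy(1) by blast
  qed
  moreover have "V \<inter> T \<noteq> {}" unfolding V_def using N(2) xy(2) n by blast
  ultimately show False using T(1) unfolding connectedin by blast
qed

text \<open>Near a point of the \<open>k\<close>-dimensional stratum the stratum is the image of a convex open subset of
  the \<open>k\<close>-dimensional space of fixed vectors, which stays connected without the origin unless
  \<open>k = 1\<close>.\<close>

lemma stratum_punctured_nbhd:
  assumes p: "p \<in> topspace X" and k: "k = sdim E A p" and Z: "finite Z" "Z \<subseteq> topspace X"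
  obtains N where "openin X N" "p \<in> N" "N \<inter> Z \<subseteq> {p}" "connectedin X (N \<inter> stratum E X A k)"
    "k \<noteq> 1 \<longrightarrow> connectedin X (N \<inter> stratum E X A k - {p})"
proof -
  note E = orbifold_subspace[OF orb]
  have Q: "openin X (topspace X - (Z - {p}))"
    using closedin_finite[of "Z - {p}"] Z by (auto simp: closedin_def)
  have pQ: "p \<in> topspace X - (Z - {p})" using p by blast
  obtain c \<L> where c: "c \<in> A" "linear_chart E c \<L>" "Proj c 0 = p" "chart_image c \<subseteq> topspace X - (Z - {p})"
    by (rule linear_chart_exists[OF orb p Q pQ]) (erule that; assumption)
  note cc = atlas_chart[OF orb c(1)]
  define V where "V = fixed_subspace E \<L>"
  define D where "D = Dom c"
  have lin: "linear L" if "L \<in> \<L>" for L using c(2) that by (auto simp: linear_chart_def)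
  have V: "subspace V" unfolding V_def by (rule subspace_fixed_subspace[OF E lin])
  have VE: "V \<subseteq> E" by (auto simp: V_def fixed_subspace_def)
  have 0: "0 \<in> D" and cD: "convex D" using c(2) by (auto simp: linear_chart_def D_def)
  have S: "chart_image c \<inter> stratum E X A k = Proj c ` (D \<inter> V)"
  proof -
    have "Proj c u \<in> stratum E X A k \<longleftrightarrow> u \<in> V" if "u \<in> D" for u
      using linear_chart_stratum_iff[OF orb c(1,2), of u] that chart_image_subset[OF cc] c(3) k
      by (auto simp: stratum_def D_def V_def chart_image_def)
    then show ?thesis by (auto simp: chart_image_def D_def)
  qed
  have inj0: "u = 0" if u: "u \<in> D" "Proj c u = p" for u
  proof -
    obtain \<gamma> where "\<gamma> \<in> Grp c" "u = \<gamma> 0"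
      using chart_Proj_eq_iff[OF cc, of 0 u] u 0 c(3) by (auto simp: D_def)
    moreover have "\<gamma> 0 = 0" if "\<gamma> \<in> Grp c" for \<gamma>
      using that c(2) 0 linear_0[OF lin] by (auto simp: linear_chart_def D_def)
    ultimately show ?thesis by simp
  qed
  have S0: "chart_image c \<inter> stratum E X A k - {p} = Proj c ` (D \<inter> V - {0})"
    unfolding S using inj0 c(3) by auto
  have conn: "connectedin X (Proj c ` W)" if W: "connected W" "W \<subseteq> D" for W
  proof (rule connectedin_continuous_map_image[OF chart_Proj(1)[OF cc]])
    show "connectedin (top_of_set (Dom c)) W" using W by (simp add: connectedin_subtopology D_def)
  qed
  have cDV: "convex (D \<inter> V)" by (intro convex_Int cD subspace_imp_convex V)
  have punctured: "connectedin X (chart_image c \<inter> stratum E X A k - {p})" if k1: "k \<noteq> 1"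
  proof -
    obtain T where T: "open T" "D = E \<inter> T" using chart_Dom(1)[OF cc] unfolding openin_open D_def by blast
    have DV: "D \<inter> V = V \<inter> T" using T(2) VE by blast
    have "openin (top_of_set V) (D \<inter> V)" unfolding DV by (rule openin_open_Int[OF T(1)])
    moreover have "D \<inter> V \<noteq> {}" using 0 subspace_0[OF V] by blast
    ultimately have "aff_dim (D \<inter> V) = aff_dim V"
      by (rule aff_dim_openin[OF _ subspace_imp_affine[OF V]])
    also have "\<dots> = int (dim V)" by (rule aff_dim_subspace[OF V])
    also have "dim V = k"
    proof -
      have "{L \<in> \<L>. L 0 = 0} = \<L>" using lin linear_0 by auto
      then show ?thesis using linear_chart_sdim[OF orb c(1,2), of 0] 0 c(3) k by (simp add: V_def D_def)
    qed
    finally have "aff_dim (D \<inter> V) \<noteq> 1" using k1 by simp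
    then have "connected (D \<inter> V - {0})"
      by (intro path_connected_imp_connected path_connected_punctured_convex cDV)
    then show "connectedin X (chart_image c \<inter> stratum E X A k - {p})"
      unfolding S0 by (rule conn) blast
  qed
  show ?thesis
  proof (rule that[of "chart_image c"])
    show "openin X (chart_image c)" by (rule chart_image_open[OF cc])
    show "p \<in> chart_image c" using 0 c(3) by (auto simp: chart_image_def D_def)
    show "chart_image c \<inter> Z \<subseteq> {p}" using c(4) by blast
    show "connectedin X (chart_image c \<inter> stratum E X A k)"
      unfolding S by (rule conn[OF convex_connected[OF cDV]]) blast
    show "k \<noteq> 1 \<longrightarrow> connectedin X (chart_image c \<inter> stratum E X A k - {p})"
      using punctured by blast
  qed
qed

text \<open>A separation of the complement of \<open>Z\<close> would extend over each point of \<open>Z\<close>, because the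
  punctured neighbourhood of the point lies entirely on one side.\<close>

lemma connectedin_stratum_component_minus_finite:
  assumes k: "k \<noteq> 1" and x: "x \<in> stratum E X A k" and Z: "finite Z" "Z \<subseteq> topspace X"
    and C: "C = connected_component_of_set (subtopology X (stratum E X A k)) x"
  shows "connectedin X (C - Z)"
proof (rule ccontr)
  let ?S = "stratum E X A k"
  have conC: "connectedin X C"
    using connectedin_connected_component_of[of "subtopology X ?S" x] unfolding C connectedin_subtopology by blast
  have CS: "C \<subseteq> ?S"
    using connectedin_connected_component_of[of "subtopology X ?S" x] unfolding C connectedin_subtopology by blast
  have Ct: "C \<subseteq> topspace X" by (rule connectedin_subset_topspace[OF conC])
  assume "\<not> connectedin X (C - Z)"
  then obtain P Q where P: "openin X P" and Q: "openin X Q" and cov: "C - Z \<subseteq> P \<union> Q"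
    and dis: "P \<inter> Q \<inter> (C - Z) = {}" and ne: "P \<inter> (C - Z) \<noteq> {}" "Q \<inter> (C - Z) \<noteq> {}"
    using Ct unfolding connectedin by blast
  have "\<exists>N. openin X N \<and> p \<in> N \<and> N \<inter> Z \<subseteq> {p} \<and> N \<inter> ?S \<subseteq> C \<and> connectedin X (N \<inter> ?S - {p})"
    if p: "p \<in> C" for p
  proof -
    have pk: "p \<in> topspace X" "k = sdim E A p" using p CS by (auto simp: stratum_def)
    obtain N where N: "openin X N" "p \<in> N" "N \<inter> Z \<subseteq> {p}" "connectedin X (N \<inter> ?S)"
      "k \<noteq> 1 \<longrightarrow> connectedin X (N \<inter> ?S - {p})"
      by (rule stratum_punctured_nbhd[OF pk Z]) (erule that; assumption)
    have c: "connectedin (subtopology X ?S) (N \<inter> ?S)"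
      using N(4) by (simp add: connectedin_subtopology)
    have "connected_component_of (subtopology X ?S) x p" using p unfolding C by simp
    then have "connected_component_of (subtopology X ?S) x = connected_component_of (subtopology X ?S) p"
      by (simp only: connected_component_of_equiv)
    then have "C = connected_component_of_set (subtopology X ?S) p" unfolding C by simp
    then have "N \<inter> ?S \<subseteq> C"
      using connected_component_of_maximal[OF c, of p] N(2) p CS by blast
    then show ?thesis using N k by blast
  qed
  then have "\<forall>p\<in>C. \<exists>N. openin X N \<and> p \<in> N \<and> N \<inter> Z \<subseteq> {p} \<and> N \<inter> ?S \<subseteq> C \<and> connectedin X (N \<inter> ?S - {p})"
    by blast
  from bchoice[OF this] obtain N where N': "\<forall>p\<in>C. openin X (N p) \<and> p \<in> N p \<and> N p \<inter> Z \<subseteq> {p} \<and>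
      N p \<inter> ?S \<subseteq> C \<and> connectedin X (N p \<inter> ?S - {p})" ..
  have N: "openin X (N p)" "p \<in> N p" "N p \<inter> Z \<subseteq> {p}" "N p \<inter> ?S \<subseteq> C" "connectedin X (N p \<inter> ?S - {p})"
    if "p \<in> C" for p
    using N' that by simp_all
  define T where "T = (\<lambda>p. N p \<inter> ?S - {p})"
  have TC: "T p \<subseteq> C - Z" if "p \<in> C" for p
    using N(3,4)[OF that] unfolding T_def by blast
  have side: "T p \<subseteq> P \<or> T p \<subseteq> Q" if p: "p \<in> C" for p
  proof -
    have "connectedin X (T p)" using N(5)[OF p] by (simp add: T_def)
    moreover have "T p \<subseteq> P \<union> Q" "P \<inter> Q \<inter> T p = {}" using TC[OF p] cov dis by auto
    ultimately have "P \<inter> T p = {} \<or> Q \<inter> T p = {}" using P Q unfolding connectedin by blast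
    then show ?thesis using \<open>T p \<subseteq> P \<union> Q\<close> by blast
  qed
  have inT: "s \<in> T p" if "s \<in> N p" "s \<in> C" "s \<noteq> p" for s p
    using that CS unfolding T_def by blast
  define U where "U = (P - Z) \<union> (\<Union>p\<in>{p\<in>C \<inter> Z. T p \<subseteq> P}. N p)"
  define V where "V = (Q - Z) \<union> (\<Union>p\<in>{p\<in>C \<inter> Z. \<not> T p \<subseteq> P}. N p)"
  have "openin X (P - Z)" "openin X (Q - Z)" using P Q closedin_finite[OF Z] by (auto intro: openin_diff)
  then have o: "openin X U" "openin X V" unfolding U_def V_def using N(1) by (auto intro!: openin_Un openin_Union)
  have c: "C \<subseteq> U \<union> V" using cov N(2) unfolding U_def V_def by blast
  have d: "s \<notin> V" if s: "s \<in> C" "s \<in> U" for s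
  proof
    assume sV: "s \<in> V"
    have PQ: "s \<notin> Z \<Longrightarrow> s \<in> P \<Longrightarrow> s \<in> Q \<Longrightarrow> False" using dis s(1) by blast
    consider "s \<notin> Z" | "s \<in> Z" by blast
    then show False
    proof cases
      case 1
      have "s \<in> P"
        using s 1 inT unfolding U_def by blast
      moreover have "s \<in> Q"
        using sV s(1) 1 inT side unfolding V_def by blast
      ultimately show False using PQ 1 by blast
    next
      case 2
      obtain p where p: "p \<in> C" "p \<in> Z" "T p \<subseteq> P" "s \<in> N p" using s(2) 2 unfolding U_def by blast
      obtain q where q: "q \<in> C" "q \<in> Z" "\<not> T q \<subseteq> P" "s \<in> N q" using sV 2 unfolding V_def by blast
      have "s = p" "s = q" using N(3)[OF p(1)] N(3)[OF q(1)] p(4) q(4) 2 by auto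
      then show False using p(3) q(3) by simp
    qed
  qed
  have "U \<inter> C \<noteq> {}" "V \<inter> C \<noteq> {}" using ne unfolding U_def V_def by blast+
  moreover have "U \<inter> V \<inter> C = {}" using d by blast
  ultimately show False using conC o c unfolding connectedin by blast
qed

lemma stratum_component_sdim:
  assumes "x \<in> topspace X" "y \<in> stratum_component E X A x"
  shows "y \<in> topspace X" "sdim E A y = sdim E A x" "stratum_component E X A y = stratum_component E X A x"
    "x \<in> stratum_component E X A x"
proof -
  let ?S = "stratum E X A (sdim E A x)"
  have cc: "connected_component_of (subtopology X ?S) x y" using assms(2) by (simp add: stratum_component_def)
  then have y: "y \<in> topspace X \<inter> ?S"
    using connected_component_in_topspace by fastforce
  then show "y \<in> topspace X" and sd: "sdim E A y = sdim E A x" by (auto simp: stratum_def)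
  have xt: "x \<in> topspace (subtopology X ?S)"
    and eq: "connected_component_of (subtopology X ?S) x = connected_component_of (subtopology X ?S) y"
    using cc by (simp_all only: connected_component_of_equiv)
  show "x \<in> stratum_component E X A x"
    using xt unfolding stratum_component_def mem_Collect_eq connected_component_of_refl .
  show "stratum_component E X A y = stratum_component E X A x"
    unfolding stratum_component_def sd eq ..
qed

lemma reachable_in_stratum_component:
  assumes x: "x \<in> topspace X" and Z: "finite Z" "Z \<subseteq> topspace X"
    and pq: "p \<in> stratum_component E X A x" "q \<in> stratum_component E X A x" "p \<notin> Z" "q \<notin> Z"
    and k: "sdim E A x \<noteq> 1 \<or> Z \<inter> stratum_component E X A x = {}"
  shows "reachable E X A Z p q"
proof -
  let ?S = "stratum E X A (sdim E A x)" and ?C = "stratum_component E X A x"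
  have xS: "x \<in> ?S" using x by (simp add: stratum_def)
  have con: "connectedin X ?C" and CS: "?C \<subseteq> ?S"
    using connectedin_connected_component_of[of "subtopology X ?S" x]
    unfolding stratum_component_def connectedin_subtopology by auto
  have "connectedin X (?C - Z)"
  proof (cases "sdim E A x = 1")
    case True
    then have "?C - Z = ?C" using k by blast
    then show ?thesis using con by simp
  next
    case False
    show ?thesis
      by (rule connectedin_stratum_component_minus_finite[OF False xS Z]) (simp add: stratum_component_def)
  qed
  then show ?thesis
    by (rule reachable_in_connected[OF _ _ Z]) (use CS pq in auto)
qed

end

theorem mainTheorem1:
  fixes E :: "'e::euclidean_space set"
    and X :: "'a topology"
    and A :: "('e, 'a) orb_chart set"
    and n :: nat
    and x y :: "nat \<Rightarrow> 'a"
  assumes "orbifold E X A"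
    and "n \<ge> 1"
    and "x ` {1..n} \<subseteq> topspace X" and "inj_on x {1..n}"
    and "y ` {1..n} \<subseteq> topspace X" and "inj_on y {1..n}"
    and "\<forall>i\<in>{1..n}. y i \<in> stratum_component E X A (x i)"
    and "\<forall>C\<in>connected_components_of (subtopology X (stratum E X A 1)).
           card {i \<in> {1..n}. x i \<in> C} \<le> 1"
  shows "\<exists>f. orbifold_diffeomorphism X A f \<and>
             (\<exists>F. orbifold_isotopy X A id f F \<and> compactly_supported X F) \<and>
             (\<forall>i\<in>{1..n}. f (x i) = y i)"
proof -
  note orb = assms(1)
  have xt: "x i \<in> topspace X" and yt: "y i \<in> topspace X" if "i \<in> {1..n}" for i
    using assms(3,5) that by auto
  \<comment> \<open>Only the points that have reached their targets are held fixed in the next step. The other points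
    may be displaced, since every isotopy keeps them in the components of their strata.\<close>
  have "\<exists>F F'. isotopy_pair E X A F F' \<and> (\<forall>i\<in>{1..m}. F (x i, 1) = y i)" if "m \<le> n" for m
    using that
  proof (induction m)
    case 0
    have "reachable E X A {} (x 1) (x 1)" using xt[of 1] assms(2) by (intro reachable_refl[OF orb]) auto
    then show ?case unfolding reachable_def by auto
  next
    case (Suc m)
    then obtain F F' where F: "isotopy_pair E X A F F'" "\<And>i. i \<in> {1..m} \<Longrightarrow> F (x i, 1) = y i" by auto
    define j where "j = Suc m"
    have j: "j \<in> {1..n}" using Suc.prems by (simp add: j_def)
    define Z where "Z = y ` {1..m}"
    define p where "p = F (x j, 1)"
    let ?C = "stratum_component E X A (x j)"
    have Z: "finite Z" "Z \<subseteq> topspace X" using yt Suc.prems by (auto simp: Z_def)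
    have inv: "F' (F (q, 1), 1) = q" if "q \<in> topspace X" for q
      using F(1) that unfolding isotopy_pair_def by auto
    have pZ: "p \<notin> Z"
    proof
      assume "p \<in> Z"
      then obtain i where i: "i \<in> {1..m}" "F (x j, 1) = y i" by (auto simp: Z_def p_def)
      then have "F (x j, 1) = F (x i, 1)" using F(2) by simp
      moreover have "i \<in> {1..n}" using i Suc.prems by simp
      ultimately have "x j = x i" using inv[OF xt[OF j]] inv[OF xt] by metis
      then have "j = i" using assms(4) j \<open>i \<in> {1..n}\<close> by (auto dest: inj_onD)
      then show False using i by (simp add: j_def)
    qed
    have yZ: "y j \<notin> Z"
    proof
      assume "y j \<in> Z"
      then obtain i where i: "i \<in> {1..m}" "y j = y i" by (auto simp: Z_def)
      then have "j = i" using assms(6) j Suc.prems by (auto dest: inj_onD)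
      then show False using i by (simp add: j_def)
    qed
    have pC: "p \<in> ?C" unfolding p_def by (rule isotopy_pair_stratum_component[OF orb F(1) xt[OF j]])
    have yC: "y j \<in> ?C" using assms(7) j by blast
    have k: "sdim E A (x j) \<noteq> 1 \<or> Z \<inter> ?C = {}"
    proof (rule ccontr)
      assume "\<not> (sdim E A (x j) \<noteq> 1 \<or> Z \<inter> ?C = {})"
      then have k1: "sdim E A (x j) = 1" and "Z \<inter> ?C \<noteq> {}" by auto
      then obtain i where i: "i \<in> {1..m}" "y i \<in> ?C" unfolding Z_def by blast
      have iN: "i \<in> {1..n}" using i Suc.prems by simp
      have "y i \<in> stratum_component E X A (x i)" using assms(7) iN by blast
      note ci = stratum_component_sdim[OF orb xt[OF iN] this]
      note cj = stratum_component_sdim[OF orb xt[OF j] i(2)]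
      have C: "?C = connected_component_of_set (subtopology X (stratum E X A 1)) (x j)"
        by (simp add: stratum_component_def k1)
      have "x j \<in> topspace (subtopology X (stratum E X A 1))" using xt[OF j] k1 by (simp add: stratum_def)
      then have "?C \<in> connected_components_of (subtopology X (stratum E X A 1))"
        unfolding C connected_components_of_def by blast
      then have card: "card {l \<in> {1..n}. x l \<in> ?C} \<le> 1" using assms(8) by blast
      have "{i, j} \<subseteq> {l \<in> {1..n}. x l \<in> ?C}" using iN j ci(3,4) cj(3,4) by simp
      then have "card {i, j} \<le> 1" using card card_mono[of "{l \<in> {1..n}. x l \<in> ?C}" "{i, j}"] by simp
      then show False using i by (simp add: j_def)
    qed
    have "reachable E X A Z p (y j)"
      by (rule reachable_in_stratum_component[OF orb xt[OF j] Z pC yC pZ yZ k])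
    then obtain G G' where G: "isotopy_pair E X A G G'" "G (p, 1) = y j" "\<forall>z\<in>Z. G (z, 1) = z"
      unfolding reachable_def by blast
    have "G (F (x i, 1), 1) = y i" if i: "i \<in> {1..Suc m}" for i
    proof (cases "i = j")
      case True
      then show ?thesis using G(2) by (simp add: p_def)
    next
      case False
      then have "i \<in> {1..m}" using i by (simp add: j_def)
      then show ?thesis using F(2) G(3) by (simp add: Z_def)
    qed
    then show ?case using isotopy_pair_compose[OF orb G(1) F(1)] by (intro exI conjI) auto
  qed
  then obtain F F' where F: "isotopy_pair E X A F F'" "\<forall>i\<in>{1..n}. F (x i, 1) = y i" by blast
  note iso = isotopy_pair_isotopy[OF orb F(1)]
  show ?thesis
    using iso F(2) by (intro exI[of _ "\<lambda>x. F (x, 1)"] conjI exI[of _ F]) auto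
qed

end
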